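(* Let $K\ge 2$ and $L\ge 1$ be integers, let $\Lambda$ be the $2K\times 3L$ triangular grid with periodic boundary conditions, and let $\{X^\beta_t\}_{t\in\mathbb N}$ be the Metropolis Markov chain corresponding to the hard-core dynamics on $\Lambda$ at inverse temperature $\beta>0$. Define $$\Gamma(\Lambda):=\min\{K,2L\}+1 .$$ Then: (i) for every $\varepsilon>0$, $\displaystyle \lim_{\beta\to\infty}\mathbb P_\beta\Big(e^{\beta(\Gamma(\Lambda)-\varepsilon)}\le \tau^{\mathbf a}_{\{\mathbf b,\mathbf c\}}\le \tau^{\mathbf a}_{\mathbf b}\le e^{\beta(\Gamma(\Lambda)+\varepsilon)}\Big)=1$; (ii) $\displaystyle \lim_{\beta\to\infty}\frac1\beta\log\mathbb E\,\tau^{\mathbf a}_{\mathbf b}=\Gamma(\Lambda)=\lim_{\beta\to\infty}\frac1\beta\log\mathbb E\,\tau^{\mathbf a}_{\{\mathbf b,\mathbf c\}}$; (iii) $\displaystyle \frac{\tau^{\mathbf a}_{\{\mathbf b,\mathbf c\}}}{\mathbb E\,\tau^{\mathbf a}_{\{\mathbf b,\mathbf c\}}}\xrightarrow{d}\mathrm{Exp}(1)$ as $\beta\to\infty$; (iv) $\displaystyle \frac{\tau^{\mathbf a}_{\mathbf b}}{\mathbb E\,\tau^{\mathbf a}_{\mathbf b}}\xrightarrow{d}\mathrm{Exp}(1)$ as $\beta\to\infty$.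
   Context: Triangular grid. For integers $K\ge2$, $L\ge1$, the $2K\times 3L$ triangular grid $\Lambda=(V,E)$ with periodic boundary conditions has vertex set (sites) $V=\{(x,y)\in \mathbb Z/6L\mathbb Z\times\mathbb Z/2K\mathbb Z : x\equiv y \pmod 2\}$ (so there are $2K$ rows, indexed by $y$, of $3L$ sites each, and $6L$ columns, indexed by $x$, of $K$ sites each), and the six neighbors of $(x,y)$ are $(x\pm2,y)$ and $(x\pm1,y\pm1)$ (all four sign choices). Let $N=|V|=6KL$. The sets $V_{\mathbf a},V_{\mathbf b},V_{\mathbf c}$ consist of the sites $(x,y)$ with $x\equiv 0,1,2\pmod 3$, respectively; they form a tripartition of $\Lambda$, each of size $2KL$. Hard-core configurations. $\mathcal X$ is the set of maps $\sigma:V\to\{0,1\}$ with $\sigma(v)\sigma(w)=0$ for every pair of neighboring sites $v,w$. The configurations $\mathbf a,\mathbf b,\mathbf c\in\mathcal X$ are the indicator functions of $V_{\mathbf a},V_{\mathbf b},V_{\mathbf c}$, respectively. Dynamics. The Hamiltonian is $H(\sigma)=-\sum_{v\in V}\sigma(v)$. For $\sigma\ne\sigma'$ in $\mathcal X$, $Q(\sigma,\sigma')=1/N$ if $\sigma,\sigma'$ differ at exactly one site and $Q(\sigma,\sigma')=0$ otherwise. The Metropolis Markov chain $\{X^\beta_t\}_{t\in\mathbb N}$ (discrete time $t=0,1,2,\dots$) on $\mathcal X$ has transition probabilities $P_\beta(\sigma,\sigma')=Q(\sigma,\sigma')e^{-\beta[H(\sigma')-H(\sigma)]^+}$ for $\sigma\ne\sigma'$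 and $P_\beta(\sigma,\sigma)=1-\sum_{\eta\ne\sigma}P_\beta(\sigma,\eta)$. Hitting times. For nonempty $A\subset\mathcal X$ and $\sigma\in\mathcal X$, $\tau^\sigma_A=\inf\{t\in\mathbb N: X^\beta_t\in A\}$ for the chain started at $X^\beta_0=\sigma$; $\tau^{\mathbf a}_{\mathbf b}$ means $\tau^{\mathbf a}_{\{\mathbf b\}}$. In (i) both hitting times are defined for the same chain started at $\mathbf a$. $\mathrm{Exp}(1)$ is the exponential distribution with mean 1 and $\xrightarrow{d}$ is convergence in distribution. *)

theory Defs
  imports "HOL-Probability.Probability" "HOL-Number_Theory.Cong"
begin

section \<open>The triangular grid\<close>

text \<open>
  Residue classes in \<open>\<int>/6L\<int>\<close> and \<open>\<int>/2K\<int>\<close> are represented by their least non-negative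
  members. Parities, and the residue of \<open>x\<close> modulo 3, do not depend on the representative since
  \<open>6L\<close> and \<open>2K\<close> are even and \<open>6L\<close> is a multiple of 3.
\<close>

type_synonym site = "int \<times> int"

definition sites :: "nat \<Rightarrow> nat \<Rightarrow> site set" where
  "sites K L = {(x, y). 0 \<le> x \<and> x < 6 * int L \<and> 0 \<le> y \<and> y < 2 * int K \<and> [x = y] (mod 2)}"

definition neighbors :: "nat \<Rightarrow> nat \<Rightarrow> site \<Rightarrow> site \<Rightarrow> bool" where
  "neighbors K L v w \<longleftrightarrow> v \<in> sites K L \<and> w \<in> sites K L \<and>
     (\<exists>(dx, dy) \<in> {(2, 0), (-2, 0), (1, 1), (1, -1), (-1, 1), (-1, -1)}.
        [fst w = fst v + dx] (mod 6 * int L) \<and> [snd w = snd v + dy] (mod 2 * int K))"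

definition sites_mod :: "nat \<Rightarrow> nat \<Rightarrow> int \<Rightarrow> site set" where
  "sites_mod K L r = {v \<in> sites K L. [fst v = r] (mod 3)}"


section \<open>Hard-core configurations\<close>

type_synonym conf = "site \<Rightarrow> nat"

definition hc_confs :: "nat \<Rightarrow> nat \<Rightarrow> conf set" where
  "hc_confs K L = {\<sigma> \<in> sites K L \<rightarrow>\<^sub>E {0, 1}. \<forall>v w. neighbors K L v w \<longrightarrow> \<sigma> v * \<sigma> w = 0}"

definition indicator_conf :: "nat \<Rightarrow> nat \<Rightarrow> site set \<Rightarrow> conf" where
  "indicator_conf K L S = (\<lambda>v \<in> sites K L. indicator S v)"

definition conf_a :: "nat \<Rightarrow> nat \<Rightarrow> conf" where
  "conf_a K L = indicator_conf K L (sites_mod K L 0)"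

definition conf_b :: "nat \<Rightarrow> nat \<Rightarrow> conf" where
  "conf_b K L = indicator_conf K L (sites_mod K L 1)"

definition conf_c :: "nat \<Rightarrow> nat \<Rightarrow> conf" where
  "conf_c K L = indicator_conf K L (sites_mod K L 2)"


section \<open>Metropolis dynamics\<close>

definition Hamiltonian :: "nat \<Rightarrow> nat \<Rightarrow> conf \<Rightarrow> real" where
  "Hamiltonian K L \<sigma> = - (\<Sum>v \<in> sites K L. real (\<sigma> v))"

definition connectivity :: "nat \<Rightarrow> nat \<Rightarrow> conf \<Rightarrow> conf \<Rightarrow> real" where
  "connectivity K L \<sigma> \<eta> =
     (if card {v \<in> sites K L. \<sigma> v \<noteq> \<eta> v} = 1 then 1 / real (card (sites K L)) else 0)"

definition metropolis_rate :: "nat \<Rightarrow> nat \<Rightarrow> real \<Rightarrow> conf \<Rightarrow> conf \<Rightarrow> real" where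
  "metropolis_rate K L \<beta> \<sigma> \<eta> =
     connectivity K L \<sigma> \<eta> * exp (- \<beta> * max 0 (Hamiltonian K L \<eta> - Hamiltonian K L \<sigma>))"

definition metropolis_prob :: "nat \<Rightarrow> nat \<Rightarrow> real \<Rightarrow> conf \<Rightarrow> conf \<Rightarrow> real" where
  "metropolis_prob K L \<beta> \<sigma> \<eta> =
     (if \<sigma> = \<eta> then 1 - (\<Sum>\<zeta> \<in> hc_confs K L - {\<sigma>}. metropolis_rate K L \<beta> \<sigma> \<zeta>)
      else metropolis_rate K L \<beta> \<sigma> \<eta>)"

text \<open>
  A process \<open>X\<close> on a probability space \<open>M\<close> is a time-homogeneous Markov chain on the (finite) state
  space \<open>S\<close> with transition probabilities \<open>p\<close>, started at \<open>s\<^sub>0\<close>.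
\<close>

definition markov_chain ::
  "'s set \<Rightarrow> ('s \<Rightarrow> 's \<Rightarrow> real) \<Rightarrow> 's \<Rightarrow> 'w measure \<Rightarrow> (nat \<Rightarrow> 'w \<Rightarrow> 's) \<Rightarrow> bool" where
  "markov_chain S p s\<^sub>0 M X \<longleftrightarrow>
     prob_space M \<and>
     (\<forall>t. X t \<in> measurable M (count_space S)) \<and>
     (AE \<omega> in M. X 0 \<omega> = s\<^sub>0) \<and>
     (\<forall>t s. (\<forall>i. s i \<in> S) \<longrightarrow> \<P>(\<omega> in M. \<forall>i\<le>t. X i \<omega> = s i) \<noteq> 0 \<longrightarrow>
        \<P>(\<omega> in M. X (Suc t) \<omega> = s (Suc t) \<bar> \<forall>i\<le>t. X i \<omega> = s i) = p (s t) (s (Suc t)))"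

definition metropolis_chain ::
  "nat \<Rightarrow> nat \<Rightarrow> real \<Rightarrow> conf \<Rightarrow> 'w measure \<Rightarrow> (nat \<Rightarrow> 'w \<Rightarrow> conf) \<Rightarrow> bool" where
  "metropolis_chain K L \<beta> = markov_chain (hc_confs K L) (metropolis_prob K L \<beta>)"


section \<open>Hitting times\<close>

text \<open>\<open>\<infinity>\<close> if the set is never hit.\<close>

definition hitting_time :: "(nat \<Rightarrow> 'w \<Rightarrow> 's) \<Rightarrow> 's set \<Rightarrow> 'w \<Rightarrow> enat" where
  "hitting_time X A \<omega> = Inf {enat t | t. X t \<omega> \<in> A}"

definition expected_time :: "'w measure \<Rightarrow> ('w \<Rightarrow> enat) \<Rightarrow> ennreal" where
  "expected_time M \<tau> = (\<integral>\<^sup>+ \<omega>. ennreal_of_enat (\<tau> \<omega>) \<partial>M)"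

text \<open>
  \<open>(1/\<beta>) log E \<tau>\<close> and \<open>\<tau> / E \<tau>\<close> as real numbers. The conversion \<^const>\<open>enn2real\<close> sends \<open>\<infinity>\<close> to \<open>0\<close>,
  so in case \<open>E \<tau> = \<infinity>\<close> both quantities are \<open>0\<close>. A limit \<open>\<noteq> 0\<close> of the former, or a weak limit
  other than the point mass at \<open>0\<close> of the latter, thus forces \<open>E \<tau> < \<infinity>\<close>
  (and \<open>\<tau> < \<infinity>\<close> almost surely) for all large \<open>\<beta>\<close>.
\<close>

definition log_expected_rate :: "real \<Rightarrow> 'w measure \<Rightarrow> ('w \<Rightarrow> enat) \<Rightarrow> real" where
  "log_expected_rate \<beta> M \<tau> = 1 / \<beta> * ln (enn2real (expected_time M \<tau>))"

definition normalized_time :: "'w measure \<Rightarrow> ('w \<Rightarrow> enat) \<Rightarrow> 'w \<Rightarrow> real" where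
  "normalized_time M \<tau> \<omega> =
     enn2real (ennreal_of_enat (\<tau> \<omega>)) / enn2real (expected_time M \<tau>)"

text \<open>
  Convergence in distribution along a continuous parameter \<open>\<beta> \<rightarrow> \<infinity>\<close>: weak convergence of the laws
  along every sequence of parameters tending to \<open>\<infinity>\<close>.
\<close>

definition conv_in_distr_at_top ::
  "(real \<Rightarrow> 'w measure) \<Rightarrow> (real \<Rightarrow> 'w \<Rightarrow> real) \<Rightarrow> real measure \<Rightarrow> bool" where
  "conv_in_distr_at_top M Y D \<longleftrightarrow>
     (\<forall>b :: nat \<Rightarrow> real. filterlim b at_top sequentially \<longrightarrow>
        weak_conv_m (\<lambda>n. distr (M (b n)) borel (Y (b n))) D)"

definition Exp1 :: "real measure" where
  "Exp1 = density lborel (exponential_density 1)"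

definition barrier :: "nat \<Rightarrow> nat \<Rightarrow> real" where
  "barrier K L = real (min K (2 * L) + 1)"

end

theory Submission
  imports Defs "HOL-Real_Asymp.Real_Asymp"
begin

text \<open>
  The proof has a probabilistic and a combinatorial half, joined by three facts about the energy
  landscape. Let \<open>h = min K (2 L)\<close>, so that \<open>\<Gamma> = h + 1\<close>.

  \<^item> From every configuration some ground state \<open>a\<close>, \<open>b\<close>, \<open>c\<close> is reached by a path that climbs at most
    \<open>h\<close> above its starting energy (\<open>path_to_grounds\<close>).
  \<^item> From every configuration \<open>b\<close> is reached by a path that climbs at most \<open>\<Gamma>\<close> (\<open>path_to_b\<close>).
  \<^item> A path from \<open>a\<close> to \<open>b\<close> or \<open>c\<close> must climb \<open>\<Gamma>\<close> (\<open>basin_a_exit\<close>).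

  For the first two, a particle of the type of one ground state is used as a nucleus: particles of
  this type are added one by one, each after clearing its neighbours, first along a zigzag of two
  rows (loss at most \<open>2 L - 1\<close>) or along a column (loss at most \<open>K\<close>), and then the new phase spreads
  to the rest of the torus almost for free.

  For the third, cut the torus into \<open>K\<close> pairs of rows and into \<open>2 L\<close> triples of columns. Each pair
  holds at most \<open>2 L\<close> particles, with equality only if both rows agree with one ground state; hence
  if fewer than \<open>K\<close> particles are missing, some row is \<^emph>\<open>full\<close> of one type. Each triple holds at most
  \<open>K\<close> particles. If the triples are placed such that their middle columns have the type of a given
  full row, a triple attaining this bound excludes full rows of the other types; hence if fewer than
  \<open>2 L\<close> particles are missing, all full rows have the same type. A step between
  configurations with at most \<open>h\<close> missing particles therefore preserves the set of types of full
  rows: the larger of the two configurations has fewer than \<open>h\<close> missing particles and two adjacent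
  full rows, of which a removal damages only one.

  On the probabilistic side everything is expressed through the survival probabilities
  \<open>f t = P(\<tau> > t)\<close>, which are iterates of a killed transition matrix. Reversibility gives both
  bounds on the time scale: the stationary flux out of the basin of \<open>a\<close> is of order
  \<open>exp (- \<beta> \<Gamma>)\<close> (\<open>exit_probability_le_flux\<close>), and paths of low height give a Poincare inequality,
  hence a spectral gap for the killed matrix and an upper bound on the mean hitting time that is
  uniform in the starting point (\<open>mean_time_upper\<close>). The exponential law follows from a separation
  of scales: the ground states are reached on the scale \<open>exp (\<beta> h)\<close>, which is negligible compared
  with the mean \<open>m\<close> of \<open>\<tau>\<close>, and \<open>\<tau>\<close> has the same law from every ground state outside the target.
  Therefore the mean remaining time after \<open>t\<close>, which is
  \<open>(\<Sum>s. f (t + s)) / f t\<close>, is \<open>m (1 + o(1))\<close> uniformly in \<open>t\<close>, and this forces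
  \<open>f (x m) \<longlonglongrightarrow> exp (- x)\<close>. Outside the target \<open>{b, c}\<close> the only ground state is \<open>a\<close> itself; outside
  the target \<open>{b}\<close> they are \<open>a\<close> and \<open>c\<close>, which are exchanged by a reflection of the torus fixing \<open>b\<close>.
\<close>

section \<open>Survival probabilities of killed chains\<close>

text \<open>
  \<open>killed S p A t g x\<close> is the expectation of \<open>g(X\<^sub>t)\<close> for the chain started in \<open>x\<close>, on the event that
  the times \<open>0, \<dots>, t\<close> avoid \<open>A\<close>. The recursion is the decomposition at the first step, which turns
  strong Markov arguments into inductions on \<open>t\<close>.
\<close>

primrec killed :: "'s set \<Rightarrow> ('s \<Rightarrow> 's \<Rightarrow> real) \<Rightarrow> 's set \<Rightarrow> nat \<Rightarrow> ('s \<Rightarrow> real) \<Rightarrow> 's \<Rightarrow> real" where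
  "killed S p A 0 g x = (if x \<in> A then 0 else g x)"
| "killed S p A (Suc t) g x = (if x \<in> A then 0 else (\<Sum>y\<in>S. p x y * killed S p A t g y))"

definition surv :: "'s set \<Rightarrow> ('s \<Rightarrow> 's \<Rightarrow> real) \<Rightarrow> 's set \<Rightarrow> nat \<Rightarrow> 's \<Rightarrow> real" where
  "surv S p A t = killed S p A t (\<lambda>_. 1)"

lemma killed_in: "x \<in> A \<Longrightarrow> killed S p A t g x = 0"
  by (cases t) auto

lemma killed_scale: "killed S p A t (\<lambda>y. c * g y) x = c * killed S p A t g x"
  by (induction t arbitrary: x) (auto simp: sum_distrib_left mult.left_commute)

lemma killed_diff: "killed S p A t (\<lambda>y. g y - h y) x = killed S p A t g x - killed S p A t h x"
  by (induction t arbitrary: x) (auto simp: sum_subtractf right_diff_distrib)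

lemma killed_sum: "killed S p A t (\<lambda>y. \<Sum>i\<in>I. g i y) x = (\<Sum>i\<in>I. killed S p A t (g i) x)"
proof (induction t arbitrary: x)
  case (Suc t)
  show ?case
    by (simp add: Suc sum_distrib_left sum.swap[of _ I])
qed auto

lemma killed_killed: "killed S p A t (killed S p A s g) x = killed S p A (t + s) g x"
  by (induction t arbitrary: x) (auto simp: killed_in)

lemma surv_in: "x \<in> A \<Longrightarrow> surv S p A t x = 0"
  by (simp add: surv_def killed_in)

lemma surv_0: "x \<notin> A \<Longrightarrow> surv S p A 0 x = 1"
  by (simp add: surv_def)

lemma surv_Suc: "x \<notin> A \<Longrightarrow> surv S p A (Suc t) x = (\<Sum>y\<in>S. p x y * surv S p A t y)"
  by (simp add: surv_def)

lemma killed_surv: "killed S p A t (surv S p A s) x = surv S p A (t + s) x"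
  unfolding surv_def killed_killed ..

lemma killed_const: "killed S p A t (\<lambda>_. c) x = c * surv S p A t x"
  using killed_scale[of S p A t c "\<lambda>_. 1" x] by (simp add: surv_def)

locale stochastic_matrix =
  fixes S :: "'s set" and p :: "'s \<Rightarrow> 's \<Rightarrow> real"
  assumes finite_S: "finite S"
    and p_nonneg: "\<And>x y. x \<in> S \<Longrightarrow> y \<in> S \<Longrightarrow> 0 \<le> p x y"
    and p_sum: "\<And>x. x \<in> S \<Longrightarrow> (\<Sum>y\<in>S. p x y) = 1"
begin

lemma killed_mono:
  assumes "\<And>y. y \<in> S \<Longrightarrow> y \<notin> A \<Longrightarrow> g y \<le> h y" and "x \<in> S"
  shows "killed S p A t g x \<le> killed S p A t h x"
  using assms(2)
proof (induction t arbitrary: x)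
  case (Suc t)
  then show ?case
    by (auto intro!: sum_mono mult_left_mono p_nonneg)
qed (use assms in auto)

lemma surv_nonneg: "x \<in> S \<Longrightarrow> 0 \<le> surv S p A t x"
  using killed_mono[of A "\<lambda>_. 0" "\<lambda>_. 1" x t] killed_const[of S p A t 0 x]
  by (simp add: surv_def)

lemma surv_le_1: "x \<in> S \<Longrightarrow> surv S p A t x \<le> 1"
proof (induction t arbitrary: x)
  case (Suc t)
  have "(\<Sum>y\<in>S. p x y * surv S p A t y) \<le> (\<Sum>y\<in>S. p x y * 1)"
    using Suc by (intro sum_mono mult_left_mono p_nonneg) auto
  then show ?case
    using Suc p_sum[of x] by (cases "x \<in> A") (auto simp: surv_in surv_Suc)
qed (auto simp: surv_def)

lemma surv_antimono: "s \<le> t \<Longrightarrow> x \<in> S \<Longrightarrow> surv S p A t x \<le> surv S p A s x"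
proof -
  assume "s \<le> t" "x \<in> S"
  then have "killed S p A s (surv S p A (t - s)) x \<le> killed S p A s (\<lambda>_. 1) x"
    by (intro killed_mono surv_le_1) auto
  then show ?thesis
    using \<open>s \<le> t\<close> by (simp add: killed_surv surv_def[of S p A s])
qed

lemma surv_antimono_set: "A \<subseteq> B \<Longrightarrow> x \<in> S \<Longrightarrow> surv S p B t x \<le> surv S p A t x"
proof (induction t arbitrary: x)
  case 0
  then show ?case by (auto simp: surv_def)
next
  case (Suc t)
  show ?case
  proof (cases "x \<in> B")
    case True
    then show ?thesis using Suc.prems by (simp add: surv_in surv_nonneg)
  next
    case False
    then have "x \<notin> A" using Suc by auto
    with False show ?thesis
      unfolding surv_Suc[OF False] surv_Suc[OF \<open>x \<notin> A\<close>]
      using Suc by (intro sum_mono mult_left_mono p_nonneg) auto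
  qed
qed

text \<open>
  After \<open>T\<close> steps at most half of the mass survives, wherever the chain starts; so the largest
  truncated mean \<open>s\<close> satisfies \<open>s \<le> T + s / 2\<close>. Truncation makes this argument legitimate before
  summability is known.
\<close>

lemma surv_partial_sum_le:
  assumes half: "\<And>x. x \<in> S \<Longrightarrow> surv S p A T x \<le> 1 / 2" and x: "x \<in> S"
  shows "(\<Sum>t<n. surv S p A t x) \<le> 2 * real T"
proof -
  define G where "G = (\<lambda>y. \<Sum>t<n. surv S p A t y)"
  define s where "s = Max (G ` S)"
  have le_s: "G y \<le> s" if "y \<in> S" for y
    unfolding s_def using that finite_S by auto
  have bound: "G y \<le> real T + s / 2" if y: "y \<in> S" for y
  proof -
    have s0: "0 \<le> s"
      using le_s[OF y] sum_nonneg[of "{..<n}" "\<lambda>t. surv S p A t y"] surv_nonneg[OF y]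
      by (simp add: G_def)
    have "G y \<le> (\<Sum>t<T + n. surv S p A t y)"
      unfolding G_def using y by (intro sum_mono2) (auto simp: surv_nonneg)
    also have "\<dots> = (\<Sum>t<T. surv S p A t y) + (\<Sum>t<n. surv S p A (T + t) y)"
      by (induction n) auto
    also have "(\<Sum>t<n. surv S p A (T + t) y) = killed S p A T G y"
      unfolding G_def killed_sum killed_surv ..
    also have "\<dots> \<le> killed S p A T (\<lambda>_. s) y"
      using le_s y by (intro killed_mono) auto
    also have "\<dots> = s * surv S p A T y" by (rule killed_const)
    also have "\<dots> \<le> s * (1 / 2)"
      using half[OF y] s0 by (intro mult_left_mono) auto
    also have "(\<Sum>t<T. surv S p A t y) \<le> (\<Sum>t<T. 1)"
      using y by (intro sum_mono) (auto simp: surv_le_1)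
    finally show ?thesis by simp
  qed
  have "s \<in> G ` S"
    unfolding s_def using x finite_S by (intro Max_in) auto
  then have "s \<le> real T + s / 2" using bound by auto
  then show ?thesis using le_s[OF x] by (simp add: G_def)
qed

lemma surv_markov_ineq:
  assumes "\<And>n. (\<Sum>t<n. surv S p A t x) \<le> R" and "x \<in> S"
  shows "real r * surv S p A r x \<le> R"
proof -
  have "real r * surv S p A r x = (\<Sum>t<r. surv S p A r x)" by simp
  also have "\<dots> \<le> (\<Sum>t<r. surv S p A t x)"
    using assms by (intro sum_mono surv_antimono) auto
  finally show ?thesis using assms(1)[of r] by simp
qed

text \<open>
  Until it visits \<open>T\<close> the chain cannot tell \<open>A\<close> from \<open>A \<union> T\<close>, and after a visit to \<open>T\<close> it needs at most
  \<open>m\<close> further steps on average.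
\<close>

lemma surv_via_upper:
  assumes m: "\<And>y n. y \<in> T \<inter> S \<Longrightarrow> (\<Sum>t<n. surv S p A t y) \<le> m" and "0 \<le> m" and x: "x \<in> S"
  shows "(\<Sum>t<n. surv S p A t x) \<le> (\<Sum>t<n. surv S p (A \<union> T) t x) + m"
  using x
proof (induction n arbitrary: x)
  case (Suc n)
  consider "x \<in> A" | "x \<in> T" | "x \<notin> A \<union> T" by auto
  then show ?case
  proof cases
    case 1
    then show ?thesis using \<open>0 \<le> m\<close> by (simp add: surv_in del: sum.lessThan_Suc)
  next
    case 2
    then show ?thesis
      using m[of x "Suc n"] Suc.prems by (simp add: surv_in del: sum.lessThan_Suc)
  next
    case 3
    have first_step: "(\<Sum>t<Suc n. surv S p B t x) = 1 + (\<Sum>y\<in>S. p x y * (\<Sum>t<n. surv S p B t y))"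
      if "x \<notin> B" for B
    proof -
      have "(\<Sum>t<Suc n. surv S p B t x) = 1 + (\<Sum>t<n. surv S p B (Suc t) x)"
        using surv_0[OF that] by (subst sum.lessThan_Suc_shift) simp
      also have "(\<Sum>t<n. surv S p B (Suc t) x) = (\<Sum>y\<in>S. p x y * (\<Sum>t<n. surv S p B t y))"
        using that by (simp add: surv_Suc sum_distrib_left sum.swap[of _ _ "{..<n}"])
      finally show ?thesis .
    qed
    have "(\<Sum>y\<in>S. p x y * (\<Sum>t<n. surv S p A t y))
        \<le> (\<Sum>y\<in>S. p x y * ((\<Sum>t<n. surv S p (A \<union> T) t y) + m))"
      using Suc by (intro sum_mono mult_left_mono p_nonneg) auto
    also have "\<dots> = (\<Sum>y\<in>S. p x y * (\<Sum>t<n. surv S p (A \<union> T) t y)) + m"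
      using p_sum[OF Suc.prems] by (simp add: distrib_left sum.distrib flip: sum_distrib_right)
    finally show ?thesis
      using 3 by (subst (1 2) first_step) auto
  qed
qed (use \<open>0 \<le> m\<close> in auto)

text \<open>
  If \<open>A\<close> is avoided for \<open>r\<close> steps but \<open>A \<union> T\<close> is not, then \<open>T\<close> is visited before \<open>A\<close>, and from the
  visited state the chain survives \<open>s\<close> more steps with probability at least \<open>f\<close>.
\<close>

lemma surv_via_lower:
  assumes f: "\<And>y. y \<in> T \<inter> S \<Longrightarrow> f \<le> surv S p A s y" and f01: "0 \<le> f" "f \<le> 1" and x: "x \<in> S"
  shows "(surv S p A r x - surv S p (A \<union> T) r x) * f \<le> surv S p A s x"
  using x
proof (induction r arbitrary: x)
  case 0
  consider "x \<in> A" | "x \<in> T" "x \<notin> A" | "x \<notin> A \<union> T" by auto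
  then show ?case
    by cases (use f 0 in \<open>auto simp: surv_in surv_0 surv_nonneg\<close>)
next
  case (Suc r)
  consider "x \<in> A" | "x \<in> T" "x \<notin> A" | "x \<notin> A \<union> T" by auto
  then show ?case
  proof cases
    case 1
    then show ?thesis by (simp add: surv_in)
  next
    case 2
    have "surv S p A (Suc r) x * f \<le> 1 * f"
      using Suc f01 by (intro mult_right_mono surv_le_1) auto
    then show ?thesis using f[of x] 2 Suc by (simp add: surv_in)
  next
    case 3
    show ?thesis
    proof (cases s)
      case 0
      have "(surv S p A (Suc r) x - surv S p (A \<union> T) (Suc r) x) * f \<le> 1 * 1"
        using Suc.prems f01 surv_le_1[of x A "Suc r"] surv_nonneg[of x "A \<union> T" "Suc r"]
        by (intro mult_mono) auto
      with 0 3 show ?thesis by (simp add: surv_0)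
    next
      case s: (Suc s')
      have "(surv S p A (Suc r) x - surv S p (A \<union> T) (Suc r) x) * f
          = (\<Sum>y\<in>S. p x y * ((surv S p A r y - surv S p (A \<union> T) r y) * f))"
        using 3 by (simp add: surv_Suc left_diff_distrib right_diff_distrib sum_subtractf sum_distrib_right mult.assoc)
      also have "\<dots> \<le> (\<Sum>y\<in>S. p x y * surv S p A s' y)"
        using Suc surv_antimono[of s' s] s
        by (intro sum_mono mult_left_mono p_nonneg order_trans[OF Suc.IH]) auto
      also have "\<dots> = surv S p A s x" using 3 s by (simp add: surv_Suc)
      finally show ?thesis .
    qed
  qed
qed

text \<open>
  A surviving chain that reaches \<open>A \<union> T\<close> within \<open>r\<close> steps with probability \<open>1 - d\<close> has to reach \<open>T\<close>,
  where its future has the law of a fresh start. The point is that the error is proportional to the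
  survival probability at time \<open>t\<close>, so it remains small deep in the tail.
\<close>

lemma almost_multiplicative:
  assumes "a \<in> S" and f: "\<And>y t. y \<in> T \<inter> S \<Longrightarrow> surv S p A t y = surv S p A t a"
    and d: "\<And>x. x \<in> S \<Longrightarrow> surv S p (A \<union> T) r x \<le> d" and "0 \<le> d"
  shows "(surv S p A (2 * r) a - 2 * d) * surv S p A t a * surv S p A s a \<le> surv S p A (t + s) a"
proof -
  let ?f = "\<lambda>t. surv S p A t a"
  have f01: "0 \<le> ?f t" "?f t \<le> 1" for t
    using \<open>a \<in> S\<close> by (auto simp: surv_nonneg surv_le_1)
  have 1: "(?f (t + r) - d * ?f t) * ?f s \<le> ?f (t + s)" for t s
  proof -
    have "killed S p A t (surv S p (A \<union> T) r) a \<le> killed S p A t (\<lambda>_. d) a"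
      using \<open>a \<in> S\<close> d by (intro killed_mono) auto
    then have "(?f (t + r) - d * ?f t) * ?f s
        \<le> (?f (t + r) - killed S p A t (surv S p (A \<union> T) r) a) * ?f s"
      using f01 by (intro mult_right_mono) (auto simp: killed_const)
    also have "\<dots> = killed S p A t (\<lambda>y. ?f s * (surv S p A r y - surv S p (A \<union> T) r y)) a"
      by (simp add: killed_scale killed_diff killed_surv)
    also have "\<dots> \<le> killed S p A t (surv S p A s) a"
      using \<open>a \<in> S\<close> surv_via_lower[of T "?f s" A s _ r] f f01
      by (intro killed_mono) (auto simp: mult.commute)
    finally show ?thesis by (simp add: killed_surv)
  qed
  (* exchanging the roles of the two times bounds the loss during r steps relative to f t *)
  have 2: "(?f (2 * r) - d) * ?f t \<le> ?f (t + r)" for t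
  proof -
    have "d * ?f r \<le> d * 1" using f01 \<open>0 \<le> d\<close> by (intro mult_left_mono)
    then have "(?f (2 * r) - d) * ?f t \<le> (?f (r + r) - d * ?f r) * ?f t"
      using f01 by (intro mult_right_mono) (auto simp: mult_2)
    also have "\<dots> \<le> ?f (t + r)" using 1[of r t] by (simp add: add.commute)
    finally show ?thesis .
  qed
  have "(?f (2 * r) - 2 * d) * ?f t * ?f s = ((?f (2 * r) - d) * ?f t - d * ?f t) * ?f s"
    by (simp add: algebra_simps)
  also have "\<dots> \<le> (?f (t + r) - d * ?f t) * ?f s"
    using 2[of t] f01 by (intro mult_right_mono) auto
  also have "\<dots> \<le> ?f (t + s)" by (rule 1)
  finally show ?thesis .
qed

text \<open>
  Given survival up to time \<open>t\<close>, the remaining time has mean at most \<open>R\<close> until \<open>A \<union> T\<close> is reached and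
  at most \<open>m\<close> afterwards.
\<close>

lemma residual_mean_upper:
  assumes "a \<in> S" and m: "\<And>y n. y \<in> T \<inter> S \<Longrightarrow> (\<Sum>t<n. surv S p A t y) \<le> m" and "0 \<le> m"
    and R: "\<And>y n. y \<in> S \<Longrightarrow> (\<Sum>t<n. surv S p (A \<union> T) t y) \<le> R"
  shows "(\<Sum>s<n. surv S p A (t + s) a) \<le> surv S p A t a * (m + R)"
proof -
  have "(\<Sum>s<n. surv S p A (t + s) a) = killed S p A t (\<lambda>y. \<Sum>s<n. surv S p A s y) a"
    by (simp add: killed_sum killed_surv)
  also have "\<dots> \<le> killed S p A t (\<lambda>_. m + R) a"
  proof (intro killed_mono \<open>a \<in> S\<close>)
    fix y assume "y \<in> S"
    show "(\<Sum>s<n. surv S p A s y) \<le> m + R"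
      using surv_via_upper[of T A m y n] m \<open>0 \<le> m\<close> \<open>y \<in> S\<close> R[of y n] by fastforce
  qed
  finally show ?thesis by (simp add: killed_const mult.commute)
qed

end

text \<open>
  The residual sums \<open>r t = (\<Sum>s. f (t + s))\<close> satisfy \<open>r (t + 1) = r t - f t\<close>, and by assumption \<open>f t\<close> is
  \<open>r t / m\<close> up to a factor \<open>1 + o(1)\<close>. Hence \<open>r\<close>, and with it \<open>f\<close>, decays by a factor
  \<open>1 - (1 + o(1)) / m\<close> per step, which gives the exponential limit without any compactness argument.
\<close>

lemma exp_limit_of_residual_means:
  fixes f :: "'b \<Rightarrow> nat \<Rightarrow> real"
  assumes f0: "\<forall>\<^sub>F b in F. f b 0 = 1"
    and sums: "\<forall>\<^sub>F b in F. f b sums m b"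
    and res: "\<forall>\<^sub>F b in F. \<forall>t. (1 - \<kappa> b) * f b t * m b \<le> (\<Sum>s. f b (t + s)) \<and>
                (\<Sum>s. f b (t + s)) \<le> (1 + \<kappa> b) * f b t * m b"
    and m: "filterlim m at_top F" and \<kappa>: "(\<kappa> \<longlongrightarrow> 0) F" and x: "0 \<le> x"
  shows "((\<lambda>b. f b (nat \<lfloor>x * m b\<rfloor>)) \<longlongrightarrow> exp (- x)) F"
proof (rule tendsto_sandwich)
  let ?t = "\<lambda>b. nat \<lfloor>x * m b\<rfloor>"
  let ?u = "\<lambda>b. 1 / (m b * (1 + \<kappa> b))" and ?q = "\<lambda>b. 1 / (m b * (1 - \<kappa> b))"
  have m_pos: "\<forall>\<^sub>F b in F. 0 < m b" using m by (auto simp: filterlim_at_top_dense)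
  have inv_m: "((\<lambda>b. 1 / m b) \<longlongrightarrow> 0) F"
    using m by (intro tendsto_divide_0[OF tendsto_const] filterlim_at_top_imp_at_infinity)
  have tm: "((\<lambda>b. real (?t b) / m b) \<longlongrightarrow> x) F"
  proof (rule tendsto_sandwich)
    show "\<forall>\<^sub>F b in F. x - 1 / m b \<le> real (?t b) / m b"
      using m_pos
    proof eventually_elim
      case (elim b)
      have "x * m b - 1 \<le> real (?t b)" by linarith
      then have "(x * m b - 1) / m b \<le> real (?t b) / m b" using elim by (intro divide_right_mono) auto
      then show ?case using elim by (simp add: diff_divide_distrib)
    qed
    show "\<forall>\<^sub>F b in F. real (?t b) / m b \<le> x"
      using m_pos
    proof eventually_elim
      case (elim b)
      then have "0 \<le> x * m b" using x by simp
      then have "real (?t b) \<le> x * m b" by linarith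
      then show ?case using elim by (simp add: pos_divide_le_eq)
    qed
    show "((\<lambda>b. x - 1 / m b) \<longlongrightarrow> x) F"
      using tendsto_diff[OF tendsto_const inv_m, of x] by simp
  qed simp
  have q0: "(?q \<longlongrightarrow> 0) F"
  proof -
    have "((\<lambda>b. (1 / m b) * (1 / (1 - \<kappa> b))) \<longlongrightarrow> 0 * (1 / (1 - 0))) F"
      by (intro tendsto_intros inv_m \<kappa>) auto
    then show ?thesis by simp
  qed
  have \<kappa>_small: "\<forall>\<^sub>F b in F. \<bar>\<kappa> b\<bar> < 1 / 2"
    using tendstoD[OF \<kappa>, of "1 / 2"] by (simp add: dist_real_def)
  have q_small: "\<forall>\<^sub>F b in F. ?q b < 1" using q0 by (auto dest: order_tendstoD(2)[where a = 1])
  have main: "\<forall>\<^sub>F b in F. exp (- (real (?t b) / m b) * (1 / ((1 - \<kappa> b) * (1 - ?q b)))) / (1 + \<kappa> b) \<le> f b (?t b)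
      \<and> f b (?t b) \<le> exp (- (real (?t b) / m b) * (1 / (1 + \<kappa> b))) / (1 - \<kappa> b)"
    using f0 sums res m_pos \<kappa>_small q_small
  proof eventually_elim
    case (elim b)
    define r where "r = (\<lambda>t. \<Sum>s. f b (t + s))"
    have r0: "r 0 = m b" using elim(2) by (simp add: r_def sums_iff)
    have summ: "summable (\<lambda>s. f b (t + s))" for t
      using elim(2) summable_iff_shift[of "f b" t] by (simp add: sums_iff add.commute)
    have rS: "r (Suc t) = r t - f b t" for t
      using suminf_split_head[OF summ[of t]] by (simp add: r_def)
    have k: "0 < 1 - \<kappa> b" "0 < 1 + \<kappa> b" using elim(5) by auto
    have fr: "(1 - \<kappa> b) * f b t * m b \<le> r t" "r t \<le> (1 + \<kappa> b) * f b t * m b" for t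
      using elim(3) by (auto simp: r_def)
    define q where "q = ?q b"
    define u where "u = ?u b"
    have f_up: "f b t \<le> r t * q" and f_lo: "r t * u \<le> f b t" for t
      using fr[of t] k \<open>0 < m b\<close> by (auto simp: q_def u_def pos_divide_le_eq pos_le_divide_eq mult_ac)
    have q01: "0 < q" "q < 1" using k \<open>0 < m b\<close> elim(6) by (auto simp: q_def)
    have step: "r t * (1 - q) \<le> r (Suc t)" "r (Suc t) \<le> r t * (1 - u)" for t
      using f_up[of t] f_lo[of t] by (auto simp: rS right_diff_distrib)
    have lo: "m b * (1 - q) ^ t \<le> r t" for t
    proof (induction t)
      case (Suc t)
      have "m b * (1 - q) ^ Suc t = (m b * (1 - q) ^ t) * (1 - q)" by simp
      also have "\<dots> \<le> r t * (1 - q)" using Suc q01 by (intro mult_right_mono) auto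
      also have "\<dots> \<le> r (Suc t)" by (rule step)
      finally show ?case .
    qed (simp add: r0)
    have r_pos: "0 \<le> r t" for t
      using q01 \<open>0 < m b\<close> by (intro order_trans[OF _ lo[of t]]) simp
    have up: "r t \<le> m b * exp (- u) ^ t" for t
    proof (induction t)
      case (Suc t)
      have "r (Suc t) \<le> r t * (1 - u)" by (rule step)
      also have "\<dots> \<le> r t * exp (- u)"
        using r_pos exp_ge_add_one_self[of "- u"] by (intro mult_left_mono) auto
      also have "\<dots> \<le> (m b * exp (- u) ^ t) * exp (- u)"
        using Suc by (intro mult_right_mono) auto
      finally show ?case by (simp add: mult_ac)
    qed (simp add: r0)
    have exp_q: "exp (- (q / (1 - q))) \<le> 1 - q"
    proof -
      have "1 / (1 - q) = 1 + q / (1 - q)"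
        using q01 by (simp add: field_simps)
      also have "\<dots> \<le> exp (q / (1 - q))" by (rule exp_ge_add_one_self)
      finally show ?thesis using q01 by (simp add: exp_minus field_simps)
    qed
    let ?T = "?t b"
    have "exp (- (real ?T / m b) * (1 / ((1 - \<kappa> b) * (1 - q)))) = exp (- (q / (1 - q))) ^ ?T"
      by (simp add: exp_of_nat_mult[symmetric] q_def)
    also have "\<dots> \<le> (1 - q) ^ ?T" using exp_q by (intro power_mono) auto
    also have "\<dots> \<le> r ?T / m b" using lo[of ?T] \<open>0 < m b\<close> by (simp only: pos_le_divide_eq mult.commute)
    also have "\<dots> \<le> f b ?T * (1 + \<kappa> b)" using fr(2)[of ?T] \<open>0 < m b\<close> by (simp only: pos_divide_le_eq mult_ac)
    finally have A: "exp (- (real ?T / m b) * (1 / ((1 - \<kappa> b) * (1 - ?q b)))) / (1 + \<kappa> b) \<le> f b ?T"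
      using k by (simp add: pos_divide_le_eq q_def)
    have "f b ?T * (1 - \<kappa> b) \<le> r ?T / m b" using fr(1)[of ?T] \<open>0 < m b\<close> by (simp only: pos_le_divide_eq mult_ac)
    also have "\<dots> \<le> exp (- u) ^ ?T" using up[of ?T] \<open>0 < m b\<close> by (simp only: pos_divide_le_eq mult.commute)
    also have "\<dots> = exp (- (real ?T / m b) * (1 / (1 + \<kappa> b)))"
      by (simp add: exp_of_nat_mult[symmetric] u_def)
    finally have B: "f b ?T \<le> exp (- (real ?T / m b) * (1 / (1 + \<kappa> b))) / (1 - \<kappa> b)"
      using k by (simp add: pos_le_divide_eq)
    show ?case using A B by simp
  qed
  show "\<forall>\<^sub>F b in F. exp (- (real (?t b) / m b) * (1 / ((1 - \<kappa> b) * (1 - ?q b)))) / (1 + \<kappa> b) \<le> f b (?t b)"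
    using main by eventually_elim simp
  show "\<forall>\<^sub>F b in F. f b (?t b) \<le> exp (- (real (?t b) / m b) * (1 / (1 + \<kappa> b))) / (1 - \<kappa> b)"
    using main by eventually_elim simp
  have "((\<lambda>b. exp (- (real (?t b) / m b) * (1 / ((1 - \<kappa> b) * (1 - ?q b)))) / (1 + \<kappa> b))
      \<longlongrightarrow> exp (- x * (1 / ((1 - 0) * (1 - 0)))) / (1 + 0)) F"
    by (intro tendsto_intros tm \<kappa> q0) auto
  then show "((\<lambda>b. exp (- (real (?t b) / m b) * (1 / ((1 - \<kappa> b) * (1 - ?q b)))) / (1 + \<kappa> b)) \<longlongrightarrow> exp (- x)) F"
    by simp
  have "((\<lambda>b. exp (- (real (?t b) / m b) * (1 / (1 + \<kappa> b))) / (1 - \<kappa> b))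
      \<longlongrightarrow> exp (- x * (1 / (1 + 0))) / (1 - 0)) F"
    by (intro tendsto_intros tm \<kappa>) auto
  then show "((\<lambda>b. exp (- (real (?t b) / m b) * (1 / (1 + \<kappa> b))) / (1 - \<kappa> b)) \<longlongrightarrow> exp (- x)) F"
    by simp
qed

section \<open>Reversible chains\<close>

locale reversible_chain = stochastic_matrix S p for S :: "'s set" and p +
  fixes \<mu> :: "'s \<Rightarrow> real"
  assumes \<mu>_pos: "\<And>x. x \<in> S \<Longrightarrow> 0 < \<mu> x"
    and detailed_balance: "\<And>x y. x \<in> S \<Longrightarrow> y \<in> S \<Longrightarrow> \<mu> x * p x y = \<mu> y * p y x"
begin

definition dirichlet :: "('s \<Rightarrow> real) \<Rightarrow> real" where
  "dirichlet f = (\<Sum>x\<in>S. \<Sum>y\<in>S. \<mu> x * p x y * (f x - f y)\<^sup>2) / 2"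

text \<open>
  Up to normalisation, the stationary expectation of \<open>u(X\<^sub>0) v(X\<^sub>1)\<close>.
\<close>

definition corr :: "('s \<Rightarrow> real) \<Rightarrow> ('s \<Rightarrow> real) \<Rightarrow> real" where
  "corr u v = (\<Sum>x\<in>S. \<Sum>y\<in>S. \<mu> x * p x y * (u x * v y))"

definition sqnorm :: "('s \<Rightarrow> real) \<Rightarrow> real" where
  "sqnorm f = (\<Sum>x\<in>S. \<mu> x * (f x)\<^sup>2)"

lemma dirichlet_eq: "dirichlet f = sqnorm f - corr f f"
proof -
  have 1: "(\<Sum>x\<in>S. \<Sum>y\<in>S. \<mu> x * p x y * (f x)\<^sup>2) = sqnorm f"
  proof -
    have "(\<Sum>y\<in>S. \<mu> x * p x y * (f x)\<^sup>2) = \<mu> x * (f x)\<^sup>2" if "x \<in> S" for x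
      using p_sum[OF that] by (simp flip: sum_distrib_left sum_distrib_right)
    then show ?thesis by (simp add: sqnorm_def)
  qed
  have 2: "(\<Sum>x\<in>S. \<Sum>y\<in>S. \<mu> x * p x y * (f y)\<^sup>2) = sqnorm f"
    unfolding 1[symmetric]
    by (subst sum.swap, intro sum.cong refl) (simp add: detailed_balance)
  have "2 * dirichlet f = (\<Sum>x\<in>S. \<Sum>y\<in>S. \<mu> x * p x y * (f x)\<^sup>2)
      + (\<Sum>x\<in>S. \<Sum>y\<in>S. \<mu> x * p x y * (f y)\<^sup>2) - 2 * corr f f"
    unfolding dirichlet_def corr_def
    by (simp add: sum.distrib[symmetric] sum_subtractf[symmetric] sum_distrib_left power2_eq_square algebra_simps)
  then show ?thesis unfolding 1 2 by simp
qed

lemma dirichlet_nonneg: "0 \<le> dirichlet f"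
  unfolding dirichlet_def
  by (intro divide_nonneg_nonneg sum_nonneg mult_nonneg_nonneg) (auto simp: p_nonneg \<mu>_pos less_imp_le)

lemma dirichlet_term_le:
  assumes "x \<in> S" "y \<in> S"
  shows "\<mu> x * p x y * (f x - f y)\<^sup>2 \<le> 2 * dirichlet f"
proof -
  have nn: "0 \<le> \<mu> x * p x y * (f x - f y)\<^sup>2" if "x \<in> S" "y \<in> S" for x y
    using that by (intro mult_nonneg_nonneg) (auto simp: p_nonneg \<mu>_pos less_imp_le)
  have "\<mu> x * p x y * (f x - f y)\<^sup>2 \<le> (\<Sum>y\<in>S. \<mu> x * p x y * (f x - f y)\<^sup>2)"
    using assms nn finite_S by (intro member_le_sum) auto
  also have "\<dots> \<le> (\<Sum>x\<in>S. \<Sum>y\<in>S. \<mu> x * p x y * (f x - f y)\<^sup>2)"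
    using assms nn finite_S by (intro member_le_sum sum_nonneg) auto
  finally show ?thesis by (simp add: dirichlet_def)
qed

lemma abs_corr_le: "\<bar>corr f f\<bar> \<le> corr (\<lambda>x. \<bar>f x\<bar>) (\<lambda>x. \<bar>f x\<bar>)"
  unfolding corr_def
  by (rule order_trans[OF sum_abs], intro sum_mono order_trans[OF sum_abs])
     (auto simp: abs_mult p_nonneg \<mu>_pos less_imp_le)

lemma sqnorm_nonneg: "0 \<le> sqnorm f"
  unfolding sqnorm_def by (intro sum_nonneg) (auto simp: \<mu>_pos less_imp_le)

text \<open>
  The killed matrix is self-adjoint with respect to \<open>\<mu>\<close>. Its quadratic form is at most \<open>1 - l\<close> by the
  Poincare inequality, and at least \<open>- (1 - l)\<close> because replacing a function by its absolute value
  can only increase the form in modulus. Polarisation turns this into a bound on the norm.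
\<close>

lemma killed_step_contraction:
  assumes poincare: "\<And>f. (\<forall>x\<in>A. f x = 0) \<Longrightarrow> l * sqnorm f \<le> dirichlet f"
    and l: "0 < l" "l \<le> 1" and f: "\<forall>x\<in>A. f x = 0"
  shows "sqnorm (\<lambda>x. if x \<in> A then 0 else \<Sum>y\<in>S. p x y * f y) \<le> (1 - l) * sqnorm f"
proof -
  define g where "g = (\<lambda>x. if x \<in> A then 0 else \<Sum>y\<in>S. p x y * f y)"
  have g: "\<forall>x\<in>A. g x = 0" by (simp add: g_def)
  have corr_le: "\<bar>corr h h\<bar> \<le> (1 - l) * sqnorm h" if "\<forall>x\<in>A. h x = 0" for h
  proof -
    have "corr (\<lambda>x. \<bar>h x\<bar>) (\<lambda>x. \<bar>h x\<bar>) \<le> (1 - l) * sqnorm (\<lambda>x. \<bar>h x\<bar>)"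
      using poincare[of "\<lambda>x. \<bar>h x\<bar>"] that by (simp add: dirichlet_eq algebra_simps)
    then show ?thesis using abs_corr_le[of h] by (simp add: sqnorm_def)
  qed
  have "sqnorm g = corr g f"
    unfolding sqnorm_def corr_def
    by (intro sum.cong refl) (auto simp: g_def power2_eq_square sum_distrib_left mult_ac intro!: sum.cong)
  also have "\<dots> = (corr (\<lambda>x. g x + f x) (\<lambda>x. g x + f x) - corr (\<lambda>x. g x - f x) (\<lambda>x. g x - f x)) / 4"
  proof -
    have sym: "corr f g = corr g f"
      unfolding corr_def by (subst sum.swap, intro sum.cong refl) (simp add: detailed_balance mult_ac)
    have "corr (\<lambda>x. g x + f x) (\<lambda>x. g x + f x) = corr g g + corr g f + corr f g + corr f f"
      by (simp add: corr_def sum.distrib[symmetric] algebra_simps)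
    moreover have "corr (\<lambda>x. g x - f x) (\<lambda>x. g x - f x) = corr g g - corr g f - corr f g + corr f f"
      by (simp add: corr_def sum.distrib[symmetric] sum_subtractf[symmetric] algebra_simps)
    ultimately show ?thesis using sym by simp
  qed
  also have "\<dots> \<le> ((1 - l) * sqnorm (\<lambda>x. g x + f x) + (1 - l) * sqnorm (\<lambda>x. g x - f x)) / 4"
    using corr_le[of "\<lambda>x. g x + f x"] corr_le[of "\<lambda>x. g x - f x"] f g by auto
  also have "\<dots> = (1 - l) * (sqnorm g + sqnorm f) / 2"
  proof -
    have "sqnorm (\<lambda>x. g x + f x) + sqnorm (\<lambda>x. g x - f x) = 2 * (sqnorm g + sqnorm f)"
      unfolding sqnorm_def sum.distrib[symmetric] sum_distrib_left
      by (intro sum.cong refl) (simp add: power2_eq_square algebra_simps)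
    then show ?thesis by (simp only: distrib_left[symmetric])
  qed
  finally have "(1 + l) * sqnorm g \<le> (1 - l) * sqnorm f" by (simp add: algebra_simps)
  moreover have "0 \<le> l * sqnorm g" using l sqnorm_nonneg[of g] by simp
  ultimately have "sqnorm g \<le> (1 - l) * sqnorm f" by (simp add: algebra_simps)
  then show ?thesis by (simp add: g_def)
qed

lemma surv_sqnorm_le:
  assumes "\<And>f. (\<forall>x\<in>A. f x = 0) \<Longrightarrow> l * sqnorm f \<le> dirichlet f" and l: "0 < l" "l \<le> 1"
  shows "sqnorm (surv S p A t) \<le> (1 - l) ^ t * (\<Sum>x\<in>S. \<mu> x)"
proof (induction t)
  case 0
  show ?case
    unfolding sqnorm_def by (simp, intro sum_mono) (auto simp: surv_def \<mu>_pos less_imp_le)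
next
  case (Suc t)
  have "sqnorm (surv S p A (Suc t)) = sqnorm (\<lambda>x. if x \<in> A then 0 else \<Sum>y\<in>S. p x y * surv S p A t y)"
    by (intro arg_cong[where f = sqnorm] ext) (auto simp: surv_in surv_Suc)
  also have "\<dots> \<le> (1 - l) * sqnorm (surv S p A t)"
    using assms by (intro killed_step_contraction) (auto simp: surv_in)
  also have "\<dots> \<le> (1 - l) * ((1 - l) ^ t * (\<Sum>x\<in>S. \<mu> x))"
    using Suc l by (intro mult_left_mono) auto
  finally show ?case by simp
qed

text \<open>
  The decay in \<open>L\<^sup>2(\<mu>)\<close> holds pointwise since all weights are at least \<open>1\<close>. The initial norm costs only
  the factor \<open>ln (4 Z)\<close>, which is linear in the inverse temperature when \<open>Z\<close> is a partition function.
\<close>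

lemma surv_sum_le_of_poincare:
  assumes poincare: "\<And>f. (\<forall>x\<in>A. f x = 0) \<Longrightarrow> l * sqnorm f \<le> dirichlet f" and l: "0 < l" "l \<le> 1"
    and \<mu>1: "\<And>x. x \<in> S \<Longrightarrow> 1 \<le> \<mu> x" and Z: "(\<Sum>x\<in>S. \<mu> x) \<le> Z" and x: "x \<in> S"
  shows "(\<Sum>t<n. surv S p A t x) \<le> 2 * (ln (4 * Z) / l + 1)"
proof -
  define T where "T = nat \<lceil>ln (4 * Z) / l\<rceil>"
  have "1 \<le> (\<Sum>x\<in>S. \<mu> x)"
    using \<mu>1[OF x] member_le_sum[of x S \<mu>] x finite_S \<mu>_pos by (fastforce simp: less_imp_le)
  then have Z1: "1 \<le> Z" using Z by simp
  then have "0 \<le> ln (4 * Z) / l" using l by simp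
  then have T: "ln (4 * Z) / l \<le> real T" "real T \<le> ln (4 * Z) / l + 1"
    unfolding T_def by linarith+
  have half: "surv S p A T y \<le> 1 / 2" if y: "y \<in> S" for y
  proof -
    have "(surv S p A T y)\<^sup>2 \<le> \<mu> y * (surv S p A T y)\<^sup>2"
      using \<mu>1[OF y] by (simp add: mult_le_cancel_right1)
    also have "\<dots> \<le> sqnorm (surv S p A T)"
      unfolding sqnorm_def using y finite_S by (intro member_le_sum) (auto simp: \<mu>_pos less_imp_le)
    also have "\<dots> \<le> (1 - l) ^ T * (\<Sum>x\<in>S. \<mu> x)"
      using surv_sqnorm_le[OF poincare l] by blast
    also have "\<dots> \<le> exp (- l) ^ T * Z"
      using l Z Z1 exp_ge_add_one_self[of "- l"] \<open>1 \<le> (\<Sum>x\<in>S. \<mu> x)\<close> by (intro mult_mono power_mono) auto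
    also have "exp (- l) ^ T = exp (- (l * real T))"
      by (simp add: exp_of_nat_mult[symmetric] mult.commute)
    also have "\<dots> \<le> exp (- ln (4 * Z))" using T(1) l by (simp add: field_simps)
    also have "\<dots> = 1 / (4 * Z)" using Z1 by (simp add: exp_minus field_simps)
    finally have "(surv S p A T y)\<^sup>2 \<le> (1 / 2)\<^sup>2" using Z1 by (simp add: power2_eq_square)
    then show ?thesis by (rule power2_le_imp_le) simp
  qed
  have "(\<Sum>t<n. surv S p A t x) \<le> 2 * real T"
    by (rule surv_partial_sum_le[OF _ x]) (rule half)
  then show ?thesis by (rule order_trans[OF _ mult_left_mono[OF T(2)]]) simp
qed

text \<open>
  By stationarity the mass that leaves \<open>W\<close> in any single step is at most the flux through the boundary
  of \<open>W\<close>. After \<open>t\<close> steps at most \<open>t\<close> times the flux has left, of which the part started in \<open>a\<close> is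
  \<open>\<mu> a\<close> times the exit probability from \<open>a\<close>.
\<close>

lemma exit_probability_le_flux:
  assumes W: "W \<subseteq> S" "a \<in> W" "A \<inter> W = {}"
  shows "\<mu> a * (1 - surv S p A t a) \<le> real t * (\<Sum>x\<in>W. \<Sum>y\<in>S - W. \<mu> x * p x y)"
proof -
  have finW: "finite W" using W finite_S finite_subset by auto
  define u where "u = (\<lambda>t y. 1 - surv S p (- W) t y)"
  have u_nonneg: "0 \<le> u t y" if "y \<in> S" for t y using that by (simp add: u_def surv_le_1)
  have u_out: "u t y = 1" if "y \<notin> W" for t y using that by (simp add: u_def surv_in)
  have "(\<Sum>x\<in>W. \<mu> x * u t x) \<le> real t * (\<Sum>x\<in>W. \<Sum>y\<in>S - W. \<mu> x * p x y)"
  proof (induction t)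
    case 0
    then show ?case by (simp add: u_def surv_0)
  next
    case (Suc t)
    have step: "\<mu> x * u (Suc t) x = (\<Sum>y\<in>S - W. \<mu> x * p x y) + (\<Sum>y\<in>W. \<mu> x * p x y * u t y)"
      if "x \<in> W" for x
    proof -
      have xS: "x \<in> S" and xW: "x \<notin> - W" using that W by auto
      have "u (Suc t) x = (\<Sum>y\<in>S. p x y * u t y)"
        using p_sum[OF xS] by (simp add: u_def surv_Suc[OF xW] right_diff_distrib sum_subtractf)
      also have "\<dots> = (\<Sum>y\<in>S - W. p x y * u t y) + (\<Sum>y\<in>W. p x y * u t y)"
        using W finite_S by (intro sum.subset_diff) auto
      also have "(\<Sum>y\<in>S - W. p x y * u t y) = (\<Sum>y\<in>S - W. p x y)"
        by (intro sum.cong) (auto simp: u_out)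
      finally show ?thesis by (simp add: distrib_left sum_distrib_left mult.assoc)
    qed
    have "(\<Sum>x\<in>W. \<Sum>y\<in>W. \<mu> x * p x y * u t y) = (\<Sum>y\<in>W. \<mu> y * u t y * (\<Sum>x\<in>W. p y x))"
      using W by (subst sum.swap, intro sum.cong refl)
        (auto simp: sum_distrib_left detailed_balance subset_eq mult_ac intro!: sum.cong)
    also have "\<dots> \<le> (\<Sum>y\<in>W. \<mu> y * u t y * 1)"
    proof (intro sum_mono mult_left_mono)
      fix y assume "y \<in> W"
      then have "y \<in> S" using W by auto
      then show "(\<Sum>x\<in>W. p y x) \<le> 1"
        using sum_mono2[OF finite_S W(1), of "p y"] p_nonneg[of y] p_sum[of y] by auto
      show "0 \<le> \<mu> y * u t y" using \<open>y \<in> S\<close> by (simp add: u_nonneg \<mu>_pos less_imp_le)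
    qed
    finally have "(\<Sum>x\<in>W. \<mu> x * u (Suc t) x)
        \<le> (\<Sum>x\<in>W. \<Sum>y\<in>S - W. \<mu> x * p x y) + (\<Sum>y\<in>W. \<mu> y * u t y)"
      by (simp add: step sum.distrib)
    with Suc show ?case by (simp add: algebra_simps)
  qed
  moreover have "\<mu> a * u t a \<le> (\<Sum>x\<in>W. \<mu> x * u t x)"
    using W finW by (intro member_le_sum) (auto simp: u_nonneg \<mu>_pos less_imp_le subset_eq)
  moreover have "\<mu> a * (1 - surv S p A t a) \<le> \<mu> a * u t a"
    unfolding u_def using W surv_antimono_set[of A "- W" a t]
    by (intro mult_left_mono) (auto simp: \<mu>_pos less_imp_le subset_eq)
  ultimately show ?thesis by linarith
qed

end

section \<open>Metropolis chains at low temperature\<close>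

text \<open>
  Energies are normalised to be nonpositive, so that every weight \<open>exp (- \<beta> H x)\<close> is at least \<open>1\<close>.
\<close>

locale metropolis =
  fixes S :: "'s set" and H :: "'s \<Rightarrow> real" and q :: "'s \<Rightarrow> 's \<Rightarrow> real"
  assumes finite_states: "finite S"
    and q_nonneg: "\<And>x y. x \<in> S \<Longrightarrow> y \<in> S \<Longrightarrow> 0 \<le> q x y"
    and q_sym: "\<And>x y. x \<in> S \<Longrightarrow> y \<in> S \<Longrightarrow> q x y = q y x"
    and q_sum: "\<And>x. x \<in> S \<Longrightarrow> (\<Sum>y\<in>S - {x}. q x y) \<le> 1"
    and H_nonpos: "\<And>x. x \<in> S \<Longrightarrow> H x \<le> 0"
begin

definition transition :: "real \<Rightarrow> 's \<Rightarrow> 's \<Rightarrow> real" where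
  "transition \<beta> x y = (if x = y then 1 - (\<Sum>z\<in>S - {x}. q x z * exp (- \<beta> * max 0 (H z - H x)))
                else q x y * exp (- \<beta> * max 0 (H y - H x)))"

text \<open>
  The reflexive transitive closure of \<open>link h\<close> is connectedness by paths of height at most \<open>h\<close>.
\<close>

definition link :: "real \<Rightarrow> 's \<Rightarrow> 's \<Rightarrow> bool" where
  "link h x y \<longleftrightarrow> x \<in> S \<and> y \<in> S \<and> H x \<le> h \<and> H y \<le> h \<and> (x = y \<or> 0 < q x y)"

abbreviation survival :: "real \<Rightarrow> 's set \<Rightarrow> nat \<Rightarrow> 's \<Rightarrow> real" where
  "survival \<beta> \<equiv> surv S (transition \<beta>)"

lemma reversible:
  assumes "0 < \<beta>"
  shows "reversible_chain S (transition \<beta>) (\<lambda>x. exp (- \<beta> * H x))"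
proof
  show "finite S" by (rule finite_states)
  fix x y assume x: "x \<in> S" and y: "y \<in> S"
  have "(\<Sum>z\<in>S - {x}. q x z * exp (- \<beta> * max 0 (H z - H x))) \<le> (\<Sum>z\<in>S - {x}. q x z * 1)"
    using x assms by (intro sum_mono mult_left_mono q_nonneg) auto
  also have "\<dots> \<le> 1" using q_sum[OF x] by simp
  finally show "0 \<le> transition \<beta> x y" using x y by (cases "x = y") (simp_all add: transition_def q_nonneg)
  have *: "exp (- \<beta> * H x) * exp (- \<beta> * max 0 (H y - H x)) = exp (- \<beta> * max (H x) (H y))" for x y
    by (auto simp: max_def exp_add[symmetric] algebra_simps)
  show "exp (- \<beta> * H x) * transition \<beta> x y = exp (- \<beta> * H y) * transition \<beta> y x"
    using *[of x y] *[of y x] q_sym[OF x y]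
    by (cases "x = y") (auto simp: transition_def max.commute mult.left_commute)
next
  fix x assume x: "x \<in> S"
  show "(\<Sum>y\<in>S. transition \<beta> x y) = 1"
  proof -
    have "(\<Sum>y\<in>S - {x}. transition \<beta> x y) = (\<Sum>y\<in>S - {x}. q x y * exp (- \<beta> * max 0 (H y - H x)))"
      by (intro sum.cong) (auto simp: transition_def)
    then show ?thesis using x finite_states by (subst sum.remove[of S x]) (auto simp: transition_def)
  qed
qed simp

text \<open>
  The conductance of an edge depends on the higher of its two endpoints only.
\<close>

lemma weight_transition:
  assumes "x \<noteq> y"
  shows "exp (- \<beta> * H x) * transition \<beta> x y = q x y * exp (- \<beta> * max (H x) (H y))"
  using assms by (auto simp: transition_def max_def exp_add[symmetric] mult.left_commute algebra_simps)

text \<open>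
  The number \<open>k\<close> is the length of the path. It is chosen before \<open>f\<close>, hence does not depend on the
  temperature when \<open>f\<close> does.
\<close>

lemma path_oscillation:
  assumes "(link h)\<^sup>*\<^sup>* x y"
  shows "\<exists>k::nat. \<forall>f d. (\<forall>u v. link h u v \<longrightarrow> \<bar>f u - f v\<bar> \<le> d) \<longrightarrow> \<bar>f x - f y\<bar> \<le> real k * (d::real)"
  using assms
proof (induction rule: rtranclp_induct)
  case base
  show ?case by (intro exI[of _ 0]) auto
next
  case (step y z)
  then obtain k where k: "\<And>f d. \<forall>u v. link h u v \<longrightarrow> \<bar>f u - f v\<bar> \<le> d \<Longrightarrow> \<bar>f x - f y\<bar> \<le> real k * d"
    by blast
  show ?case
  proof (intro exI[of _ "Suc k"] allI impI)
    fix f :: "'s \<Rightarrow> real" and d assume *: "\<forall>u v. link h u v \<longrightarrow> \<bar>f u - f v\<bar> \<le> d"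
    then have "\<bar>f x - f y\<bar> \<le> real k * d" "\<bar>f y - f z\<bar> \<le> d" using k step by auto
    then have "\<bar>f x - f z\<bar> \<le> real k * d + d" by linarith
    then show "\<bar>f x - f z\<bar> \<le> real (Suc k) * d" by (simp add: algebra_simps)
  qed
qed

lemma q_lower_bound: "\<exists>q0>0. \<forall>x\<in>S. \<forall>y\<in>S. 0 < q x y \<longrightarrow> q0 \<le> q x y"
proof -
  let ?Q = "insert 1 {r \<in> (\<lambda>(x, y). q x y) ` (S \<times> S). 0 < r}"
  have fin: "finite ?Q" using finite_states by auto
  show ?thesis
  proof (intro exI[of _ "Min ?Q"] conjI ballI impI)
    show "0 < Min ?Q" using fin by (subst Min_gr_iff) auto
    fix x y assume "x \<in> S" "y \<in> S" "0 < q x y"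
    then show "Min ?Q \<le> q x y" using fin by (intro Min_le) auto
  qed
qed

text \<open>
  On a path from \<open>x\<close> to \<open>A\<close> of height at most \<open>H x + G\<close> every edge has conductance at least
  \<open>q0 exp (- \<beta> (H x + G))\<close>, so the increments of \<open>f\<close> are controlled by the Dirichlet form and
  \<open>exp (- \<beta> H x) (f x)\<^sup>2\<close> is at most a constant times \<open>exp (\<beta> G)\<close> times the Dirichlet form. Comparing the
  height of the path with \<open>H x\<close>, and not with the minimal energy, is what produces the exponent \<open>G\<close>.
\<close>

lemma poincare:
  assumes paths: "\<And>x. x \<in> S \<Longrightarrow> \<exists>y\<in>A. (link (H x + G))\<^sup>*\<^sup>* x y"
  shows "\<exists>C\<ge>1. \<forall>\<beta>>0. \<forall>f. (\<forall>x\<in>A. f x = 0) \<longrightarrow>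
    reversible_chain.sqnorm S (\<lambda>x. exp (- \<beta> * H x)) f
      \<le> C * exp (\<beta> * G) * reversible_chain.dirichlet S (transition \<beta>) (\<lambda>x. exp (- \<beta> * H x)) f"
proof -
  have "\<forall>x. \<exists>k::nat. x \<in> S \<longrightarrow> (\<exists>y\<in>A. \<forall>f d. (\<forall>u v. link (H x + G) u v \<longrightarrow> \<bar>f u - f v\<bar> \<le> d) \<longrightarrow> \<bar>f x - f y\<bar> \<le> real k * (d::real))"
  proof
    fix x
    show "\<exists>k::nat. x \<in> S \<longrightarrow> (\<exists>y\<in>A. \<forall>f d. (\<forall>u v. link (H x + G) u v \<longrightarrow> \<bar>f u - f v\<bar> \<le> d) \<longrightarrow> \<bar>f x - f y\<bar> \<le> real k * (d::real))"
      using paths[of x] path_oscillation[of "H x + G" x] by (cases "x \<in> S") blast+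
  qed
  then obtain k :: "'s \<Rightarrow> nat" where k: "\<And>x. x \<in> S \<Longrightarrow> \<exists>y\<in>A. \<forall>f d. (\<forall>u v. link (H x + G) u v \<longrightarrow> \<bar>f u - f v\<bar> \<le> d) \<longrightarrow> \<bar>f x - f y\<bar> \<le> real (k x) * (d::real)"
    by metis
  obtain q0 where q0: "0 < q0" "\<And>x y. x \<in> S \<Longrightarrow> y \<in> S \<Longrightarrow> 0 < q x y \<Longrightarrow> q0 \<le> q x y"
    using q_lower_bound by blast
  define C where "C = (\<Sum>x\<in>S. (real (k x))\<^sup>2 * (2 / q0)) + 1"
  have "1 \<le> C" unfolding C_def using q0 by (auto intro!: sum_nonneg)
  moreover have "reversible_chain.sqnorm S (\<lambda>x. exp (- \<beta> * H x)) f
      \<le> C * exp (\<beta> * G) * reversible_chain.dirichlet S (transition \<beta>) (\<lambda>x. exp (- \<beta> * H x)) f"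
    if "0 < \<beta>" and f: "\<forall>x\<in>A. f x = 0" for \<beta> f
  proof -
    interpret reversible_chain S "transition \<beta>" "\<lambda>x. exp (- \<beta> * H x)"
      using \<open>0 < \<beta>\<close> by (rule reversible)
    let ?D = "dirichlet f"
    have D: "0 \<le> ?D" by (rule dirichlet_nonneg)
    have point: "exp (- \<beta> * H x) * (f x)\<^sup>2 \<le> (real (k x))\<^sup>2 * (2 / q0) * (exp (\<beta> * G) * ?D)" if x: "x \<in> S" for x
    proof -
      let ?d2 = "2 * ?D * exp (\<beta> * (H x + G)) / q0"
      have step: "\<bar>f u - f v\<bar> \<le> sqrt ?d2" if uv: "link (H x + G) u v" for u v
      proof (cases "u = v")
        case True
        then show ?thesis using D q0 by simp
      next
        case False
        with uv have uv': "u \<in> S" "v \<in> S" "0 < q u v" "max (H u) (H v) \<le> H x + G"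
          by (auto simp: link_def)
        have "q0 * exp (- \<beta> * (H x + G)) * (f u - f v)\<^sup>2 \<le> q u v * exp (- \<beta> * max (H u) (H v)) * (f u - f v)\<^sup>2"
          using uv' q0(2)[of u v] \<open>0 < \<beta>\<close> q0 by (intro mult_right_mono mult_mono) auto
        also have "\<dots> \<le> 2 * ?D"
          using dirichlet_term_le[OF uv'(1,2), of f] by (simp only: weight_transition[OF False])
        finally have "exp (\<beta> * (H x + G)) * (q0 * exp (- \<beta> * (H x + G)) * (f u - f v)\<^sup>2) \<le> exp (\<beta> * (H x + G)) * (2 * ?D)"
          by (intro mult_left_mono) auto
        also have "exp (\<beta> * (H x + G)) * (q0 * exp (- \<beta> * (H x + G)) * (f u - f v)\<^sup>2) = q0 * (f u - f v)\<^sup>2"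
          by (simp add: exp_minus)
        finally have "(f u - f v)\<^sup>2 \<le> ?d2" using q0 by (simp add: pos_le_divide_eq mult_ac)
        then show ?thesis by (metis real_sqrt_abs real_sqrt_le_mono)
      qed
      obtain y where "y \<in> A" "\<bar>f x - f y\<bar> \<le> real (k x) * sqrt ?d2"
        using k[OF x] step by metis
      then have "\<bar>f x\<bar> \<le> real (k x) * sqrt ?d2" using f by simp
      then have "\<bar>f x\<bar>\<^sup>2 \<le> (real (k x) * sqrt ?d2)\<^sup>2" by (intro power_mono) auto
      also have "\<dots> = (real (k x))\<^sup>2 * ?d2" using D q0 by (simp add: power_mult_distrib)
      finally have "exp (- \<beta> * H x) * (f x)\<^sup>2 \<le> exp (- \<beta> * H x) * ((real (k x))\<^sup>2 * ?d2)"
        by (intro mult_left_mono) auto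
      also have "\<dots> = (real (k x))\<^sup>2 * (2 / q0) * ((exp (- \<beta> * H x) * exp (\<beta> * (H x + G))) * ?D)" by simp
      also have "exp (- \<beta> * H x) * exp (\<beta> * (H x + G)) = exp (\<beta> * G)"
        by (simp add: exp_add[symmetric] algebra_simps)
      finally show ?thesis .
    qed
    have "sqnorm f \<le> (\<Sum>x\<in>S. (real (k x))\<^sup>2 * (2 / q0) * (exp (\<beta> * G) * ?D))"
      unfolding sqnorm_def by (intro sum_mono point)
    also have "\<dots> = (C - 1) * (exp (\<beta> * G) * ?D)" by (simp add: C_def sum_distrib_right)
    also have "\<dots> \<le> C * (exp (\<beta> * G) * ?D)" using D by (intro mult_right_mono) auto
    finally show ?thesis by (simp add: mult_ac)
  qed
  ultimately show ?thesis by blast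
qed

text \<open>
  The Poincare constant is of order \<open>exp (- \<beta> G)\<close>; all other factors are at most linear in \<open>\<beta>\<close>.
\<close>

lemma mean_time_upper:
  assumes paths: "\<And>x. x \<in> S \<Longrightarrow> \<exists>y\<in>A. (link (H x + G))\<^sup>*\<^sup>* x y" and "0 \<le> G" and "0 < \<epsilon>"
  shows "\<forall>\<^sub>F \<beta> in at_top. \<forall>x\<in>S. \<forall>n. (\<Sum>t<n. survival \<beta> A t x) \<le> exp (\<beta> * (G + \<epsilon>))"
proof -
  obtain C where C: "1 \<le> C" "\<And>\<beta> f. 0 < \<beta> \<Longrightarrow> \<forall>x\<in>A. f x = 0 \<Longrightarrow>
    reversible_chain.sqnorm S (\<lambda>x. exp (- \<beta> * H x)) f
      \<le> C * exp (\<beta> * G) * reversible_chain.dirichlet S (transition \<beta>) (\<lambda>x. exp (- \<beta> * H x)) f"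
    using poincare[of A G] paths by blast
  (* any upper bound on - H would do *)
  define h where "h = (\<Sum>x\<in>S. - H x)"
  have h: "- H x \<le> h" if "x \<in> S" for x
    unfolding h_def using that finite_states H_nonpos by (intro member_le_sum[of x S "\<lambda>x. - H x"]) auto
  have h0: "0 \<le> h" unfolding h_def using H_nonpos by (intro sum_nonneg) auto
  define B where "B = real (card S) + 1"
  have B1: "1 \<le> B" by (simp add: B_def)
  have bound: "(\<Sum>t<n. survival \<beta> A t x) \<le> 2 * ((ln (4 * B) + \<beta> * h) * (C * exp (\<beta> * G)) + 1)"
    if b: "0 < \<beta>" and x: "x \<in> S" for \<beta> x n
  proof -
    interpret reversible_chain S "transition \<beta>" "\<lambda>x. exp (- \<beta> * H x)"
      using b by (rule reversible)
    define l where "l = 1 / (C * exp (\<beta> * G))"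
    have CG: "1 \<le> C * exp (\<beta> * G)" using C(1) b \<open>0 \<le> G\<close> mult_mono[of 1 C 1 "exp (\<beta> * G)"] by simp
    have "(\<Sum>t<n. survival \<beta> A t x) \<le> 2 * (ln (4 * (B * exp (\<beta> * h))) / l + 1)"
    proof (rule surv_sum_le_of_poincare[OF _ _ _ _ _ x])
      show "l * sqnorm f \<le> dirichlet f" if "\<forall>x\<in>A. f x = 0" for f
        using C(2)[OF b that] CG by (simp add: l_def pos_divide_le_eq mult_ac)
      show "0 < l" "l \<le> 1" using CG by (auto simp: l_def)
      show "1 \<le> exp (- \<beta> * H y)" if "y \<in> S" for y using b H_nonpos[OF that] by (simp add: mult_nonneg_nonpos)
      have "(\<Sum>x\<in>S. exp (- \<beta> * H x)) \<le> (\<Sum>x\<in>S. exp (\<beta> * h))"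
      proof (intro sum_mono)
        fix y assume "y \<in> S"
        then have "\<beta> * - H y \<le> \<beta> * h" using h[of y] b by (intro mult_left_mono) auto
        then show "exp (- \<beta> * H y) \<le> exp (\<beta> * h)" by simp
      qed
      then show "(\<Sum>x\<in>S. exp (- \<beta> * H x)) \<le> B * exp (\<beta> * h)"
        by (simp add: B_def distrib_right add_increasing2)
    qed
    also have "ln (4 * (B * exp (\<beta> * h))) = ln (4 * B) + \<beta> * h"
      using B1 by (simp add: ln_mult mult.assoc[symmetric])
    finally show ?thesis by (simp add: l_def)
  qed
  have "\<forall>\<^sub>F \<beta> in at_top. 2 * ((ln (4 * B) + \<beta> * h) * (C * exp (\<beta> * G)) + 1) \<le> exp (\<beta> * (G + \<epsilon>))"
  proof -
    have "\<forall>\<^sub>F \<beta> in at_top. 2 * ((ln (4 * B) + \<beta> * h) * C + 1) \<le> exp (\<beta> * \<epsilon>)"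
      using \<open>0 < \<epsilon>\<close> C(1) h0 B1 by real_asymp
    with eventually_gt_at_top[of 0] show ?thesis
    proof eventually_elim
      case (elim \<beta>)
      have "2 * ((ln (4 * B) + \<beta> * h) * (C * exp (\<beta> * G)) + 1) \<le> 2 * ((ln (4 * B) + \<beta> * h) * (C * exp (\<beta> * G)) + exp (\<beta> * G))"
        using elim \<open>0 \<le> G\<close> by simp
      also have "\<dots> = 2 * ((ln (4 * B) + \<beta> * h) * C + 1) * exp (\<beta> * G)" by (simp add: algebra_simps)
      also have "\<dots> \<le> exp (\<beta> * \<epsilon>) * exp (\<beta> * G)" using elim by (intro mult_right_mono) auto
      finally show ?case by (simp add: exp_add[symmetric] algebra_simps)
    qed
  qed
  with eventually_gt_at_top[of 0] show ?thesis
    by eventually_elim (use bound in \<open>blast intro: order_trans\<close>)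
qed

text \<open>
  Every transition that leaves \<open>W\<close> has conductance at most \<open>exp (- \<beta> (H a + G))\<close>.
\<close>

lemma survival_lower:
  assumes W: "W \<subseteq> S" "a \<in> W" "A \<inter> W = {}" and "0 < \<beta>"
    and exit: "\<And>u v. u \<in> W \<Longrightarrow> v \<in> S - W \<Longrightarrow> 0 < q u v \<Longrightarrow> H a + G \<le> max (H u) (H v)"
  shows "1 - real t * (real (card S))\<^sup>2 * exp (- \<beta> * G) \<le> survival \<beta> A t a"
proof -
  interpret reversible_chain S "transition \<beta>" "\<lambda>x. exp (- \<beta> * H x)"
    using \<open>0 < \<beta>\<close> by (rule reversible)
  have edge: "exp (- \<beta> * H x) * transition \<beta> x y \<le> exp (- \<beta> * (H a + G))" if "x \<in> W" "y \<in> S - W" for x y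
  proof -
    have xy: "x \<noteq> y" "x \<in> S" "y \<in> S" using that W by auto
    show ?thesis
    proof (cases "0 < q x y")
      case True
      have "q x y \<le> (\<Sum>z\<in>S - {x}. q x z)"
        using xy finite_states q_nonneg by (intro member_le_sum) auto
      then have "q x y \<le> 1" using q_sum[OF xy(2)] by simp
      then have "q x y * exp (- \<beta> * max (H x) (H y)) \<le> 1 * exp (- \<beta> * (H a + G))"
        using exit[OF that True] \<open>0 < \<beta>\<close> by (intro mult_mono) auto
      then show ?thesis by (simp only: weight_transition[OF xy(1)] mult_1_left)
    next
      case False
      then have "q x y = 0" using q_nonneg[OF xy(2,3)] by simp
      then show ?thesis using xy by (simp add: transition_def)
    qed
  qed
  have "(\<Sum>x\<in>W. \<Sum>y\<in>S - W. exp (- \<beta> * H x) * transition \<beta> x y) \<le> (\<Sum>x\<in>W. \<Sum>y\<in>S - W. exp (- \<beta> * (H a + G)))"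
    by (intro sum_mono edge)
  also have "\<dots> = real (card W) * real (card (S - W)) * exp (- \<beta> * (H a + G))" by simp
  also have "\<dots> \<le> real (card S) * real (card S) * exp (- \<beta> * (H a + G))"
    using W finite_states by (intro mult_right_mono mult_mono) (auto intro: card_mono)
  finally have "exp (- \<beta> * H a) * (1 - survival \<beta> A t a) \<le> real t * ((real (card S))\<^sup>2 * exp (- \<beta> * (H a + G)))"
    using order_trans[OF exit_probability_le_flux[OF W, of t] mult_left_mono] unfolding power2_eq_square
    by fastforce
  also have "\<dots> = exp (- \<beta> * H a) * (real t * (real (card S))\<^sup>2 * exp (- \<beta> * G))"
    by (simp add: exp_add[symmetric] algebra_simps)
  finally show ?thesis by simp
qed

end

text \<open>
  The set \<open>T\<close> collects the states, \<open>a\<close> among them, at which the chain has to start afresh: the target \<open>A\<close>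
  is reached from everywhere over a barrier \<open>G\<close>, but \<open>A \<union> T\<close> already over a smaller barrier \<open>G'\<close>. The
  set \<open>W\<close> is a basin around \<open>a\<close> that can be left only at height \<open>G\<close>.
\<close>

locale metastable = metropolis S H q for S :: "'s set" and H and q +
  fixes a :: 's and T A W :: "'s set" and G G' :: real
  assumes a_T: "a \<in> T" and T_S: "T \<subseteq> S" and G: "0 \<le> G'" "G' < G"
    and paths_A: "\<And>x. x \<in> S \<Longrightarrow> \<exists>y\<in>A. (link (H x + G))\<^sup>*\<^sup>* x y"
    and paths_AT: "\<And>x. x \<in> S \<Longrightarrow> \<exists>y\<in>A \<union> T. (link (H x + G'))\<^sup>*\<^sup>* x y"
    and W: "W \<subseteq> S" "a \<in> W" "A \<inter> W = {}"
    and exit: "\<And>u v. u \<in> W \<Longrightarrow> v \<in> S - W \<Longrightarrow> 0 < q u v \<Longrightarrow> H a + G \<le> max (H u) (H v)"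
    and same_law: "\<And>\<beta> t y. 0 < \<beta> \<Longrightarrow> y \<in> T \<Longrightarrow> survival \<beta> A t y = survival \<beta> A t a"
begin

abbreviation m :: "real \<Rightarrow> real" where
  "m \<beta> \<equiv> (\<Sum>t. survival \<beta> A t a)"

lemma a_S: "a \<in> S" using a_T T_S by auto

lemma mean_partial_upper:
  assumes "0 < \<epsilon>"
  shows "\<forall>\<^sub>F \<beta> in at_top. \<forall>n. (\<Sum>t<n. survival \<beta> A t a) \<le> exp (\<beta> * (G + \<epsilon>))"
proof -
  have "\<forall>\<^sub>F \<beta> in at_top. \<forall>x\<in>S. \<forall>n. (\<Sum>t<n. survival \<beta> A t x) \<le> exp (\<beta> * (G + \<epsilon>))"
    by (rule mean_time_upper) (use paths_A G assms in auto)
  then show ?thesis by eventually_elim (use a_S in auto)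
qed

lemma survival_nonneg: "0 < \<beta> \<Longrightarrow> 0 \<le> survival \<beta> A t a"
  and survival_le_1: "0 < \<beta> \<Longrightarrow> survival \<beta> A t a \<le> 1"
  and survival_antimono: "0 < \<beta> \<Longrightarrow> s \<le> t \<Longrightarrow> survival \<beta> A t a \<le> survival \<beta> A s a"
proof -
  assume "0 < \<beta>"
  interpret reversible_chain S "transition \<beta>" "\<lambda>x. exp (- \<beta> * H x)"
    using \<open>0 < \<beta>\<close> by (rule reversible)
  show "0 \<le> survival \<beta> A t a" "survival \<beta> A t a \<le> 1"
    "s \<le> t \<Longrightarrow> survival \<beta> A t a \<le> survival \<beta> A s a"
    using a_S by (auto simp: surv_nonneg surv_le_1 surv_antimono)
qed

lemma survival_summable: "\<forall>\<^sub>F \<beta> in at_top. summable (\<lambda>t. survival \<beta> A t a)"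
  using mean_partial_upper[of 1, simplified] eventually_gt_at_top[of 0]
proof eventually_elim
  case (elim \<beta>)
  show ?case
  proof (rule bounded_imp_summable)
    show "0 \<le> survival \<beta> A t a" for t using elim by (simp add: survival_nonneg)
    show "(\<Sum>t\<le>n. survival \<beta> A t a) \<le> exp (\<beta> * (G + 1))" for n
      using elim(1) by (simp add: lessThan_Suc_atMost[symmetric] del: sum.lessThan_Suc)
  qed
qed

lemma mean_upper:
  assumes "0 < \<epsilon>"
  shows "\<forall>\<^sub>F \<beta> in at_top. m \<beta> \<le> exp (\<beta> * (G + \<epsilon>))"
  using mean_partial_upper[OF assms] survival_summable
  by eventually_elim (auto intro: suminf_le_const)

lemma survival_tendsto_1:
  assumes "((\<lambda>\<beta>. real (t \<beta>) * exp (- \<beta> * G)) \<longlongrightarrow> 0) at_top"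
  shows "((\<lambda>\<beta>. survival \<beta> A (t \<beta>) a) \<longlongrightarrow> 1) at_top"
proof (rule tendsto_sandwich)
  show "\<forall>\<^sub>F \<beta> in at_top. 1 - (real (card S))\<^sup>2 * (real (t \<beta>) * exp (- \<beta> * G)) \<le> survival \<beta> A (t \<beta>) a"
    using eventually_gt_at_top[of 0]
  proof eventually_elim
    case (elim \<beta>)
    show ?case using survival_lower[OF W elim exit, of "t \<beta>"] by (simp add: mult_ac)
  qed
  show "\<forall>\<^sub>F \<beta> in at_top. survival \<beta> A (t \<beta>) a \<le> 1"
    using eventually_gt_at_top[of 0] by eventually_elim (rule survival_le_1)
  have "((\<lambda>\<beta>. 1 - (real (card S))\<^sup>2 * (real (t \<beta>) * exp (- \<beta> * G))) \<longlongrightarrow> 1 - (real (card S))\<^sup>2 * 0) at_top"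
    by (intro tendsto_intros assms)
  then show "((\<lambda>\<beta>. 1 - (real (card S))\<^sup>2 * (real (t \<beta>) * exp (- \<beta> * G))) \<longlongrightarrow> 1) at_top" by simp
qed simp

lemma subcritical_time:
  assumes "g < G"
  shows "((\<lambda>\<beta>. real (nat \<lceil>exp (\<beta> * g)\<rceil>) * exp (- \<beta> * G)) \<longlongrightarrow> 0) at_top"
proof (rule tendsto_sandwich)
  show "\<forall>\<^sub>F \<beta> in at_top. 0 \<le> real (nat \<lceil>exp (\<beta> * g)\<rceil>) * exp (- \<beta> * G)"
    by (intro always_eventually allI mult_nonneg_nonneg of_nat_0_le_iff exp_ge_zero)
  show "\<forall>\<^sub>F \<beta> in at_top. real (nat \<lceil>exp (\<beta> * g)\<rceil>) * exp (- \<beta> * G) \<le> (exp (\<beta> * g) + 1) * exp (- \<beta> * G)"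
  proof (intro always_eventually allI mult_right_mono)
    fix \<beta>
    have "0 \<le> exp (\<beta> * g)" by simp
    then show "real (nat \<lceil>exp (\<beta> * g)\<rceil>) \<le> exp (\<beta> * g) + 1" by linarith
  qed simp
  have "0 < G" using G by simp
  then show "((\<lambda>\<beta>. (exp (\<beta> * g) + 1) * exp (- \<beta> * G)) \<longlongrightarrow> 0) at_top"
  proof -
    have "0 < G - g" using assms by simp
    then have "((\<lambda>\<beta>. exp (- \<beta> * (G - g))) \<longlongrightarrow> 0) at_top" by real_asymp
    moreover have "((\<lambda>\<beta>. exp (- \<beta> * G)) \<longlongrightarrow> 0) at_top" using \<open>0 < G\<close> by real_asymp
    ultimately have "((\<lambda>\<beta>. exp (- \<beta> * (G - g)) + exp (- \<beta> * G)) \<longlongrightarrow> 0 + 0) at_top"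
      by (intro tendsto_intros)
    then show ?thesis by (simp add: distrib_right exp_add[symmetric] right_diff_distrib)
  qed
qed simp

lemma survival_before:
  assumes "0 < \<epsilon>"
  shows "((\<lambda>\<beta>. survival \<beta> A (nat \<lceil>exp (\<beta> * (G - \<epsilon>))\<rceil>) a) \<longlongrightarrow> 1) at_top"
  using assms by (intro survival_tendsto_1 subcritical_time) auto

text \<open>
  At a time \<open>t\<close> slightly below \<open>exp (\<beta> G)\<close> the chain still survives with probability at least \<open>1 / 2\<close>,
  and the mean is at least \<open>t\<close> times the survival probability at time \<open>t\<close>.
\<close>

lemma mean_lower:
  assumes "0 < \<epsilon>"
  shows "\<forall>\<^sub>F \<beta> in at_top. exp (\<beta> * (G - \<epsilon>)) \<le> m \<beta>"
proof -
  have "\<forall>\<^sub>F \<beta> in at_top. 1 / 2 < survival \<beta> A (nat \<lceil>exp (\<beta> * (G - \<epsilon> / 2))\<rceil>) a"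
    using order_tendstoD(1)[OF survival_before[of "\<epsilon> / 2"], of "1 / 2"] assms by simp
  moreover have "\<forall>\<^sub>F \<beta> in at_top. exp (\<beta> * (G - \<epsilon>)) \<le> exp (\<beta> * (G - \<epsilon> / 2)) / 2"
  proof -
    have "\<forall>\<^sub>F \<beta> in at_top. 2 \<le> exp (\<beta> * (\<epsilon> / 2))" using assms by real_asymp
    then show ?thesis
    proof eventually_elim
      case (elim \<beta>)
      then have "exp (\<beta> * (G - \<epsilon>)) * 2 \<le> exp (\<beta> * (G - \<epsilon>)) * exp (\<beta> * (\<epsilon> / 2))" by simp
      also have "\<dots> = exp (\<beta> * (G - \<epsilon> / 2))" by (simp add: exp_add[symmetric] algebra_simps)
      finally show ?case by simp
    qed
  qed
  ultimately show ?thesis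
    using survival_summable eventually_gt_at_top[of 0]
  proof eventually_elim
    case (elim \<beta>)
    define t where "t = nat \<lceil>exp (\<beta> * (G - \<epsilon> / 2))\<rceil>"
    have "exp (\<beta> * (G - \<epsilon> / 2)) \<le> real t" unfolding t_def by linarith
    then have "exp (\<beta> * (G - \<epsilon>)) \<le> real t * (1 / 2)" using elim(2) by simp
    also have "\<dots> \<le> real t * survival \<beta> A t a"
      using elim(1) by (intro mult_left_mono less_imp_le) (simp_all add: t_def)
    also have "\<dots> = (\<Sum>s<t. survival \<beta> A t a)" by simp
    also have "\<dots> \<le> (\<Sum>s<t. survival \<beta> A s a)"
      using elim by (intro sum_mono survival_antimono) auto
    also have "\<dots> \<le> m \<beta>"
      using elim by (intro sum_le_suminf) (auto simp: survival_nonneg)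
    finally show ?case .
  qed
qed

lemma survival_after:
  assumes "0 < \<epsilon>"
  shows "((\<lambda>\<beta>. survival \<beta> A (nat \<lfloor>exp (\<beta> * (G + \<epsilon>))\<rfloor>) a) \<longlongrightarrow> 0) at_top"
proof (rule tendsto_sandwich)
  show "\<forall>\<^sub>F \<beta> in at_top. 0 \<le> survival \<beta> A (nat \<lfloor>exp (\<beta> * (G + \<epsilon>))\<rfloor>) a"
    using eventually_gt_at_top[of 0] by eventually_elim (rule survival_nonneg)
  have "\<forall>\<^sub>F \<beta> in at_top. \<forall>n. (\<Sum>t<n. survival \<beta> A t a) \<le> exp (\<beta> * (G + \<epsilon> / 2))"
    using assms by (intro mean_partial_upper) simp
  then show "\<forall>\<^sub>F \<beta> in at_top. survival \<beta> A (nat \<lfloor>exp (\<beta> * (G + \<epsilon>))\<rfloor>) a \<le> 2 * exp (- \<beta> * (\<epsilon> / 2))"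
    using eventually_gt_at_top[of 0]
  proof eventually_elim
    case (elim \<beta>)
    interpret reversible_chain S "transition \<beta>" "\<lambda>x. exp (- \<beta> * H x)"
      using elim(2) by (rule reversible)
    define r where "r = nat \<lfloor>exp (\<beta> * (G + \<epsilon>))\<rfloor>"
    have "0 < G + \<epsilon>" using G assms by simp
    then have "1 \<le> exp (\<beta> * (G + \<epsilon>))" using elim(2) by simp
    moreover have "y / 2 \<le> real_of_int \<lfloor>y\<rfloor>" if "1 \<le> y" for y :: real
    proof -
      have "1 \<le> \<lfloor>y\<rfloor>" using that by simp
      then show ?thesis by linarith
    qed
    ultimately have "exp (\<beta> * (G + \<epsilon>)) / 2 \<le> real_of_int \<lfloor>exp (\<beta> * (G + \<epsilon>))\<rfloor>" by blast
    then have "exp (\<beta> * (G + \<epsilon>)) / 2 \<le> real r" by (simp add: r_def)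
    then have "exp (\<beta> * (G + \<epsilon>)) / 2 * survival \<beta> A r a \<le> real r * survival \<beta> A r a"
      using elim(2) by (intro mult_right_mono survival_nonneg)
    also have "\<dots> \<le> exp (\<beta> * (G + \<epsilon> / 2))"
      using elim(1) a_S by (intro surv_markov_ineq) auto
    finally have "exp (\<beta> * (G + \<epsilon>)) * survival \<beta> A r a \<le> exp (\<beta> * (G + \<epsilon>)) * (2 * exp (- \<beta> * (\<epsilon> / 2)))"
      by (simp add: exp_add[symmetric] algebra_simps)
    then show ?case by (simp add: r_def)
  qed
  show "((\<lambda>\<beta>. 2 * exp (- \<beta> * (\<epsilon> / 2))) \<longlongrightarrow> 0) at_top" using assms by real_asymp
qed simp

lemma mean_at_top: "filterlim m at_top at_top"
proof (rule filterlim_at_top_mono)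
  have "0 < G" using G by simp
  then show "filterlim (\<lambda>\<beta>. exp (\<beta> * (G - G / 2))) at_top at_top" by real_asymp
  show "\<forall>\<^sub>F \<beta> in at_top. exp (\<beta> * (G - G / 2)) \<le> m \<beta>"
    using \<open>0 < G\<close> by (intro mean_lower) simp
qed

text \<open>
  Three scales are separated by the gap between \<open>G'\<close> and \<open>G\<close>: the mean time \<open>exp (\<beta> (G' + e))\<close> to reach
  \<open>A \<union> T\<close>, the time \<open>r\<close> of order \<open>exp (\<beta> (G' + 2 e))\<close> within which it is reached with high probability by
  Markov's inequality, and the mean exit time, which exceeds \<open>exp (\<beta> (G - e))\<close>. The lower bound comes
  from summing \<open>almost_multiplicative\<close> over \<open>s\<close>.
\<close>

lemma residual_means:
  obtains \<kappa> where "(\<kappa> \<longlongrightarrow> 0) at_top"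
    "\<forall>\<^sub>F \<beta> in at_top. \<forall>t. (1 - \<kappa> \<beta>) * survival \<beta> A t a * m \<beta> \<le> (\<Sum>s. survival \<beta> A (t + s) a) \<and>
       (\<Sum>s. survival \<beta> A (t + s) a) \<le> (1 + \<kappa> \<beta>) * survival \<beta> A t a * m \<beta>"
proof
  define e where "e = (G - G') / 4"
  have e: "0 < e" using G by (simp add: e_def)
  define r where "r \<beta> = nat \<lceil>exp (\<beta> * (G' + 2 * e))\<rceil>" for \<beta>
  define d where "d \<beta> = exp (- \<beta> * e)" for \<beta>
  define \<kappa> where "\<kappa> \<beta> = (1 - survival \<beta> A (2 * r \<beta>) a) + 2 * d \<beta> + exp (- \<beta> * (2 * e))" for \<beta>
  have "((\<lambda>\<beta>. survival \<beta> A (2 * r \<beta>) a) \<longlongrightarrow> 1) at_top"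
  proof (rule survival_tendsto_1)
    have "((\<lambda>\<beta>. 2 * (real (r \<beta>) * exp (- \<beta> * G))) \<longlongrightarrow> 2 * 0) at_top"
      unfolding r_def using G by (intro tendsto_intros subcritical_time) (simp add: e_def field_simps)
    then show "((\<lambda>\<beta>. real (2 * r \<beta>) * exp (- \<beta> * G)) \<longlongrightarrow> 0) at_top" by (simp add: mult.assoc)
  qed
  moreover have "(d \<longlongrightarrow> 0) at_top" unfolding d_def using e by real_asymp
  moreover have "((\<lambda>\<beta>. exp (- \<beta> * (2 * e))) \<longlongrightarrow> 0) at_top" using e by real_asymp
  ultimately have "(\<kappa> \<longlongrightarrow> (1 - 1) + 2 * 0 + 0) at_top"
    unfolding \<kappa>_def by (intro tendsto_intros)
  then show "(\<kappa> \<longlongrightarrow> 0) at_top" by simp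
  have "\<forall>\<^sub>F \<beta> in at_top. \<forall>x\<in>S. \<forall>n. (\<Sum>t<n. survival \<beta> (A \<union> T) t x) \<le> exp (\<beta> * (G' + e))"
    by (rule mean_time_upper) (use paths_AT G e in auto)
  moreover have "\<forall>\<^sub>F \<beta> in at_top. exp (\<beta> * (G - e)) \<le> m \<beta>" using e by (intro mean_lower)
  ultimately show "\<forall>\<^sub>F \<beta> in at_top. \<forall>t. (1 - \<kappa> \<beta>) * survival \<beta> A t a * m \<beta> \<le> (\<Sum>s. survival \<beta> A (t + s) a) \<and>
       (\<Sum>s. survival \<beta> A (t + s) a) \<le> (1 + \<kappa> \<beta>) * survival \<beta> A t a * m \<beta>"
    using survival_summable eventually_gt_at_top[of 0]
  proof eventually_elim
    case (elim \<beta>)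
    interpret reversible_chain S "transition \<beta>" "\<lambda>x. exp (- \<beta> * H x)"
      using elim(4) by (rule reversible)
    let ?f = "\<lambda>t. survival \<beta> A t a"
    have f: "0 \<le> ?f t" "?f t \<le> 1" for t using elim(4) by (auto simp: survival_nonneg survival_le_1)
    have m0: "0 \<le> m \<beta>" using elim(3) f by (intro suminf_nonneg)
    have m_T: "(\<Sum>t<n. survival \<beta> A t y) \<le> m \<beta>" if "y \<in> T \<inter> S" for y n
      using that same_law[OF elim(4)] elim(3) f by (auto intro!: sum_le_suminf)
    have r0: "exp (\<beta> * (G' + 2 * e)) \<le> real (r \<beta>)" unfolding r_def by linarith
    have d_bound: "survival \<beta> (A \<union> T) (r \<beta>) x \<le> d \<beta>" if x: "x \<in> S" for x
    proof -
      have "exp (\<beta> * (G' + 2 * e)) * survival \<beta> (A \<union> T) (r \<beta>) x \<le> real (r \<beta>) * survival \<beta> (A \<union> T) (r \<beta>) x"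
        using r0 x by (intro mult_right_mono surv_nonneg)
      also have "\<dots> \<le> exp (\<beta> * (G' + e))"
        using elim(1) x by (intro surv_markov_ineq) auto
      also have "\<dots> = exp (\<beta> * (G' + 2 * e)) * d \<beta>"
        by (simp add: d_def exp_add[symmetric] algebra_simps)
      finally show ?thesis by simp
    qed
    have R: "exp (\<beta> * (G' + e)) \<le> \<kappa> \<beta> * m \<beta>"
    proof -
      have "exp (\<beta> * (G' + e)) = exp (- \<beta> * (2 * e)) * exp (\<beta> * (G - e))"
        by (simp add: exp_add[symmetric] e_def field_simps)
      also have "\<dots> \<le> \<kappa> \<beta> * m \<beta>"
        using elim(2) f[of "2 * r \<beta>"] m0 by (intro mult_mono) (auto simp: \<kappa>_def d_def)
      finally show ?thesis .
    qed
    have shift: "summable (\<lambda>s. ?f (t + s))" for t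
      using elim(3) summable_iff_shift[of ?f t] by (simp add: add.commute)
    show ?case
    proof (intro allI conjI)
      fix t
      have "(1 - \<kappa> \<beta>) * ?f t * m \<beta> \<le> (?f (2 * r \<beta>) - 2 * d \<beta>) * ?f t * m \<beta>"
        using f m0 by (intro mult_right_mono) (auto simp: \<kappa>_def)
      also have "\<dots> = (\<Sum>s. (?f (2 * r \<beta>) - 2 * d \<beta>) * ?f t * ?f s)"
        using elim(3) by (simp add: suminf_mult)
      also have "\<dots> \<le> (\<Sum>s. ?f (t + s))"
        using elim(3,4) a_S same_law d_bound
        by (intro suminf_le almost_multiplicative[where T = T] shift summable_mult) (auto simp: d_def)
      finally show "(1 - \<kappa> \<beta>) * ?f t * m \<beta> \<le> (\<Sum>s. ?f (t + s))" .
      have "(\<Sum>s. ?f (t + s)) \<le> ?f t * (m \<beta> + exp (\<beta> * (G' + e)))"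
      proof (rule suminf_le_const[OF shift])
        show "(\<Sum>s<n. ?f (t + s)) \<le> ?f t * (m \<beta> + exp (\<beta> * (G' + e)))" for n
          using a_S m_T m0 elim(1) by (intro residual_mean_upper[where T = T]) auto
      qed
      also have "\<dots> \<le> ?f t * (m \<beta> + \<kappa> \<beta> * m \<beta>)" using f R by (intro mult_left_mono) auto
      finally show "(\<Sum>s. ?f (t + s)) \<le> (1 + \<kappa> \<beta>) * ?f t * m \<beta>" by (simp add: algebra_simps)
    qed
  qed
qed

lemma a_notin_A: "a \<notin> A" using W by auto

theorem exponential_law:
  assumes "0 \<le> x"
  shows "((\<lambda>\<beta>. survival \<beta> A (nat \<lfloor>x * m \<beta>\<rfloor>) a) \<longlongrightarrow> exp (- x)) at_top"
proof -
  obtain \<kappa> where \<kappa>: "(\<kappa> \<longlongrightarrow> 0) at_top"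
    "\<forall>\<^sub>F \<beta> in at_top. \<forall>t. (1 - \<kappa> \<beta>) * survival \<beta> A t a * m \<beta> \<le> (\<Sum>s. survival \<beta> A (t + s) a) \<and>
       (\<Sum>s. survival \<beta> A (t + s) a) \<le> (1 + \<kappa> \<beta>) * survival \<beta> A t a * m \<beta>"
    by (rule residual_means)
  show ?thesis
  proof (rule exp_limit_of_residual_means[OF _ _ \<kappa>(2) mean_at_top \<kappa>(1) assms])
    show "\<forall>\<^sub>F \<beta> in at_top. survival \<beta> A 0 a = 1" using a_notin_A by (simp add: surv_0)
    show "\<forall>\<^sub>F \<beta> in at_top. (\<lambda>t. survival \<beta> A t a) sums m \<beta>"
      using survival_summable by eventually_elim (rule summable_sums)
  qed
qed

end

section \<open>Hitting times of Markov chains\<close>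

lemma chain_path_prob:
  assumes mc: "markov_chain S p s0 M X" and s: "\<And>i. i \<le> t \<Longrightarrow> s i \<in> S"
  shows "\<P>(\<omega> in M. \<forall>i\<le>t. X i \<omega> = s i) = (if s 0 = s0 then \<Prod>i<t. p (s i) (s (Suc i)) else 0)"
  using s
proof (induction t)
  case 0
  interpret prob_space M using mc by (simp add: markov_chain_def)
  have [measurable]: "X 0 \<in> measurable M (count_space S)" using mc by (simp add: markov_chain_def)
  have ae: "AE \<omega> in M. X 0 \<omega> = s0" using mc by (simp add: markov_chain_def)
  have meas: "{\<omega> \<in> space M. X 0 \<omega> = s 0} \<in> sets M" by measurable
  show ?case
  proof (cases "s 0 = s0")
    case True
    have "prob {\<omega> \<in> space M. X 0 \<omega> = s 0} = 1"
      using prob_Collect_eq_1[OF meas] ae True by simp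
    then show ?thesis using True by simp
  next
    case False
    have "prob {\<omega> \<in> space M. X 0 \<omega> = s 0} = 0"
      using prob_Collect_eq_0[OF meas] ae False by auto
    then show ?thesis using False by simp
  qed
next
  case (Suc t)
  interpret prob_space M using mc by (simp add: markov_chain_def)
  have X[measurable]: "X i \<in> measurable M (count_space S)" for i using mc by (simp add: markov_chain_def)
  let ?past = "\<P>(\<omega> in M. \<forall>i\<le>t. X i \<omega> = s i)"
  have IH: "?past = (if s 0 = s0 then \<Prod>i<t. p (s i) (s (Suc i)) else 0)"
    using Suc by auto
  have split: "\<P>(\<omega> in M. \<forall>i\<le>Suc t. X i \<omega> = s i)
      = \<P>(\<omega> in M. X (Suc t) \<omega> = s (Suc t) \<and> (\<forall>i\<le>t. X i \<omega> = s i))"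
    by (intro arg_cong[where f = prob] Collect_cong) (auto simp: le_Suc_eq)
  have "\<P>(\<omega> in M. \<forall>i\<le>Suc t. X i \<omega> = s i) = ?past * p (s t) (s (Suc t))"
  proof (cases "?past = 0")
    case True
    have "\<P>(\<omega> in M. X (Suc t) \<omega> = s (Suc t) \<and> (\<forall>i\<le>t. X i \<omega> = s i)) \<le> ?past"
      by (intro finite_measure_mono) auto
    then show ?thesis using True split by (simp add: measure_le_0_iff)
  next
    case False
    define s' where "s' i = (if i \<le> Suc t then s i else s 0)" for i
    have s'S: "\<forall>i. s' i \<in> S" using Suc.prems by (auto simp: s'_def)
    have eq: "(\<forall>i\<le>t. X i \<omega> = s' i) \<longleftrightarrow> (\<forall>i\<le>t. X i \<omega> = s i)" for \<omega> by (auto simp: s'_def)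
    have markov: "\<forall>t s. (\<forall>i. s i \<in> S) \<longrightarrow> \<P>(\<omega> in M. \<forall>i\<le>t. X i \<omega> = s i) \<noteq> 0 \<longrightarrow>
        \<P>(\<omega> in M. X (Suc t) \<omega> = s (Suc t) \<bar> \<forall>i\<le>t. X i \<omega> = s i) = p (s t) (s (Suc t))"
      using mc by (simp add: markov_chain_def)
    have "\<P>(\<omega> in M. X (Suc t) \<omega> = s' (Suc t) \<bar> \<forall>i\<le>t. X i \<omega> = s' i) = p (s' t) (s' (Suc t))"
      using markov[rule_format, of s' t] s'S False unfolding eq by blast
    then have "\<P>(\<omega> in M. X (Suc t) \<omega> = s (Suc t) \<bar> \<forall>i\<le>t. X i \<omega> = s i) = p (s t) (s (Suc t))"
      unfolding eq by (simp add: s'_def)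
    then show ?thesis using False unfolding split cond_prob_def by (simp add: field_simps)
  qed
  then show ?case using IH by (simp add: mult.commute)
qed

lemma sum_PiE_insert:
  assumes "i \<notin> I"
  shows "(\<Sum>s\<in>insert i I \<rightarrow>\<^sub>E B. F s) = (\<Sum>y\<in>B. \<Sum>s\<in>I \<rightarrow>\<^sub>E B. F (s(i := y)))"
  unfolding PiE_insert_eq
  using sum.reindex[OF inj_combinator[OF assms, of "\<lambda>_. B"], of F]
  by (simp add: sum.cartesian_product case_prod_unfold)

text \<open>
  The last step of a path is split off on the left but the first step on the right, hence the
  induction is for all \<open>g\<close>.
\<close>

lemma killed_path_sum:
  assumes fin: "finite S" and s0: "s0 \<in> S"
  shows "(\<Sum>s\<in>{..t} \<rightarrow>\<^sub>E (S - A). (if s 0 = s0 then \<Prod>i<t. p (s i) (s (Suc i)) else 0) * g (s t))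
    = killed S p A t g s0"
proof (induction t arbitrary: g)
  case 0
  have at0: "{..0::nat} = insert 0 {}" by auto
  have "(\<Sum>s\<in>{..0} \<rightarrow>\<^sub>E (S - A). (if s 0 = s0 then \<Prod>i<0. p (s i) (s (Suc i)) else 0) * g (s 0))
     = (\<Sum>x\<in>S - A. (if x = s0 then g x else 0))"
    unfolding at0 by (subst sum_PiE_insert) (auto intro!: sum.cong)
  also have "\<dots> = killed S p A 0 g s0" using fin s0 by (simp add: sum.delta)
  finally show ?case by simp
next
  case (Suc t)
  let ?w = "\<lambda>t s. if s 0 = s0 then \<Prod>i<t. p (s i) (s (Suc i)) else 0"
  have ins: "{..Suc t} = insert (Suc t) {..t}" by auto
  have wS: "?w (Suc t) (s(Suc t := y)) = ?w t s * p (s t) y" for s y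
    by (auto intro!: prod.cong)
  have "(\<Sum>s\<in>{..Suc t} \<rightarrow>\<^sub>E (S - A). ?w (Suc t) s * g (s (Suc t)))
      = (\<Sum>y\<in>S - A. \<Sum>s\<in>{..t} \<rightarrow>\<^sub>E (S - A). ?w t s * (p (s t) y * g y))"
    unfolding ins by (subst sum_PiE_insert, simp) (simp only: wS fun_upd_same mult.assoc)
  also have "\<dots> = (\<Sum>s\<in>{..t} \<rightarrow>\<^sub>E (S - A). ?w t s * (\<Sum>y\<in>S - A. p (s t) y * g y))"
    by (subst sum.swap) (simp only: sum_distrib_left)
  also have "\<dots> = killed S p A t (\<lambda>x. \<Sum>y\<in>S - A. p x y * g y) s0" by (rule Suc)
  also have "\<dots> = killed S p A t (killed S p A 1 g) s0"
  proof -
    have "killed S p A t h s0 = killed S p A t (\<lambda>x. if x \<in> A then 0 else h x) s0" for h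
      using s0 by (induction t arbitrary: s0) (auto intro!: sum.cong)
    moreover have "(\<lambda>x. if x \<in> A then 0 else (\<Sum>y\<in>S - A. p x y * g y)) = killed S p A 1 g"
      using fin by (auto simp: fun_eq_iff if_distrib sum.If_cases intro!: sum.mono_neutral_cong_left)
    ultimately show ?thesis by metis
  qed
  also have "\<dots> = killed S p A (Suc t) g s0" by (simp only: killed_killed Suc_eq_plus1)
  finally show ?case .
qed

lemma markov_chain_avoid:
  assumes mc: "markov_chain S p s0 M X" and fin: "finite S" and s0: "s0 \<in> S"
  shows "\<P>(\<omega> in M. \<forall>i\<le>t. X i \<omega> \<notin> A) = surv S p A t s0"
proof -
  interpret prob_space M using mc by (simp add: markov_chain_def)
  have X[measurable]: "X i \<in> measurable M (count_space S)" for i using mc by (simp add: markov_chain_def)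
  have XS: "X i \<omega> \<in> S" if "\<omega> \<in> space M" for i \<omega> using measurable_space[OF X that] by simp
  let ?I = "{..t} \<rightarrow>\<^sub>E (S - A)"
  have finI: "finite ?I" using fin by (intro finite_PiE) auto
  have "{\<omega> \<in> space M. \<forall>i\<le>t. X i \<omega> \<notin> A} = (\<Union>s\<in>?I. {\<omega> \<in> space M. \<forall>i\<le>t. X i \<omega> = s i})"
  proof safe
    fix \<omega> assume \<omega>: "\<omega> \<in> space M" "\<forall>i\<le>t. X i \<omega> \<notin> A"
    then show "\<omega> \<in> (\<Union>s\<in>?I. {\<omega> \<in> space M. \<forall>i\<le>t. X i \<omega> = s i})"
      using XS by (intro UN_I[of "\<lambda>i\<in>{..t}. X i \<omega>"]) auto
  qed (auto simp: PiE_def Pi_def)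
  also have "prob \<dots> = (\<Sum>s\<in>?I. \<P>(\<omega> in M. \<forall>i\<le>t. X i \<omega> = s i))"
  proof (rule finite_measure_finite_Union[OF finI])
    have "{\<omega> \<in> space M. \<forall>i\<le>t. X i \<omega> = s i} \<in> sets M" for s by measurable
    then show "(\<lambda>s. {\<omega> \<in> space M. \<forall>i\<le>t. X i \<omega> = s i}) ` ?I \<subseteq> sets M" by blast
    show "disjoint_family_on (\<lambda>s. {\<omega> \<in> space M. \<forall>i\<le>t. X i \<omega> = s i}) ?I"
      unfolding disjoint_family_on_def
    proof (intro ballI impI)
      fix s s' assume s: "s \<in> ?I" "s' \<in> ?I" "s \<noteq> s'"
      have "s = s'" if "\<forall>i\<le>t. X i \<omega> = s i" "\<forall>i\<le>t. X i \<omega> = s' i" for \<omega>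
        using that s(1,2) by (intro PiE_ext) auto
      then show "{\<omega> \<in> space M. \<forall>i\<le>t. X i \<omega> = s i} \<inter> {\<omega> \<in> space M. \<forall>i\<le>t. X i \<omega> = s' i} = {}"
        using s(3) by blast
    qed
  qed
  also have "\<dots> = (\<Sum>s\<in>?I. (if s 0 = s0 then \<Prod>i<t. p (s i) (s (Suc i)) else 0) * 1)"
    by (intro sum.cong refl) (subst chain_path_prob[OF mc], auto simp: PiE_def Pi_def)
  also have "\<dots> = surv S p A t s0"
    unfolding surv_def by (rule killed_path_sum[OF fin s0])
  finally show ?thesis .
qed

lemma hitting_time_gt_iff: "enat t < hitting_time X A \<omega> \<longleftrightarrow> (\<forall>i\<le>t. X i \<omega> \<notin> A)"
proof (cases "\<exists>t. X t \<omega> \<in> A")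
  case True
  let ?T = "{enat t | t. X t \<omega> \<in> A}"
  obtain k where "X k \<omega> \<in> A" using True by blast
  then have "enat k \<in> ?T" by blast
  then have "Inf ?T \<in> ?T" by (rule wellorder_InfI)
  then obtain t0 where t0: "Inf ?T = enat t0" "X t0 \<omega> \<in> A" by auto
  have "t0 \<le> i" if "X i \<omega> \<in> A" for i
    using Inf_lower[of "enat i" ?T] that t0 by auto
  then show ?thesis using t0 unfolding hitting_time_def
    by (metis enat_ord_simps(2) linorder_not_less order_le_less_trans)
next
  case False
  then have "{enat t | t. X t \<omega> \<in> A} = {}" by auto
  then have "hitting_time X A \<omega> = \<infinity>" by (simp add: hitting_time_def Inf_enat_def)
  then show ?thesis using False by simp
qed

lemma hitting_time_antimono: "A \<subseteq> B \<Longrightarrow> hitting_time X B \<omega> \<le> hitting_time X A \<omega>"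
  unfolding hitting_time_def by (intro Inf_superset_mono) auto

text \<open>
  The set \<open>A\<close> may contain points outside the state space, where the process never is.
\<close>

lemma hitting_time_measurable:
  assumes X: "\<And>i. X i \<in> measurable M (count_space S)" and S: "countable S"
  shows "hitting_time X A \<in> measurable M (count_space UNIV)"
proof -
  have "{\<omega> \<in> space M. X i \<omega> \<in> A} = X i -` (S \<inter> A) \<inter> space M" for i
    using measurable_space[OF X[of i]] by auto
  then have "{\<omega> \<in> space M. X i \<omega> \<in> A} \<in> sets M" for i
    using measurable_sets[OF X[of i], of "S \<inter> A"] by simp
  then have gt: "{\<omega> \<in> space M. enat t < hitting_time X A \<omega>} \<in> sets M" for t
    unfolding hitting_time_gt_iff by (intro sets.sets_Collect_countable_All sets.sets_Collect) auto
  have "hitting_time X A -` {e} \<inter> space M \<in> sets M" for e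
  proof (cases e)
    case (enat n)
    have "hitting_time X A -` {e} \<inter> space M =
      (if n = 0 then space M else {\<omega> \<in> space M. enat (n - 1) < hitting_time X A \<omega>}) - {\<omega> \<in> space M. enat n < hitting_time X A \<omega>}"
    proof -
      have "h = enat n \<longleftrightarrow> (n = 0 \<or> enat (n - 1) < h) \<and> \<not> enat n < h" for h
        by (cases h; cases n) auto
      then have "hitting_time X A \<omega> = e \<longleftrightarrow> (n = 0 \<or> enat (n - 1) < hitting_time X A \<omega>) \<and> \<not> enat n < hitting_time X A \<omega>" for \<omega>
        using enat by blast
      then show ?thesis by (simp only: set_eq_iff) auto
    qed
    then show ?thesis using gt by auto
  next
    case infinity
    have "hitting_time X A -` {e} \<inter> space M = (\<Inter>n. {\<omega> \<in> space M. enat n < hitting_time X A \<omega>})"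
    proof -
      have inf_iff: "h = \<infinity> \<longleftrightarrow> (\<forall>n. enat n < h)" for h
        by (metis enat_ord_simps(4) less_irrefl not_enat_eq)
      have "hitting_time X A \<omega> = e \<longleftrightarrow> (\<forall>n. enat n < hitting_time X A \<omega>)" for \<omega>
        unfolding infinity by (rule inf_iff)
      then show ?thesis by (simp only: set_eq_iff) auto
    qed
    then show ?thesis using gt by auto
  qed
  then show ?thesis
    by (subst measurable_count_space_eq_countable) auto
qed

lemma expected_hitting_time:
  assumes mc: "markov_chain S p s0 M X" and fin: "finite S" and s0: "s0 \<in> S"
    and summ: "summable (\<lambda>t. surv S p A t s0)" and nn: "\<And>t. 0 \<le> surv S p A t s0"
  shows "expected_time M (hitting_time X A) = ennreal (\<Sum>t. surv S p A t s0)"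
proof -
  interpret prob_space M using mc by (simp add: markov_chain_def)
  have X: "X i \<in> measurable M (count_space S)" for i using mc by (simp add: markov_chain_def)
  have "expected_time M (hitting_time X A) = (\<Sum>t. emeasure M {\<omega> \<in> space M. enat t < hitting_time X A \<omega>})"
    unfolding expected_time_def
    by (intro nn_integral_enat_function hitting_time_measurable[OF X] countable_finite fin)
  also have "\<dots> = (\<Sum>t. ennreal (surv S p A t s0))"
    by (simp add: emeasure_eq_measure hitting_time_gt_iff markov_chain_avoid[OF mc fin s0])
  also have "\<dots> = ennreal (\<Sum>t. surv S p A t s0)"
    using summ nn by (intro suminf_ennreal2)
  finally show ?thesis .
qed

section \<open>Limit laws of the hitting time\<close>

lemma cdf_Exp1: "cdf Exp1 x = (if x < 0 then 0 else 1 - exp (- x))"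
proof -
  have "emeasure Exp1 {..x} = ennreal (erlang_CDF 0 1 x)"
    unfolding Exp1_def by (intro emeasure_erlang_density) auto
  then show ?thesis
    by (auto simp: cdf_def measure_def erlang_CDF_0)
qed

locale metastable_chain = metastable S H q a T A W G G'
  for S :: "'s set" and H q a T A W G G' +
  fixes M :: "real \<Rightarrow> 'w measure" and X :: "real \<Rightarrow> nat \<Rightarrow> 'w \<Rightarrow> 's"
  assumes mc: "\<And>\<beta>. 0 < \<beta> \<Longrightarrow> markov_chain S (transition \<beta>) a (M \<beta>) (X \<beta>)"
begin

abbreviation \<tau> :: "real \<Rightarrow> 'w \<Rightarrow> enat" where
  "\<tau> \<beta> \<equiv> hitting_time (X \<beta>) A"

lemma prob_M: "0 < \<beta> \<Longrightarrow> prob_space (M \<beta>)"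
  using mc by (simp add: markov_chain_def)

lemma \<tau>_measurable: "0 < \<beta> \<Longrightarrow> \<tau> \<beta> \<in> measurable (M \<beta>) (count_space UNIV)"
  using mc[of \<beta>] finite_states
  by (intro hitting_time_measurable[of _ _ S]) (auto simp: markov_chain_def countable_finite)

lemma prob_\<tau>_gt: "0 < \<beta> \<Longrightarrow> \<P>(\<omega> in M \<beta>. enat t < \<tau> \<beta> \<omega>) = survival \<beta> A t a"
  unfolding hitting_time_gt_iff
  using markov_chain_avoid[OF mc finite_states a_S] .

lemma mean_nonneg: "0 < \<beta> \<Longrightarrow> summable (\<lambda>t. survival \<beta> A t a) \<Longrightarrow> 0 \<le> m \<beta>"
  by (intro suminf_nonneg survival_nonneg)

lemma expected_\<tau>:
  "\<forall>\<^sub>F \<beta> in at_top. enn2real (expected_time (M \<beta>) (\<tau> \<beta>)) = m \<beta>"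
  using survival_summable eventually_gt_at_top[of 0]
proof eventually_elim
  case (elim \<beta>)
  have "expected_time (M \<beta>) (\<tau> \<beta>) = ennreal (m \<beta>)"
    using elim by (intro expected_hitting_time[OF mc finite_states a_S]) (auto simp: survival_nonneg)
  then show ?case using mean_nonneg elim by simp
qed

lemma log_expected_rate_tendsto:
  "((\<lambda>\<beta>. log_expected_rate \<beta> (M \<beta>) (\<tau> \<beta>)) \<longlongrightarrow> G) at_top"
  unfolding tendsto_iff
proof (intro allI impI)
  fix e :: real assume e: "0 < e"
  have "\<forall>\<^sub>F \<beta> in at_top. exp (\<beta> * (G - e / 2)) \<le> m \<beta>" using e by (intro mean_lower) simp
  moreover have "\<forall>\<^sub>F \<beta> in at_top. m \<beta> \<le> exp (\<beta> * (G + e / 2))" using e by (intro mean_upper) simp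
  ultimately show "\<forall>\<^sub>F \<beta> in at_top. dist (log_expected_rate \<beta> (M \<beta>) (\<tau> \<beta>)) G < e"
    using expected_\<tau> eventually_gt_at_top[of 0]
  proof eventually_elim
    case (elim \<beta>)
    define l where "l = ln (m \<beta>)"
    have m0: "0 < m \<beta>" using elim(1) exp_gt_zero less_le_trans by blast
    have "\<beta> * (G - e / 2) \<le> l" "l \<le> \<beta> * (G + e / 2)"
      using elim(1) ln_mono[OF elim(2) m0] m0 by (simp_all add: l_def ln_ge_iff)
    then have "G - e / 2 \<le> l / \<beta>" "l / \<beta> \<le> G + e / 2"
      using elim(4) by (simp_all add: pos_le_divide_eq pos_divide_le_eq mult.commute)
    then have "\<bar>l / \<beta> - G\<bar> < e" using e by linarith
    then show ?case
      unfolding log_expected_rate_def elim(3) dist_real_def l_def by simp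
  qed
qed

lemma \<tau>_lower:
  assumes "0 < \<epsilon>"
  shows "((\<lambda>\<beta>. \<P>(\<omega> in M \<beta>. ennreal (exp (\<beta> * (G - \<epsilon>))) \<le> ennreal_of_enat (\<tau> \<beta> \<omega>))) \<longlongrightarrow> 1) at_top"
proof (rule tendsto_sandwich[OF _ _ survival_before[OF assms] tendsto_const])
  show "\<forall>\<^sub>F \<beta> in at_top. survival \<beta> A (nat \<lceil>exp (\<beta> * (G - \<epsilon>))\<rceil>) a
      \<le> \<P>(\<omega> in M \<beta>. ennreal (exp (\<beta> * (G - \<epsilon>))) \<le> ennreal_of_enat (\<tau> \<beta> \<omega>))"
    using eventually_gt_at_top[of 0]
  proof eventually_elim
    case (elim \<beta>)
    interpret prob_space "M \<beta>" using elim by (rule prob_M)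
    note \<tau>_measurable[OF elim, measurable]
    have "ennreal (exp (\<beta> * (G - \<epsilon>))) \<le> ennreal_of_enat (\<tau> \<beta> \<omega>)"
      if "enat (nat \<lceil>exp (\<beta> * (G - \<epsilon>))\<rceil>) < \<tau> \<beta> \<omega>" for \<omega>
    proof -
      have "ennreal (exp (\<beta> * (G - \<epsilon>))) \<le> ennreal (real (nat \<lceil>exp (\<beta> * (G - \<epsilon>))\<rceil>))"
        by (intro ennreal_leI) linarith
      also have "\<dots> = ennreal_of_enat (enat (nat \<lceil>exp (\<beta> * (G - \<epsilon>))\<rceil>))"
        by (simp add: ennreal_of_nat_eq_real_of_nat)
      also have "\<dots> \<le> ennreal_of_enat (\<tau> \<beta> \<omega>)"
        using that by (subst ennreal_of_enat_le_iff) (rule less_imp_le)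
      finally show ?thesis .
    qed
    then have "\<P>(\<omega> in M \<beta>. enat (nat \<lceil>exp (\<beta> * (G - \<epsilon>))\<rceil>) < \<tau> \<beta> \<omega>)
        \<le> \<P>(\<omega> in M \<beta>. ennreal (exp (\<beta> * (G - \<epsilon>))) \<le> ennreal_of_enat (\<tau> \<beta> \<omega>))"
      by (intro finite_measure_mono) auto
    then show ?case by (simp only: prob_\<tau>_gt[OF elim])
  qed
  show "\<forall>\<^sub>F \<beta> in at_top. \<P>(\<omega> in M \<beta>. ennreal (exp (\<beta> * (G - \<epsilon>))) \<le> ennreal_of_enat (\<tau> \<beta> \<omega>)) \<le> 1"
    using eventually_gt_at_top[of 0] by eventually_elim (intro prob_space.prob_le_1 prob_M)
qed

lemma \<tau>_upper:
  assumes "0 < \<epsilon>"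
  shows "((\<lambda>\<beta>. \<P>(\<omega> in M \<beta>. ennreal_of_enat (\<tau> \<beta> \<omega>) \<le> ennreal (exp (\<beta> * (G + \<epsilon>))))) \<longlongrightarrow> 1) at_top"
proof (rule tendsto_sandwich[OF _ _ _ tendsto_const])
  show "((\<lambda>\<beta>. 1 - survival \<beta> A (nat \<lfloor>exp (\<beta> * (G + \<epsilon>))\<rfloor>) a) \<longlongrightarrow> 1) at_top"
    using tendsto_diff[OF tendsto_const survival_after[OF assms], of 1] by simp
  show "\<forall>\<^sub>F \<beta> in at_top. 1 - survival \<beta> A (nat \<lfloor>exp (\<beta> * (G + \<epsilon>))\<rfloor>) a
      \<le> \<P>(\<omega> in M \<beta>. ennreal_of_enat (\<tau> \<beta> \<omega>) \<le> ennreal (exp (\<beta> * (G + \<epsilon>))))"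
    using eventually_gt_at_top[of 0]
  proof eventually_elim
    case (elim \<beta>)
    interpret prob_space "M \<beta>" using elim by (rule prob_M)
    note \<tau>_measurable[OF elim, measurable]
    define t where "t = nat \<lfloor>exp (\<beta> * (G + \<epsilon>))\<rfloor>"
    have le: "ennreal_of_enat (\<tau> \<beta> \<omega>) \<le> ennreal (exp (\<beta> * (G + \<epsilon>)))" if "\<not> enat t < \<tau> \<beta> \<omega>" for \<omega>
    proof -
      have "ennreal_of_enat (\<tau> \<beta> \<omega>) \<le> ennreal_of_enat (enat t)"
        using that by (subst ennreal_of_enat_le_iff) (simp only: not_less)
      also have "\<dots> = ennreal (real t)" by (simp add: ennreal_of_nat_eq_real_of_nat)
      also have "\<dots> \<le> ennreal (exp (\<beta> * (G + \<epsilon>)))" unfolding t_def by (intro ennreal_leI) simp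
      finally show ?thesis .
    qed
    have "1 - \<P>(\<omega> in M \<beta>. enat t < \<tau> \<beta> \<omega>) = \<P>(\<omega> in M \<beta>. \<not> enat t < \<tau> \<beta> \<omega>)"
      by (intro prob_neg[symmetric]) measurable
    also have "\<dots> \<le> \<P>(\<omega> in M \<beta>. ennreal_of_enat (\<tau> \<beta> \<omega>) \<le> ennreal (exp (\<beta> * (G + \<epsilon>))))"
      using le by (intro finite_measure_mono) auto
    finally show ?case by (simp only: prob_\<tau>_gt[OF elim] t_def)
  qed
  show "\<forall>\<^sub>F \<beta> in at_top. \<P>(\<omega> in M \<beta>. ennreal_of_enat (\<tau> \<beta> \<omega>) \<le> ennreal (exp (\<beta> * (G + \<epsilon>)))) \<le> 1"
    using eventually_gt_at_top[of 0] by eventually_elim (intro prob_space.prob_le_1 prob_M)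
qed

lemma prob_\<tau>_infinite:
  assumes "0 < \<beta>" and summ: "summable (\<lambda>t. survival \<beta> A t a)"
  shows "\<P>(\<omega> in M \<beta>. \<tau> \<beta> \<omega> = \<infinity>) = 0"
proof -
  interpret prob_space "M \<beta>" using assms(1) by (rule prob_M)
  note \<tau>_measurable[OF assms(1), measurable]
  have "\<P>(\<omega> in M \<beta>. \<tau> \<beta> \<omega> = \<infinity>) \<le> survival \<beta> A t a" for t
    unfolding prob_\<tau>_gt[OF assms(1), symmetric] by (intro finite_measure_mono) auto
  then have "\<P>(\<omega> in M \<beta>. \<tau> \<beta> \<omega> = \<infinity>) \<le> 0"
    using LIMSEQ_le_const[OF summable_LIMSEQ_zero[OF summ]] by blast
  then show ?thesis by (simp add: measure_le_0_iff)
qed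

text \<open>
  Where the hitting time is infinite, the normalised time has the default value \<open>0\<close>; this is a null
  event.
\<close>

lemma cdf_normalized:
  "\<forall>\<^sub>F \<beta> in at_top. cdf (distr (M \<beta>) borel (normalized_time (M \<beta>) (\<tau> \<beta>))) x
     = (if x < 0 then 0 else 1 - survival \<beta> A (nat \<lfloor>x * m \<beta>\<rfloor>) a)"
proof -
  have "\<forall>\<^sub>F \<beta> in at_top. 0 < m \<beta>" using mean_at_top by (auto simp: filterlim_at_top_dense)
  then show ?thesis
    using expected_\<tau> survival_summable eventually_gt_at_top[of 0]
  proof eventually_elim
    case (elim \<beta>)
    interpret prob_space "M \<beta>" using elim(4) by (rule prob_M)
    note \<tau>_measurable[OF elim(4), measurable]
    let ?Y = "normalized_time (M \<beta>) (\<tau> \<beta>)"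
    have Y: "?Y = (\<lambda>\<omega>. enn2real (ennreal_of_enat (\<tau> \<beta> \<omega>)) / m \<beta>)"
      unfolding normalized_time_def elim(2) ..
    have [measurable]: "?Y \<in> borel_measurable (M \<beta>)"
      unfolding Y
      by (rule measurable_compose[OF \<tau>_measurable[OF elim(4)]]) simp
    have cdf: "cdf (distr (M \<beta>) borel ?Y) x = \<P>(\<omega> in M \<beta>. ?Y \<omega> \<le> x)"
      unfolding cdf_def by (subst measure_distr) (auto intro!: arg_cong[where f = prob])
    show ?case
    proof (cases "x < 0")
      case True
      have "0 \<le> ?Y \<omega>" for \<omega> using elim(1) by (simp add: Y)
      then have "{\<omega> \<in> space (M \<beta>). ?Y \<omega> \<le> x} = {}" using True by (force simp: not_le intro: less_le_trans)
      then show ?thesis using True unfolding cdf by (simp only: measure_empty if_True)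
    next
      case False
      define t where "t = nat \<lfloor>x * m \<beta>\<rfloor>"
      have Y_le: "?Y \<omega> \<le> x \<longleftrightarrow> \<not> enat t < \<tau> \<beta> \<omega>" if "\<tau> \<beta> \<omega> \<noteq> \<infinity>" for \<omega>
      proof -
        obtain n where n: "\<tau> \<beta> \<omega> = enat n" using \<open>\<tau> \<beta> \<omega> \<noteq> \<infinity>\<close> by auto
        have "0 \<le> x * m \<beta>" using False elim(1) by simp
        then have "real n \<le> x * m \<beta> \<longleftrightarrow> n \<le> t"
          unfolding t_def by (simp add: le_nat_iff le_floor_iff)
        moreover have "?Y \<omega> \<le> x \<longleftrightarrow> real n \<le> x * m \<beta>"
          using elim(1) n by (simp add: Y pos_divide_le_eq ennreal_of_nat_eq_real_of_nat)
        ultimately show ?thesis using n by auto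
      qed
      have "AE \<omega> in M \<beta>. \<tau> \<beta> \<omega> \<noteq> \<infinity>"
        using prob_\<tau>_infinite[OF elim(4,3)] by (subst (asm) prob_Collect_eq_0) (auto simp del: not_infinity_eq)
      then have "\<P>(\<omega> in M \<beta>. ?Y \<omega> \<le> x) = \<P>(\<omega> in M \<beta>. \<not> enat t < \<tau> \<beta> \<omega>)"
        by (intro finite_measure_eq_AE) (auto simp: Y_le)
      also have "\<dots> = 1 - \<P>(\<omega> in M \<beta>. enat t < \<tau> \<beta> \<omega>)"
        by (intro prob_neg) measurable
      finally show ?thesis using False by (simp only: cdf prob_\<tau>_gt[OF elim(4)] t_def if_False)
    qed
  qed
qed

lemma normalized_time_conv: "conv_in_distr_at_top M (\<lambda>\<beta>. normalized_time (M \<beta>) (\<tau> \<beta>)) Exp1"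
  unfolding conv_in_distr_at_top_def weak_conv_m_def weak_conv_def
proof (intro allI impI)
  fix b :: "nat \<Rightarrow> real" and x
  assume b: "filterlim b at_top sequentially"
  have "((\<lambda>\<beta>. cdf (distr (M \<beta>) borel (normalized_time (M \<beta>) (\<tau> \<beta>))) x) \<longlongrightarrow> cdf Exp1 x) at_top"
  proof (rule Lim_transform_eventually)
    show "\<forall>\<^sub>F \<beta> in at_top. (if x < 0 then 0 else 1 - survival \<beta> A (nat \<lfloor>x * m \<beta>\<rfloor>) a)
      = cdf (distr (M \<beta>) borel (normalized_time (M \<beta>) (\<tau> \<beta>))) x"
      using cdf_normalized[of x] by eventually_elim simp
    show "((\<lambda>\<beta>. if x < 0 then 0 else 1 - survival \<beta> A (nat \<lfloor>x * m \<beta>\<rfloor>) a) \<longlongrightarrow> cdf Exp1 x) at_top"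
      unfolding cdf_Exp1
      by (cases "x < 0") (auto intro!: tendsto_intros exponential_law)
  qed
  then show "(\<lambda>n. cdf (distr (M (b n)) borel (normalized_time (M (b n)) (\<tau> (b n)))) x) \<longlonglongrightarrow> cdf Exp1 x"
    using b by (rule filterlim_compose)
qed

end

section \<open>The torus and single-particle paths\<close>

lemma cong3_shift:
  fixes x r :: int
  assumes "[x = r] (mod 3)"
  shows "\<not> [x + 1 = r] (mod 3)" "\<not> [x + 2 = r] (mod 3)" "\<not> [x - 1 = r] (mod 3)" "\<not> [x - 2 = r] (mod 3)"
  using assms unfolding cong_def by presburger+

locale grid =
  fixes K L :: nat
  assumes K2: "2 \<le> K" and L1: "1 \<le> L"
begin

text \<open>
  Integer coordinates on the universal cover. Arguments about neighbouring sites can then ignore the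
  seams of the torus; coordinates are reduced only here.
\<close>

definition pt :: "int \<Rightarrow> int \<Rightarrow> site" where
  "pt x y = (x mod (6 * int L), y mod (2 * int K))"

definition nb :: "int \<Rightarrow> int \<Rightarrow> site set" where
  "nb x y = {pt (x + 2) y, pt (x - 2) y, pt (x + 1) (y + 1), pt (x + 1) (y - 1), pt (x - 1) (y + 1), pt (x - 1) (y - 1)}"

definition nbs :: "site \<Rightarrow> site set" where
  "nbs v = {w. neighbors K L v w}"

abbreviation V :: "int \<Rightarrow> site set" where
  "V \<equiv> sites_mod K L"

lemma pt_eq_iff: "pt x y = pt x' y' \<longleftrightarrow> [x = x'] (mod 6 * int L) \<and> [y = y'] (mod 2 * int K)"
  by (simp add: pt_def cong_def)

lemma pt_in_sites: "pt x y \<in> sites K L \<longleftrightarrow> even (x - y)"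
proof -
  have "x mod (6 * int L) mod 2 = x mod 2" "y mod (2 * int K) mod 2 = y mod 2"
    by (auto intro!: mod_mod_cancel)
  then show ?thesis
    using K2 L1 by (auto simp: pt_def sites_def cong_def even_diff_iff mod2_eq_if split: if_splits)
qed

lemma pt_in_V: "pt x y \<in> V r \<longleftrightarrow> even (x - y) \<and> [x = r] (mod 3)"
proof -
  have "x mod (6 * int L) mod 3 = x mod 3" by (auto intro!: mod_mod_cancel)
  then show ?thesis
    unfolding sites_mod_def mem_Collect_eq pt_in_sites by (simp add: pt_def cong_def)
qed

lemma pt_self: "(x, y) \<in> sites K L \<Longrightarrow> pt x y = (x, y)"
  by (auto simp: pt_def sites_def)

lemma site_cases:
  assumes "v \<in> sites K L"
  obtains x y where "v = pt x y" "even (x - y)"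
  using assms pt_self pt_in_sites by (metis surj_pair)

lemma nb_image:
  "nb x y = (\<lambda>d. pt (x + fst d) (y + snd d)) ` {(2, 0), (-2, 0), (1, 1), (1, -1), (-1, 1), (-1, -1)}"
  by (simp add: nb_def)

lemma neighbors_pt:
  assumes "even (x - y)"
  shows "neighbors K L (pt x y) w \<longleftrightarrow> w \<in> nb x y"
proof -
  define D :: "(int \<times> int) set" where "D = {(2, 0), (-2, 0), (1, 1), (1, -1), (-1, 1), (-1, -1)}"
  have D_even: "even (fst d - snd d)" if "d \<in> D" for d using that by (auto simp: D_def)
  have shift: "pt x' y' = pt (x + fst d) (y + snd d) \<longleftrightarrow>
      [x' = fst (pt x y) + fst d] (mod 6 * int L) \<and> [y' = snd (pt x y) + snd d] (mod 2 * int K)" for x' y' d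
    unfolding pt_eq_iff by (simp add: pt_def cong_def mod_simps)
  have "neighbors K L (pt x y) w \<longleftrightarrow> w \<in> sites K L \<and>
     (\<exists>d\<in>D. [fst w = fst (pt x y) + fst d] (mod 6 * int L) \<and> [snd w = snd (pt x y) + snd d] (mod 2 * int K))"
    using assms unfolding neighbors_def D_def[symmetric] case_prod_unfold by (simp add: pt_in_sites)
  also have "\<dots> \<longleftrightarrow> w \<in> sites K L \<and> (\<exists>d\<in>D. w = pt (x + fst d) (y + snd d))"
    unfolding shift[symmetric] using pt_self[of "fst w" "snd w"] by (simp cong: conj_cong)
  also have "\<dots> \<longleftrightarrow> (\<exists>d\<in>D. w = pt (x + fst d) (y + snd d))"
  proof -
    have "pt (x + fst d) (y + snd d) \<in> sites K L" if "d \<in> D" for d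
    proof -
      have "x + fst d - (y + snd d) = (x - y) + (fst d - snd d)" by simp
      then show ?thesis using D_even[OF that] assms unfolding pt_in_sites by presburger
    qed
    then show ?thesis by blast
  qed
  also have "\<dots> \<longleftrightarrow> w \<in> nb x y" unfolding nb_image D_def[symmetric] by blast
  finally show ?thesis .
qed

lemma nbs_pt: "even (x - y) \<Longrightarrow> nbs (pt x y) = nb x y"
  by (auto simp: nbs_def neighbors_pt)

lemma neighbors_sites: "neighbors K L v w \<Longrightarrow> v \<in> sites K L \<and> w \<in> sites K L"
  by (simp add: neighbors_def)

lemma neighbors_sym:
  assumes "neighbors K L v w"
  shows "neighbors K L w v"
proof -
  obtain x y where v: "v = pt x y" "even (x - y)"
    using assms neighbors_sites site_cases by metis
  then have "w \<in> nb x y" using assms neighbors_pt by simp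
  moreover have "neighbors K L (pt x' y') (pt x y)"
    if "pt x y \<in> nb x' y'" "even (x' - y')" for x' y' using that neighbors_pt by simp
  ultimately show ?thesis
    unfolding v(1) using v(2) by (auto simp: nb_def)
qed

lemma V_not_neighbors:
  assumes "v \<in> V r" "w \<in> V r"
  shows "\<not> neighbors K L v w"
proof
  assume nbr: "neighbors K L v w"
  obtain x y where v: "v = pt x y" "even (x - y)"
    using nbr neighbors_sites site_cases by metis
  have x: "[x = r] (mod 3)" using assms(1) by (simp add: v pt_in_V)
  have "w \<in> nb x y" using nbr neighbors_pt v by simp
  then show False using assms(2) cong3_shift[OF x] by (auto simp: nb_def pt_in_V)
qed

lemma finite_sites: "finite (sites K L)"
proof (rule finite_subset)
  show "sites K L \<subseteq> {0..<6 * int L} \<times> {0..<2 * int K}" by (auto simp: sites_def)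
qed auto

lemma V_sites: "V r \<subseteq> sites K L" by (auto simp: sites_mod_def)

lemma not_self_neighbor: "\<not> neighbors K L v v"
proof
  assume "neighbors K L v v"
  moreover from this have "v \<in> V (fst v)" using neighbors_sites by (simp add: sites_mod_def)
  ultimately show False using V_not_neighbors by blast
qed

definition indep :: "site set \<Rightarrow> bool" where
  "indep A \<longleftrightarrow> A \<subseteq> sites K L \<and> (\<forall>v\<in>A. \<forall>w\<in>A. \<not> neighbors K L v w)"

lemma indep_finite: "indep A \<Longrightarrow> finite A"
  using finite_sites finite_subset by (auto simp: indep_def)

lemma indep_subset: "indep A \<Longrightarrow> B \<subseteq> A \<Longrightarrow> indep B"
  by (auto simp: indep_def)

lemma indep_V: "indep (V r)"
  using V_not_neighbors V_sites by (auto simp: indep_def)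

lemma indep_pt: "indep A \<Longrightarrow> pt x y \<in> A \<Longrightarrow> w \<in> nb x y \<Longrightarrow> w \<notin> A"
  using neighbors_pt[of x y w] pt_in_sites[of x y] by (auto simp: indep_def)

text \<open>
  \<open>linked m A B\<close>: single particles can be added and removed so as to lead from \<open>A\<close> to \<open>B\<close> through
  independent sets of at least \<open>m\<close> particles.
\<close>

inductive linked :: "int \<Rightarrow> site set \<Rightarrow> site set \<Rightarrow> bool" for m where
  refl: "indep A \<Longrightarrow> m \<le> int (card A) \<Longrightarrow> linked m A A"
| add: "linked m A B \<Longrightarrow> v \<notin> B \<Longrightarrow> indep (insert v B) \<Longrightarrow> linked m A (insert v B)"
| remove: "linked m A (insert v B) \<Longrightarrow> v \<notin> B \<Longrightarrow> m \<le> int (card B) \<Longrightarrow> linked m A B"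

lemma linked_end: "linked m A B \<Longrightarrow> indep B \<and> m \<le> int (card B)"
  by (induction rule: linked.induct) (auto simp: indep_finite intro: indep_subset dest: indep_finite)

lemma linked_trans: "linked m B C \<Longrightarrow> linked m A B \<Longrightarrow> linked m A C"
  by (induction rule: linked.induct) (auto intro: linked.intros)

lemma linked_mono: "linked m A B \<Longrightarrow> m' \<le> m \<Longrightarrow> linked m' A B"
  by (induction rule: linked.induct) (auto intro: linked.intros)

lemma linked_diff:
  assumes "indep A" "R \<subseteq> A" "m \<le> int (card A) - int (card R)"
  shows "linked m A (A - R)"
proof -
  have "finite R" using assms indep_finite finite_subset by blast
  then show ?thesis using assms(2,3)
  proof (induction R)
    case empty
    then show ?case using assms(1) by (auto intro: linked.refl)
  next
    case (insert v R)
    have eq: "A - R = insert v (A - insert v R)" using insert by auto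
    have fin: "finite A" using assms(1) by (rule indep_finite)
    have "linked m A (A - R)" using insert by auto
    then have "linked m A (insert v (A - insert v R))" using eq by simp
    moreover have "int (card (A - insert v R)) = int (card A) - int (card (insert v R))"
    proof -
      have "card (insert v R) \<le> card A" using fin insert by (intro card_mono) auto
      moreover have "card (A - insert v R) = card A - card (insert v R)"
        using insert by (intro card_Diff_subset) auto
      ultimately show ?thesis by (simp only: of_nat_diff)
    qed
    ultimately show ?case
      by - (rule linked.remove[of m A v], use insert.prems in simp_all)
  qed
qed

text \<open>
  Put a particle on \<open>v\<close> after clearing its neighbours.
\<close>

definition ins :: "site \<Rightarrow> site set \<Rightarrow> site set" where
  "ins v A = insert v (A - nbs v)"

lemma indep_ins: "indep A \<Longrightarrow> v \<in> sites K L \<Longrightarrow> indep (ins v A)"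
  unfolding ins_def indep_def nbs_def by (auto simp: not_self_neighbor dest: neighbors_sym)

text \<open>
  Clearing first costs at most \<open>c\<close> particles, of which one is regained. If \<open>v\<close> is occupied already nothing
  happens, which agrees with the formula for \<open>c \<ge> 1\<close>; hence the proviso for \<open>c = 0\<close>.
\<close>

lemma linked_ins:
  assumes A: "indep A" and v: "v \<in> sites K L"
    and c: "int (card (A \<inter> nbs v)) \<le> c" "c = 0 \<Longrightarrow> v \<notin> A" and m: "m \<le> int (card A) - c"
  shows "linked m A (ins v A)" and "int (card A) + 1 - c \<le> int (card (ins v A))"
proof -
  have fin: "finite A" using A by (rule indep_finite)
  have card_diff: "int (card (A - nbs v)) = int (card A) - int (card (A \<inter> nbs v))"
  proof -
    have "card (A \<inter> nbs v) \<le> card A" using fin by (intro card_mono) auto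
    moreover have "card (A - nbs v) = card A - card (A \<inter> nbs v)"
      using fin by (intro card_Diff_subset_Int) auto
    ultimately show ?thesis by (simp only: of_nat_diff)
  qed
  have diff: "linked m A (A - nbs v)"
    using linked_diff[OF A, of "A \<inter> nbs v" m] c m by (simp add: Diff_Int)
  have c0: "0 \<le> c" using c(1) by simp
  show "linked m A (ins v A)"
  proof (cases "v \<in> A - nbs v")
    case True
    then have "ins v A = A - nbs v" by (auto simp: ins_def)
    then show ?thesis using diff by simp
  next
    case False
    show ?thesis using linked.add[OF diff False] indep_ins[OF A v] unfolding ins_def by blast
  qed
  show "int (card A) + 1 - c \<le> int (card (ins v A))"
  proof (cases "v \<in> A")
    case True
    then have "A \<inter> nbs v = {}" using A by (auto simp: indep_def nbs_def)
    then have "A - nbs v = A" by auto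
    then have "ins v A = A" using True by (auto simp: ins_def)
    then show ?thesis using c(2) c0 True by (cases "c = 0") auto
  next
    case False
    then have "v \<notin> A - nbs v" by simp
    then have "int (card (ins v A)) = int (card (A - nbs v)) + 1"
      using fin by (simp add: ins_def del: Diff_iff)
    then show ?thesis using card_diff c by simp
  qed
qed

text \<open>
  Particles are placed greedily on the sites \<open>u 0, u 1, \<dots>\<close> of one type, where \<open>c j\<close> bounds the number of
  particles in the way of \<open>u j\<close>. The bound has to hold for all intermediate configurations \<open>C\<close>; what is
  known about these is that no particle of type \<open>r\<close> has been lost, that the previous sites have been
  filled and that nothing else has been added. The loss before step \<open>j\<close> is at most the sum of the \<open>c i - 1\<close>,
  and during step \<open>j\<close> it rises by up to \<open>c j\<close>.
\<close>

lemma fill: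
  fixes u :: "nat \<Rightarrow> site" and c :: "nat \<Rightarrow> int"
  assumes B: "indep B" and u: "\<And>j. j < n \<Longrightarrow> u j \<in> V r"
    and conflict: "\<And>j C. j < n \<Longrightarrow> indep C \<Longrightarrow> B \<inter> V r \<subseteq> C \<Longrightarrow> (\<forall>i<j. u i \<in> C) \<Longrightarrow> C \<subseteq> B \<union> u ` {..<j} \<Longrightarrow>
        int (card (C \<inter> nbs (u j))) \<le> c j \<and> (c j = 0 \<longrightarrow> u j \<notin> C)"
    and s: "\<And>j. j < n \<Longrightarrow> (\<Sum>i<j. c i - 1) + c j \<le> s" and s0: "0 \<le> s"
  shows "\<exists>C. linked (int (card B) - s) B C \<and> int (card B) - (\<Sum>i<n. c i - 1) \<le> int (card C) \<and>
    B \<inter> V r \<subseteq> C \<and> (\<forall>i<n. u i \<in> C) \<and> C \<subseteq> B \<union> u ` {..<n}"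
  using u conflict s
proof (induction n)
  case 0
  then show ?case using B s0 by (intro exI[of _ B]) (auto intro: linked.refl)
next
  case (Suc n)
  have "\<exists>C. linked (int (card B) - s) B C \<and> int (card B) - (\<Sum>i<n. c i - 1) \<le> int (card C) \<and>
    B \<inter> V r \<subseteq> C \<and> (\<forall>i<n. u i \<in> C) \<and> C \<subseteq> B \<union> u ` {..<n}"
    by (rule Suc.IH) (use Suc.prems in auto)
  then obtain C where C: "linked (int (card B) - s) B C" "int (card B) - (\<Sum>i<n. c i - 1) \<le> int (card C)"
    "B \<inter> V r \<subseteq> C" "\<forall>i<n. u i \<in> C" "C \<subseteq> B \<union> u ` {..<n}" by blast
  have indC: "indep C" using linked_end[OF C(1)] by simp
  have cf: "int (card (C \<inter> nbs (u n))) \<le> c n" "c n = 0 \<Longrightarrow> u n \<notin> C"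
    using Suc.prems(2)[of n C] C indC by auto
  have m: "int (card B) - s \<le> int (card C) - c n" using C(2) Suc.prems(3)[of n] by simp
  have un: "u n \<in> V r" "u n \<in> sites K L" using Suc.prems(1)[of n] V_sites by auto
  note step = linked_ins[OF indC un(2) cf m]
  have keep: "w \<in> ins (u n) C" if "w \<in> C" "w \<in> V r" for w
    using that V_not_neighbors[OF un(1)] by (auto simp: ins_def nbs_def)
  show ?case
  proof (intro exI[of _ "ins (u n) C"] conjI)
    show "linked (int (card B) - s) B (ins (u n) C)" using step(1) C(1) by (rule linked_trans)
    show "int (card B) - (\<Sum>i<Suc n. c i - 1) \<le> int (card (ins (u n) C))" using step(2) C(2) by simp
    show "B \<inter> V r \<subseteq> ins (u n) C" using keep C(3) by auto
    show "\<forall>i<Suc n. u i \<in> ins (u n) C"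
      using keep C(4) Suc.prems(1) by (auto simp: less_Suc_eq) (simp add: ins_def)
    show "ins (u n) C \<subseteq> B \<union> u ` {..<Suc n}" using C(5) by (auto simp: ins_def)
  qed
qed

text \<open>
  An independent set has at most one site on each edge.
\<close>

lemma card_edges:
  assumes "indep C" and "C \<inter> N \<subseteq> \<Union>E" "finite E" "\<And>e. e \<in> E \<Longrightarrow> \<exists>p q. e = {p, q} \<and> neighbors K L p q"
  shows "card (C \<inter> N) \<le> card E"
proof -
  have one: "card (C \<inter> e) \<le> 1" if eE: "e \<in> E" for e
  proof -
    obtain p q where e: "e = {p, q}" "neighbors K L p q" using assms(4)[OF eE] by blast
    have "C \<inter> e = {} \<or> C \<inter> e = {p} \<or> C \<inter> e = {q}" using e assms(1) by (auto simp: indep_def)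
    then show ?thesis by auto
  qed
  have "card (C \<inter> N) \<le> card (\<Union>e\<in>E. C \<inter> e)"
    using assms(2,3) indep_finite[OF assms(1)] by (intro card_mono) auto
  also have "\<dots> \<le> (\<Sum>e\<in>E. card (C \<inter> e))" using assms(3) by (rule card_UN_le)
  also have "\<dots> \<le> (\<Sum>e\<in>E. 1)" by (intro sum_mono one)
  finally show ?thesis by simp
qed

lemma covered_by_edge:
  assumes "indep C" "C \<inter> N \<subseteq> {p, q}" "neighbors K L p q"
  shows "card (C \<inter> N) \<le> 1"
proof -
  have "card (C \<inter> N) \<le> card {{p, q}}"
  proof (rule card_edges[OF assms(1)])
    show "\<exists>p q. e = {p, q} \<and> neighbors K L p q" if "e \<in> {{p, q}}" for e
      using that assms(3) by blast
  qed (use assms(2) in auto)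
  then show ?thesis by simp
qed

lemma covered_by_two_edges:
  assumes "indep C" "C \<inter> N \<subseteq> {p, q} \<union> {p', q'}" "neighbors K L p q" "neighbors K L p' q'"
  shows "card (C \<inter> N) \<le> 2"
proof -
  have "card (C \<inter> N) \<le> card {{p, q}, {p', q'}}"
  proof (rule card_edges[OF assms(1)])
    show "\<exists>p q. e = {p, q} \<and> neighbors K L p q" if "e \<in> {{p, q}, {p', q'}}" for e
      using that assms(3,4) by blast
  qed (use assms(2) in auto)
  also have "\<dots> \<le> 2" by (simp add: card_insert_if)
  finally show ?thesis .
qed

lemma nb_edge:
  assumes "even (x - y)"
  shows "neighbors K L (pt x y) (pt (x + 2) y)" "neighbors K L (pt x y) (pt (x + 1) (y + 1))"
    "neighbors K L (pt x y) (pt (x + 1) (y - 1))"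
  using assms by (auto simp: neighbors_pt nb_def)

section \<open>Nucleation along rows\<close>

text \<open>
  The six neighbours of a site form a hexagon. The particle at \<open>(x - 3, y + s)\<close> has emptied two adjacent
  ones, and the other four form a path, which is covered by two edges. A particle at
  \<open>(x + 3, y + s)\<close> empties one of these edges.
\<close>

lemma conflict_diagonal:
  assumes C: "indep C" and xy: "even (x - y)" and s: "s = 1 \<or> s = -1" and l: "pt (x - 3) (y + s) \<in> C"
  shows "card (C \<inter> nbs (pt x y)) \<le> 2"
    and "pt (x + 3) (y + s) \<in> C \<Longrightarrow> card (C \<inter> nbs (pt x y)) \<le> 1"
proof -
  have ex: "pt (x - 2) y \<notin> C" "pt (x - 1) (y + s) \<notin> C"
    by (rule indep_pt[OF C l], use s in \<open>force simp: nb_def add.commute\<close>)+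
  have e1: "neighbors K L (pt (x - 1) (y - s)) (pt (x + 1) (y - s))"
    using nb_edge(1)[of "x - 1" "y - s"] xy s by (auto simp: add.commute)
  have e2: "neighbors K L (pt (x + 1) (y + s)) (pt (x + 2) y)"
    using nb_edge(2)[of "x + 1" "y - 1"] nb_edge(3)[of "x + 1" "y + 1"] xy s by (auto simp: add.commute)
  show "card (C \<inter> nbs (pt x y)) \<le> 2"
    by (rule covered_by_two_edges[OF C _ e1 e2]) (use ex s in \<open>auto simp: nbs_pt[OF xy] nb_def\<close>)
  assume r: "pt (x + 3) (y + s) \<in> C"
  have ex': "pt (x + 2) y \<notin> C" "pt (x + 1) (y + s) \<notin> C"
    by (rule indep_pt[OF C r], use s in \<open>force simp: nb_def add.commute\<close>)+
  show "card (C \<inter> nbs (pt x y)) \<le> 1"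
    by (rule covered_by_edge[OF C _ e1]) (use ex ex' s in \<open>auto simp: nbs_pt[OF xy] nb_def\<close>)
qed

text \<open>
  The particle two rows below has emptied two neighbours, and two edges cover the others.
\<close>

lemma conflict_vertical:
  assumes C: "indep C" and xy: "even (x - y)" and l: "pt x (y - 2) \<in> C"
  shows "card (C \<inter> nbs (pt x y)) \<le> 2"
proof -
  have ex: "pt (x - 1) (y - 1) \<notin> C" "pt (x + 1) (y - 1) \<notin> C"
    using indep_pt[OF C l] by (auto simp: nb_def)
  have e1: "neighbors K L (pt (x - 2) y) (pt (x - 1) (y + 1))"
    using nb_edge(2)[of "x - 2" "y"] xy by (auto simp: add.commute)
  have e2: "neighbors K L (pt (x + 1) (y + 1)) (pt (x + 2) y)"
    using nb_edge(3)[of "x + 1" "y + 1"] xy by (auto simp: add.commute)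
  show ?thesis
    by (rule covered_by_two_edges[OF C _ e1 e2]) (use ex in \<open>auto simp: nbs_pt[OF xy] nb_def\<close>)
qed

text \<open>
  Particles of a full column at \<open>x - 3\<close> empty the left half of the hexagon around \<open>(x, y)\<close>. The right
  half is a path of three sites.
\<close>

lemma conflict_beside_column:
  assumes C: "indep C" and xy: "even (x - y)" and l: "pt (x - 3) (y + 1) \<in> C" "pt (x - 3) (y - 1) \<in> C"
  shows "C \<inter> nbs (pt x y) \<subseteq> {pt (x + 2) y, pt (x + 1) (y + 1), pt (x + 1) (y - 1)}"
    and "card (C \<inter> nbs (pt x y)) \<le> 2"
    and "pt (x + 1) (y - 1) \<notin> C \<Longrightarrow> card (C \<inter> nbs (pt x y)) \<le> 1"
proof -
  have ex: "pt (x - 2) y \<notin> C" "pt (x - 1) (y + 1) \<notin> C" "pt (x - 1) (y - 1) \<notin> C"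
    using indep_pt[OF C l(1)] indep_pt[OF C l(2)] by (auto simp: nb_def)
  then show sub: "C \<inter> nbs (pt x y) \<subseteq> {pt (x + 2) y, pt (x + 1) (y + 1), pt (x + 1) (y - 1)}"
    unfolding nbs_pt[OF xy] nb_def by auto
  have e1: "neighbors K L (pt (x + 1) (y + 1)) (pt (x + 2) y)"
    using nb_edge(3)[of "x + 1" "y + 1"] xy by (auto simp: add.commute)
  have e2: "neighbors K L (pt (x + 1) (y - 1)) (pt (x + 2) y)"
    using nb_edge(2)[of "x + 1" "y - 1"] xy by (auto simp: add.commute)
  show "card (C \<inter> nbs (pt x y)) \<le> 2"
    by (rule covered_by_two_edges[OF C _ e1 e2]) (use sub in auto)
  show "pt (x + 1) (y - 1) \<notin> C \<Longrightarrow> card (C \<inter> nbs (pt x y)) \<le> 1"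
    by (rule covered_by_edge[OF C _ e1]) (use sub in auto)
qed

text \<open>
  Each site of another type has a neighbour of type \<open>r\<close>.
\<close>

lemma V_maximal:
  assumes "indep C" "V r \<subseteq> C"
  shows "C = V r"
proof (rule antisym)
  show "C \<subseteq> V r"
  proof
    fix v assume v: "v \<in> C"
    then have "v \<in> sites K L" using assms(1) by (auto simp: indep_def)
    then obtain x y where xy: "v = pt x y" "even (x - y)" by (rule site_cases)
    have "[x = r] (mod 3) \<or> [x - 1 = r] (mod 3) \<or> [x + 1 = r] (mod 3)"
      unfolding cong_def by presburger
    then consider "[x = r] (mod 3)" | "[x - 1 = r] (mod 3)" | "[x + 1 = r] (mod 3)" by blast
    then show "v \<in> V r"
    proof cases
      case 1
      then show ?thesis using xy by (simp add: pt_in_V)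
    next
      case 2
      then have "pt (x - 1) (y + 1) \<in> C" using assms(2) xy by (auto simp: pt_in_V)
      then show ?thesis using indep_pt[OF assms(1), of x y "pt (x - 1) (y + 1)"] v xy by (simp add: nb_def)
    next
      case 3
      then have "pt (x + 1) (y + 1) \<in> C" using assms(2) xy by (auto simp: pt_in_V)
      then show ?thesis using indep_pt[OF assms(1), of x y "pt (x + 1) (y + 1)"] v xy by (simp add: nb_def)
    qed
  qed
qed (rule assms(2))

definition row_full :: "site set \<Rightarrow> int \<Rightarrow> int \<Rightarrow> bool" where
  "row_full C r y \<longleftrightarrow> (\<forall>x. even (x - y) \<and> [x = r] (mod 3) \<longrightarrow> pt x y \<in> C)"

definition col_full :: "site set \<Rightarrow> int \<Rightarrow> bool" where
  "col_full C x \<longleftrightarrow> (\<forall>y. even (x - y) \<longrightarrow> pt x y \<in> C)"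

lemma pt_shift_x: "pt (x + 6 * int L * k) y = pt x y"
  by (simp add: pt_def)

lemma pt_shift_y: "pt x (y + 2 * int K * k) = pt x y"
  by (simp add: pt_def)

lemma row_fullI:
  assumes "even (x1 - y)" "[x1 = r] (mod 3)" and full: "\<And>j. j < L \<Longrightarrow> pt (x1 + 6 * int j) y \<in> C"
  shows "row_full C r y"
  unfolding row_full_def
proof (intro allI impI)
  fix x assume x: "even (x - y) \<and> [x = r] (mod 3)"
  then have "6 dvd x - x1" using assms(1,2) unfolding cong_def by presburger
  then obtain q where "x - x1 = 6 * q" by (rule dvdE)
  then have q: "x = x1 + 6 * q" by simp
  define d where "d = q div int L"
  define j where "j = nat (q mod int L)"
  have j: "j < L" "int j = q mod int L" using L1 by (auto simp: j_def nat_less_iff)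
  have "q = int j + int L * d" using j by (simp add: d_def)
  then have "x = (x1 + 6 * int j) + 6 * int L * d" by (simp add: q algebra_simps)
  then have "pt x y = pt (x1 + 6 * int j) y" by (simp only: pt_shift_x)
  then show "pt x y \<in> C" using full[OF j(1)] by simp
qed

lemma col_fullI:
  assumes "even (x - y1)" and full: "\<And>j. j < K \<Longrightarrow> pt x (y1 + 2 * int j) \<in> C"
  shows "col_full C x"
  unfolding col_full_def
proof (intro allI impI)
  fix y assume y: "even (x - y)"
  then have "even (y - y1)" using assms(1) by presburger
  then obtain q where "y - y1 = 2 * q" by (rule evenE)
  then have q: "y = y1 + 2 * q" by simp
  define d where "d = q div int K"
  define j where "j = nat (q mod int K)"
  have j: "j < K" "int j = q mod int K" using K2 by (auto simp: j_def nat_less_iff)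
  have "q = int j + int K * d" using j by (simp add: d_def)
  then have "y = (y1 + 2 * int j) + 2 * int K * d" by (simp add: q algebra_simps)
  then have "pt x y = pt x (y1 + 2 * int j)" by (simp only: pt_shift_y)
  then show "pt x y \<in> C" using full[OF j(1)] by simp
qed

text \<open>
  The nucleus grows to a zigzag through the rows \<open>y0\<close> and \<open>y0 + 1\<close>. Each new particle lies diagonally
  next to the previous one, so it displaces at most two others; the last of the \<open>2 L\<close> particles has such
  a neighbour on both sides and displaces at most one.
\<close>

lemma row_strip:
  assumes A: "indep A" and v: "pt x0 y0 \<in> A"
  shows "\<exists>C. linked (int (card A) - (2 * int L - 1)) A C \<and> int (card A) - (2 * int L - 2) \<le> int (card C) \<and> row_full C x0 y0"
proof -
  have "pt x0 y0 \<in> sites K L" using A v by (auto simp: indep_def)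
  then have xy0: "even (x0 - y0)" by (simp only: pt_in_sites)
  define w where "w k = pt (x0 + 3 * int k) (y0 + int k mod 2)" for k
  define c where "c j = (if j < 2 * L - 2 then 2 else 1 :: int)" for j
  have w_last: "w (2 * L) = pt x0 y0"
    using pt_shift_x[of x0 1 y0] by (simp add: w_def mult.assoc)
  have sums: "(\<Sum>i<j. c i - 1) = int j" if "j \<le> 2 * L - 2" for j
    using that by (induction j) (auto simp: c_def)
  have "\<exists>C. linked (int (card A) - (2 * int L - 1)) A C \<and> int (card A) - (\<Sum>i<2 * L - 1. c i - 1) \<le> int (card C) \<and>
    A \<inter> V x0 \<subseteq> C \<and> (\<forall>i<2 * L - 1. w (Suc i) \<in> C) \<and> C \<subseteq> A \<union> (\<lambda>i. w (Suc i)) ` {..<2 * L - 1}"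
  proof (rule fill[OF A])
    show "w (Suc j) \<in> V x0" for j
    proof -
      have "even (x0 + 3 * int (Suc j) - (y0 + int (Suc j) mod 2))" using xy0 by presburger
      moreover have "[x0 + 3 * int (Suc j) = x0] (mod 3)" unfolding cong_def by presburger
      ultimately show ?thesis unfolding w_def pt_in_V by blast
    qed
    show "(\<Sum>i<j. c i - 1) + c j \<le> 2 * int L - 1" if "j < 2 * L - 1" for j
    proof -
      have "j \<le> 2 * L - 2" using that by simp
      from sums[OF this] show ?thesis using that L1 by (auto simp: c_def of_nat_diff)
    qed
    show "0 \<le> 2 * int L - 1" using L1 by simp
    fix j C assume j: "j < 2 * L - 1" and C: "indep C" and old: "A \<inter> V x0 \<subseteq> C" and new: "\<forall>i<j. w (Suc i) \<in> C"
    have "pt x0 y0 \<in> C" using v old xy0 by (auto simp: pt_in_V)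
    then have w0: "w 0 \<in> C" "w (2 * L) \<in> C" by (auto simp: w_last) (simp add: w_def)
    have prev: "w j \<in> C" using new w0 by (cases j) auto
    define x where "x = x0 + 3 * int (Suc j)"
    define y where "y = y0 + int (Suc j) mod 2"
    define s :: int where "s = (if even j then -1 else 1)"
    have y: "y + s = y0 + int j mod 2" unfolding y_def s_def by (simp add: mod_2_eq_odd)
    have xy: "even (x - y)" using xy0 unfolding x_def y_def by presburger
    have target: "w (Suc j) = pt x y" by (simp add: w_def x_def y_def)
    have p: "pt (x - 3) (y + s) \<in> C" using prev unfolding y by (simp add: w_def x_def)
    have s: "s = 1 \<or> s = -1" by (simp add: s_def)
    show "int (card (C \<inter> nbs (w (Suc j)))) \<le> c j \<and> (c j = 0 \<longrightarrow> w (Suc j) \<notin> C)"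
    proof (cases "j < 2 * L - 2")
      case True
      then show ?thesis using conflict_diagonal(1)[OF C xy s p] by (simp add: c_def target)
    next
      case False
      then have j': "j = 2 * L - 2" using j by simp
      then have "Suc (Suc j) = 2 * L" using L1 by simp
      then have "pt (x0 + 3 * int (Suc (Suc j))) (y0 + int (Suc (Suc j)) mod 2) \<in> C"
        using w0(2) by (metis w_def)
      then have "pt (x + 3) (y + s) \<in> C" unfolding y x_def by (simp add: algebra_simps)
      then show ?thesis using conflict_diagonal(2)[OF C xy s p] False by (simp add: c_def target)
    qed
  qed
  then obtain C where C: "linked (int (card A) - (2 * int L - 1)) A C" "int (card A) - (\<Sum>i<2 * L - 1. c i - 1) \<le> int (card C)"
    "A \<inter> V x0 \<subseteq> C" "\<forall>i<2 * L - 1. w (Suc i) \<in> C" by blast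
  have "2 * L - 1 = Suc (2 * L - 2)" using L1 by simp
  then have "(\<Sum>i<2 * L - 1. c i - 1) = 2 * int L - 2"
    using sums[of "2 * L - 2"] L1 by (simp add: c_def of_nat_diff)
  moreover have "row_full C x0 y0"
  proof (rule row_fullI[OF xy0])
    fix j assume "j < L"
    have "w (2 * j) \<in> C"
    proof (cases j)
      case 0
      then show ?thesis using v C(3) xy0 by (auto simp: w_def pt_in_V)
    next
      case (Suc i)
      then show ?thesis using C(4) \<open>j < L\<close> by (auto dest: spec[of _ "2 * i + 1"])
    qed
    then show "pt (x0 + 6 * int j) y0 \<in> C" by (simp add: w_def)
  qed simp
  ultimately show ?thesis using C by auto
qed

lemma row_fullD: "row_full B r y \<Longrightarrow> B \<inter> V r \<subseteq> C \<Longrightarrow> even (x - y) \<Longrightarrow> [x = r] (mod 3) \<Longrightarrow> pt x y \<in> C"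
  unfolding row_full_def using pt_in_V by blast

text \<open>
  The row below has emptied all neighbours of a new particle except two adjacent ones in the row
  above, so each step displaces at most one particle.
\<close>

lemma fill_row:
  assumes B: "indep B" and row: "row_full B r y"
  shows "\<exists>C. linked (int (card B) - 1) B C \<and> card B \<le> card C \<and> B \<inter> V r \<subseteq> C \<and> row_full C r (y + 1)"
proof -
  (* a number congruent to r modulo 3 with the parity of row y + 1 *)
  define x1 where "x1 = r + 3 * (r - y - 1)"
  have x1: "even (x1 - (y + 1))" "[x1 = r] (mod 3)" unfolding x1_def cong_def by presburger+
  define u where "u j = pt (x1 + 6 * int j) (y + 1)" for j
  have "\<exists>C. linked (int (card B) - 1) B C \<and> int (card B) - (\<Sum>i<L. 1 - 1) \<le> int (card C) \<and>
    B \<inter> V r \<subseteq> C \<and> (\<forall>i<L. u i \<in> C) \<and> C \<subseteq> B \<union> u ` {..<L}"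
  proof (rule fill[OF B])
    show "u j \<in> V r" for j
    proof -
      have "[x1 + 6 * int j = r] (mod 3)" using x1(2) unfolding cong_def by presburger
      moreover have "even (x1 + 6 * int j - (y + 1))" using x1(1) by presburger
      ultimately show ?thesis unfolding u_def pt_in_V by blast
    qed
    fix j C assume C: "indep C" and old: "B \<inter> V r \<subseteq> C"
    define x where "x = x1 + 6 * int j"
    have x: "even (x - (y + 1))" "[x = r] (mod 3)" using x1 unfolding x_def cong_def by presburger+
    have "even (x - 3 - y)" "[x - 3 = r] (mod 3)" "even (x + 3 - y)" "[x + 3 = r] (mod 3)"
      using x unfolding cong_def by presburger+
    then have "pt (x - 3) y \<in> C" "pt (x + 3) y \<in> C"
      by (auto intro: row_fullD[OF row old])
    then have "card (C \<inter> nbs (u j)) \<le> 1"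
      using conflict_diagonal(2)[OF C x(1), of "-1"] by (simp add: u_def x_def)
    then show "int (card (C \<inter> nbs (u j))) \<le> 1 \<and> (1 = (0::int) \<longrightarrow> u j \<notin> C)" by simp
  qed auto
  then obtain C where C: "linked (int (card B) - 1) B C" "card B \<le> card C" "B \<inter> V r \<subseteq> C" "\<forall>i<L. u i \<in> C" by auto
  moreover have "row_full C r (y + 1)" using row_fullI[OF x1] C(4) by (simp add: u_def)
  ultimately show ?thesis by blast
qed

lemma row_full_subset: "row_full B r y \<Longrightarrow> B \<inter> V r \<subseteq> C \<Longrightarrow> row_full C r y"
  unfolding row_full_def using pt_in_V by blast

lemma spread_rows:
  assumes B: "indep B" and row: "row_full B r y"
  shows "linked (int (card B) - 1) B (V r)"
proof -
  have "\<exists>C. linked (int (card B) - 1) B C \<and> card B \<le> card C \<and> (\<forall>i\<le>n. row_full C r (y + int i))" for n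
  proof (induction n)
    case 0
    then show ?case using B row by (intro exI[of _ B]) (auto intro: linked.refl)
  next
    case (Suc n)
    then obtain C where C: "linked (int (card B) - 1) B C" "card B \<le> card C" "\<forall>i\<le>n. row_full C r (y + int i)" by blast
    obtain D where D: "linked (int (card C) - 1) C D" "card C \<le> card D" "C \<inter> V r \<subseteq> D" "row_full D r (y + int n + 1)"
      using fill_row[of C r "y + int n"] linked_end[OF C(1)] C(3) by auto
    have "linked (int (card B) - 1) B D" using linked_trans[OF linked_mono[OF D(1)] C(1)] C(2) by simp
    moreover have "row_full D r (y + int i)" if "i \<le> Suc n" for i
    proof (cases "i = Suc n")
      case True
      then show ?thesis using D(4) by (simp add: add_ac)
    next
      case False
      then show ?thesis using that C(3) row_full_subset[OF _ D(3)] by simp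
    qed
    ultimately show ?case using C(2) D(2) by (intro exI[of _ D]) auto
  qed
  then obtain C where C: "linked (int (card B) - 1) B C" "\<forall>i\<le>2 * K. row_full C r (y + int i)" by blast
  have "V r \<subseteq> C"
  proof
    fix v assume v: "v \<in> V r"
    then obtain x y' where xy: "v = pt x y'" "even (x - y')" using V_sites site_cases by blast
    define i where "i = nat ((y' - y) mod (2 * int K))"
    have i: "i \<le> 2 * K" "int i = (y' - y) mod (2 * int K)"
      using K2 pos_mod_bound[of "2 * int K" "y' - y"] by (auto simp: i_def nat_le_iff less_imp_le)
    define d where "d = (y' - y) div (2 * int K)"
    have "y' = (y + int i) + 2 * int K * d"
      using mult_div_mod_eq[of "2 * int K" "y' - y"] unfolding i(2) d_def by linarith
    then have eq: "v = pt x (y + int i)" unfolding xy(1) by (simp only: pt_shift_y)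
    then show "v \<in> C" using C(2) i(1) v by (auto simp: row_full_def pt_in_V)
  qed
  then show ?thesis using V_maximal linked_end C(1) by blast
qed

lemma nucleate_row:
  assumes A: "indep A" and v: "pt x0 y0 \<in> A"
  shows "linked (int (card A) - (2 * int L - 1)) A (V x0)"
proof -
  obtain C where C: "linked (int (card A) - (2 * int L - 1)) A C" "int (card A) - (2 * int L - 2) \<le> int (card C)" "row_full C x0 y0"
    using row_strip[OF A v] by blast
  show ?thesis
    using linked_trans[OF linked_mono[OF spread_rows[OF _ C(3)]] C(1)] linked_end[OF C(1)] C(2) by simp
qed

section \<open>Nucleation along columns\<close>

text \<open>
  The nucleus grows to a full column, from bottom to top. Each new particle displaces at most two.
\<close>

lemma strip_column:
  assumes A: "indep A" and v: "pt x0 y0 \<in> A"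
  shows "\<exists>C. linked (int (card A) - int K) A C \<and> int (card A) - (int K - 1) \<le> int (card C) \<and>
    col_full C x0 \<and> C \<subseteq> A \<union> V x0"
proof -
  have "pt x0 y0 \<in> sites K L" using A v by (auto simp: indep_def)
  then have xy0: "even (x0 - y0)" by (simp only: pt_in_sites)
  define w where "w k = pt x0 (y0 + 2 * int k)" for k
  have wV: "w k \<in> V x0" for k using xy0 by (simp add: w_def pt_in_V)
  have "\<exists>C. linked (int (card A) - int K) A C \<and> int (card A) - (\<Sum>i<K - 1. 2 - 1) \<le> int (card C) \<and>
    A \<inter> V x0 \<subseteq> C \<and> (\<forall>i<K - 1. w (Suc i) \<in> C) \<and> C \<subseteq> A \<union> (\<lambda>i. w (Suc i)) ` {..<K - 1}"
  proof (rule fill[OF A])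
    show "w (Suc j) \<in> V x0" for j by (rule wV)
    show "(\<Sum>i<j. 2 - 1) + 2 \<le> int K" if "j < K - 1" for j using that by simp
    fix j C assume C: "indep C" and old: "A \<inter> V x0 \<subseteq> C" and new: "\<forall>i<j. w (Suc i) \<in> C" and "j < K - 1"
    have "w j \<in> C"
    proof (cases j)
      case 0
      then show ?thesis using v old wV[of 0] by (auto simp: w_def)
    qed (use new in auto)
    moreover have "y0 + 2 * int (Suc j) - 2 = y0 + 2 * int j" by simp
    moreover have "even (x0 - (y0 + 2 * int (Suc j)))" using xy0 by presburger
    ultimately have "card (C \<inter> nbs (w (Suc j))) \<le> 2"
      unfolding w_def by (intro conflict_vertical[OF C]) simp_all
    then show "int (card (C \<inter> nbs (w (Suc j)))) \<le> 2 \<and> (2 = (0::int) \<longrightarrow> w (Suc j) \<notin> C)" by simp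
  qed simp
  then obtain C where C: "linked (int (card A) - int K) A C" "int (card A) - int (K - 1) \<le> int (card C)"
    "A \<inter> V x0 \<subseteq> C" "\<forall>i<K - 1. w (Suc i) \<in> C" "C \<subseteq> A \<union> (\<lambda>i. w (Suc i)) ` {..<K - 1}" by auto
  have "col_full C x0"
  proof (rule col_fullI[OF xy0])
    fix j assume "j < K"
    then show "pt x0 (y0 + 2 * int j) \<in> C"
      using C(3,4) v wV[of 0] by (cases j) (auto simp: w_def)
  qed
  moreover have "C \<subseteq> A \<union> V x0" using C(5) wV by auto
  ultimately show ?thesis using C(1,2) K2 by (auto simp: of_nat_diff)
qed

lemma col_fullD: "col_full B x \<Longrightarrow> [x = r] (mod 3) \<Longrightarrow> B \<inter> V r \<subseteq> C \<Longrightarrow> even (x - y) \<Longrightarrow> pt x y \<in> C"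
  unfolding col_full_def using pt_in_V by blast

text \<open>
  The phase spreads from the full column \<open>x\<close> to column \<open>x + 3\<close>. What is in the way of a site are one site
  of column \<open>x + 5\<close> and two sites of column \<open>x + 4\<close>. If column \<open>x + 4\<close> has a hole, filling starts above
  the hole, and each step displaces at most one particle. If column \<open>x + 4\<close> is full, the first step displaces two
  particles, but then column \<open>x + 5\<close> is empty and the last step, whose neighbours in column \<open>x + 4\<close> are
  already gone, displaces none.
\<close>

lemma fill_column:
  assumes B: "indep B" and col: "col_full B x" and r: "[x = r] (mod 3)"
    and s: "s = 1 \<and> \<not> col_full B (x + 4) \<or> s = 2 \<and> col_full B (x + 4)"
  shows "\<exists>C. linked (int (card B) - s) B C \<and> card B \<le> card C \<and> B \<inter> V r \<subseteq> C \<and> col_full C (x + 3) \<and> C \<subseteq> B \<union> V r"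
proof -
  obtain y1 where y1: "even (x - y1)" "s = 1 \<Longrightarrow> pt (x + 4) y1 \<notin> B"
  proof (cases "s = 1")
    case True
    then obtain y where "even (x + 4 - y)" "pt (x + 4) y \<notin> B" using s by (auto simp: col_full_def)
    then show ?thesis by (intro that[of y]) auto
  next
    case False
    then show ?thesis by (intro that[of x]) auto
  qed
  define u where "u j = pt (x + 3) (y1 + 1 + 2 * int j)" for j
  (* in the case s = 2 the two particles displaced first are compensated by the last step *)
  define c :: "nat \<Rightarrow> int" where
    "c j = (if s = 1 then 1 else if j = 0 then 2 else if j = K - 1 then 0 else 1)" for j
  have sums: "(\<Sum>i<j. c i - 1) = (if s = 1 \<or> j = 0 then 0 else 1)" if "j \<le> K - 1" for j
    using that by (induction j) (auto simp: c_def)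
  have sum_all: "(\<Sum>i<K. c i - 1) = 0"
  proof -
    have "K = Suc (K - 1)" using K2 by simp
    then have "(\<Sum>i<K. c i - 1) = (\<Sum>i<K - 1. c i - 1) + (c (K - 1) - 1)" by (metis sum.lessThan_Suc)
    then show ?thesis using sums[of "K - 1"] K2 by (auto simp: c_def)
  qed
  have x3: "[x + 3 = r] (mod 3)" using r unfolding cong_def by presburger
  have uV: "u j \<in> V r" for j
  proof -
    have "even (x + 3 - (y1 + 1 + 2 * int j))" using y1(1) by presburger
    then show ?thesis unfolding u_def pt_in_V using x3 by blast
  qed
  have "\<exists>C. linked (int (card B) - s) B C \<and> int (card B) - (\<Sum>i<K. c i - 1) \<le> int (card C) \<and>
    B \<inter> V r \<subseteq> C \<and> (\<forall>i<K. u i \<in> C) \<and> C \<subseteq> B \<union> u ` {..<K}"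
  proof (rule fill[OF B uV])
    show "(\<Sum>i<j. c i - 1) + c j \<le> s" if "j < K" for j
      using sums[of j] that s K2 by (auto simp: c_def)
    show "0 \<le> s" using s by auto
    fix j C assume j: "j < K" and C: "indep C" and old: "B \<inter> V r \<subseteq> C" and new: "\<forall>i<j. u i \<in> C"
      and sub: "C \<subseteq> B \<union> u ` {..<j}"
    have subV: "C \<subseteq> B \<union> V r" using sub uV by auto
    define X where "X = x + 3"
    define y where "y = y1 + 1 + 2 * int j"
    have xy: "even (X - y)" using y1(1) unfolding X_def y_def by presburger
    have target: "u j = pt X y" by (simp add: u_def X_def y_def)
    have ev: "even (x - (y + 1))" "even (x - (y - 1))" using xy unfolding X_def by presburger+
    have l: "pt (X - 3) (y + 1) \<in> C" "pt (X - 3) (y - 1) \<in> C"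
      using col_fullD[OF col r old] ev by (auto simp: X_def)
    note conflict = conflict_beside_column[OF C xy l]
    have notV: "pt (X + 1) y' \<notin> V r" "pt (X + 2) y' \<notin> V r" for y'
      using cong3_shift[OF x3] by (auto simp: pt_in_V X_def)
    have above: "pt (X + 1) (y - 1) \<notin> C" if "0 < j"
    proof -
      have "u (j - 1) \<in> C" using new that by simp
      moreover have "y1 + 1 + 2 * int (j - 1) = y - 2" using that by (simp add: y_def of_nat_diff)
      ultimately have "pt X (y - 2) \<in> C" by (simp only: u_def X_def)
      then show ?thesis by (rule indep_pt[OF C]) (simp add: nb_def add.commute)
    qed
    have "c j = 1 \<and> (s = 1 \<or> 0 < j) \<or> c j = 2 \<or> s = 2 \<and> j = K - 1 \<and> 0 < j \<and> c j = 0"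
      using s by (cases "s = 1"; cases "j = 0"; cases "j = K - 1") (simp_all add: c_def)
    then consider (light) "c j = 1" "s = 1 \<or> 0 < j" | (first) "c j = 2" | (last) "s = 2" "j = K - 1" "0 < j" "c j = 0"
      by blast
    then show "int (card (C \<inter> nbs (u j))) \<le> c j \<and> (c j = 0 \<longrightarrow> u j \<notin> C)"
    proof cases
      case light
      have "pt (X + 1) (y - 1) \<notin> C"
      proof (cases "j = 0")
        case True
        then have "pt (X + 1) (y - 1) \<notin> B" using light y1(2) by (simp add: X_def y_def add.commute)
        then show ?thesis using subV notV by blast
      qed (use above in auto)
      then show ?thesis using conflict(3) light by (simp add: target)
    next
      case first
      then show ?thesis using conflict(2) by (simp add: target)
    next
      case last
      have full: "pt (X + 1) (y - 1) \<in> B"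
      proof -
        have e: "even (x + 4 - (y - 1))" and X4: "X + 1 = x + 4" using ev(2) by (auto simp: X_def)
        have "col_full B (x + 4)" using s last(1) by simp
        then show ?thesis unfolding X4 col_full_def using e by blast
      qed
      have "u 0 \<in> C" using new last by simp
      moreover have "u 0 = pt X (y + 2)"
        using pt_shift_y[of X "y1 + 1" 1] last(2) K2
        by (simp add: u_def X_def y_def of_nat_diff algebra_simps)
      ultimately have "pt (X + 1) (y + 1) \<notin> C"
        by (intro indep_pt[OF C, of X "y + 2"]) (auto simp: nb_def add.commute)
      moreover have "pt (X + 2) y \<notin> B"
        by (rule indep_pt[OF B full]) (simp add: nb_def add.commute)
      then have "pt (X + 2) y \<notin> C" using subV notV by blast
      ultimately have "C \<inter> nbs (u j) = {}"
        using conflict(1) above[OF last(3)] unfolding target by blast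
      moreover have "u j \<notin> C"
      proof
        assume "u j \<in> C"
        have "u j \<notin> B"
          unfolding target by (rule indep_pt[OF B full]) (simp add: nb_def add.commute)
        then obtain i where i: "i < j" "u j = u i" using sub \<open>u j \<in> C\<close> by auto
        then have "[y1 + 1 + 2 * int j = y1 + 1 + 2 * int i] (mod 2 * int K)"
          by (simp add: u_def pt_eq_iff)
        then have "2 * int K dvd 2 * int (j - i)"
          using i(1) by (simp add: cong_iff_dvd_diff of_nat_diff right_diff_distrib)
        then have "int K dvd int (j - i)" by simp
        then have "K \<le> j - i" using i(1) by (auto dest: zdvd_imp_le)
        then show False using j i(1) by simp
      qed
      ultimately show ?thesis using last by simp
    qed
  qed
  then obtain C where C: "linked (int (card B) - s) B C" "card B \<le> card C" "B \<inter> V r \<subseteq> C"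
    "\<forall>i<K. u i \<in> C" "C \<subseteq> B \<union> u ` {..<K}" unfolding sum_all by auto
  have "col_full C (x + 3)"
  proof (rule col_fullI)
    show "even (x + 3 - (y1 + 1))" using y1(1) by presburger
  qed (use C(4) in \<open>simp add: u_def\<close>)
  then show ?thesis using C uV by (intro exI[of _ C]) auto
qed

text \<open>
  Only particles of type \<open>r\<close> are added, so the columns of type \<open>r + 1\<close> do not become full on the way.
\<close>

lemma spread_columns:
  assumes B: "indep B" and col: "col_full B x" and r: "[x = r] (mod 3)"
    and s: "s = 1 \<and> (\<forall>x'. [x' = r + 1] (mod 3) \<longrightarrow> \<not> col_full B x') \<or> s = 2"
  shows "linked (int (card B) - s) B (V r)"
proof -
  have "\<exists>C. linked (int (card B) - s) B C \<and> card B \<le> card C \<and> C \<subseteq> B \<union> V r \<and> (\<forall>i\<le>n. col_full C (x + 3 * int i))" for n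
  proof (induction n)
    case 0
    then show ?case using B col s by (intro exI[of _ B]) (auto intro: linked.refl)
  next
    case (Suc n)
    then obtain C where C: "linked (int (card B) - s) B C" "card B \<le> card C" "C \<subseteq> B \<union> V r"
      "\<forall>i\<le>n. col_full C (x + 3 * int i)" by blast
    let ?x = "x + 3 * int n"
    have rx: "[?x = r] (mod 3)" using r unfolding cong_def by presburger
    have x4: "[?x + 4 = r + 1] (mod 3)" using r unfolding cong_def by presburger
    define s' :: int where "s' = (if col_full C (?x + 4) then 2 else 1)"
    have "s' \<le> s"
    proof (cases "s = 1")
      case True
      then have "\<not> col_full B (?x + 4)" using s x4 by auto
      then obtain y where y: "even (?x + 4 - y)" "pt (?x + 4) y \<notin> B" by (auto simp: col_full_def)
      have "pt (?x + 4) y \<notin> V r" using x4 unfolding pt_in_V cong_def by presburger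
      then have "\<not> col_full C (?x + 4)" using y C(3) by (auto simp: col_full_def)
      then show ?thesis using True by (simp add: s'_def)
    next
      case False
      then show ?thesis using s by (simp add: s'_def)
    qed
    obtain D where D: "linked (int (card C) - s') C D" "card C \<le> card D" "C \<inter> V r \<subseteq> D" "col_full D (?x + 3)" "D \<subseteq> C \<union> V r"
    proof -
      have "col_full C ?x" using C(4) by simp
      moreover have "s' = 1 \<and> \<not> col_full C (?x + 4) \<or> s' = 2 \<and> col_full C (?x + 4)"
        by (simp add: s'_def)
      ultimately show ?thesis using fill_column[of C ?x r s'] linked_end[OF C(1)] rx that by blast
    qed
    have "linked (int (card B) - s) B D"
      using linked_trans[OF linked_mono[OF D(1)] C(1)] C(2) \<open>s' \<le> s\<close> by simp
    moreover have "col_full D (x + 3 * int i)" if "i \<le> Suc n" for i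
    proof (cases "i = Suc n")
      case True
      then show ?thesis using D(4) by (simp add: add_ac)
    next
      case False
      then have "col_full C (x + 3 * int i)" using that C(4) by simp
      moreover have "[x + 3 * int i = r] (mod 3)" using r unfolding cong_def by presburger
      ultimately show ?thesis using col_fullD[OF _ _ D(3)] unfolding col_full_def[of D] by blast
    qed
    ultimately show ?case using C(2,3) D(2,5) by (intro exI[of _ D]) auto
  qed
  then obtain C where C: "linked (int (card B) - s) B C" "\<forall>i\<le>2 * L. col_full C (x + 3 * int i)" by blast
  have "V r \<subseteq> C"
  proof
    fix v assume v: "v \<in> V r"
    then obtain x' y where xy: "v = pt x' y" "even (x' - y)" using V_sites site_cases by blast
    then have "[x' = r] (mod 3)" using v by (simp add: pt_in_V)
    then have "[x = x'] (mod 3)" using r cong_sym cong_trans by blast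
    then have "3 dvd x' - x" using cong_iff_dvd_diff cong_sym by blast
    then obtain q where "x' - x = 3 * q" by (rule dvdE)
    then have q: "x' = x + 3 * q" by simp
    define d where "d = q div (2 * int L)"
    define i where "i = nat (q mod (2 * int L))"
    have i: "i \<le> 2 * L" "int i = q mod (2 * int L)"
      using L1 pos_mod_bound[of "2 * int L" q] by (auto simp: i_def nat_le_iff less_imp_le)
    have "q = int i + 2 * int L * d"
      using mult_div_mod_eq[of "2 * int L" q] unfolding i(2) d_def by linarith
    then have x': "x' = (x + 3 * int i) + 6 * int L * d" by (simp add: q algebra_simps)
    then have eq: "v = pt (x + 3 * int i) y" unfolding xy(1) by (simp only: pt_shift_x)
    have "even (x + 3 * int i - y)" using xy(2) unfolding x' by simp
    then show "v \<in> C" using C(2) i(1) unfolding eq col_full_def by blast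
  qed
  then show ?thesis using V_maximal linked_end C(1) by blast
qed

text \<open>
  If some column is full, it serves as nucleus and nothing has to be built. Otherwise building a
  column ends with at most \<open>K - 1\<close> particles lost, and as no column of type \<open>x0 + 1\<close> is full the
  spreading adds at most one to this loss at any time.
\<close>

lemma nucleate_column:
  assumes A: "indep A" and v: "pt x0 y0 \<in> A"
  shows "\<exists>r. linked (int (card A) - int K) A (V r)"
proof (cases "\<exists>x. col_full A x")
  case True
  then obtain x where "col_full A x" by blast
  then have "linked (int (card A) - 2) A (V x)" by (intro spread_columns[OF A]) auto
  then show ?thesis using linked_mono K2 by (intro exI[of _ x]) auto
next
  case False
  obtain C where C: "linked (int (card A) - int K) A C" "int (card A) - (int K - 1) \<le> int (card C)"
    "col_full C x0" "C \<subseteq> A \<union> V x0" using strip_column[OF A v] by blast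
  have "\<not> col_full C x'" if x': "[x' = x0 + 1] (mod 3)" for x'
  proof -
    obtain y where y: "even (x' - y)" "pt x' y \<notin> A" using False by (auto simp: col_full_def)
    have "pt x' y \<notin> V x0" using x' unfolding pt_in_V cong_def by presburger
    then show ?thesis using y C(4) by (auto simp: col_full_def)
  qed
  then have "linked (int (card C) - 1) C (V x0)"
    using linked_end[OF C(1)] C(3) by (intro spread_columns) auto
  then have "linked (int (card A) - int K) A (V x0)"
    using linked_trans[OF linked_mono C(1)] C(2) by simp
  then show ?thesis by blast
qed

definition barrier_height :: int where
  "barrier_height = int (min K (2 * L))"

text \<open>
  Any particle can serve as nucleus; the direction of the strip is chosen according to which of \<open>K\<close> and
  \<open>2 L\<close> is smaller.
\<close>

lemma relax_to_ground:
  assumes A: "indep A"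
  shows "\<exists>r. linked (int (card A) - barrier_height) A (V r)"
proof -
  have *: "\<exists>r. linked (int (card A) - barrier_height) A (V r)" if A: "indep A" "A \<noteq> {}" for A
  proof -
    obtain v where v: "v \<in> A" using A by blast
    then have "v \<in> sites K L" using A by (auto simp: indep_def)
    then obtain x y where xy: "v = pt x y" by (rule site_cases)
    show ?thesis
    proof (cases "K \<le> 2 * L")
      case True
      then show ?thesis using nucleate_column[OF A(1)] v by (simp add: xy barrier_height_def)
    next
      case False
      have "linked (int (card A) - (2 * int L - 1)) A (V x)" using nucleate_row[OF A(1)] v xy by simp
      then have "linked (int (card A) - barrier_height) A (V x)"
        using False by (elim linked_mono) (simp add: barrier_height_def)
      then show ?thesis by blast
    qed
  qed
  show ?thesis
  proof (cases "A = {}")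
    case True
    define v where "v = pt 0 0"
    have v: "indep {v}" using not_self_neighbor by (auto simp: indep_def v_def pt_in_sites)
    obtain r where r: "linked (int (card {v}) - barrier_height) {v} (V r)" using *[OF v] by auto
    have "linked (int (card A) - barrier_height) A A" using A True by (intro linked.refl) (auto simp: barrier_height_def)
    then have "linked (int (card A) - barrier_height) A {v}" using linked.add[of _ A A v] v True by simp
    then have "linked (int (card A) - barrier_height) A (V r)"
      using linked_trans[OF linked_mono[OF r]] True by simp
    then show ?thesis by blast
  qed (use * A in auto)
qed

text \<open>
  Inside a ground state there is no nucleus of another type. If \<open>2 L < K\<close>, three particles are removed
  to make room for one, a net loss of two, after which the growth of a strip loses another \<open>2 L - 1\<close>.
  Otherwise one column is emptied, so that the particles of the next column of the same type can be
  shifted by two, one at a time; then the new phase spreads from the shifted column.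
\<close>

lemma cross_between_grounds:
  "linked (int (card (V r)) - barrier_height - 1) (V r) (V (r + 1))"
proof (cases "K \<le> 2 * L")
  case False
  define v where "v = pt (r + 1) (r + 1)"
  have vs: "v \<in> sites K L" by (simp add: v_def pt_in_sites)
  let ?e1 = "{pt (r + 1 + 1) (r + 1 + 1), pt (r + 1 + 2) (r + 1)}"
  let ?e2 = "{pt (r + 1 - 2) (r + 1), pt (r + 1 - 1) (r + 1 + 1)}"
  let ?e3 = "{pt (r + 1 - 1) (r + 1 - 1), pt (r + 1 + 1) (r + 1 - 1)}"
  have edges: "neighbors K L (pt (r + 1 + 1) (r + 1 + 1)) (pt (r + 1 + 2) (r + 1))"
    "neighbors K L (pt (r + 1 - 2) (r + 1)) (pt (r + 1 - 1) (r + 1 + 1))"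
    "neighbors K L (pt (r + 1 - 1) (r + 1 - 1)) (pt (r + 1 + 1) (r + 1 - 1))"
    using nb_edge(3)[of "r + 2" "r + 2"] nb_edge(2)[of "r - 1" "r + 1"] nb_edge(1)[of r r]
    by (simp_all add: add.commute)
  have "card (V r \<inter> nbs v) \<le> card {?e1, ?e2, ?e3}"
  proof (rule card_edges[OF indep_V])
    show "V r \<inter> nbs v \<subseteq> \<Union> {?e1, ?e2, ?e3}" unfolding v_def by (subst nbs_pt) (auto simp: nb_def)
    show "\<exists>p q. e = {p, q} \<and> neighbors K L p q" if "e \<in> {?e1, ?e2, ?e3}" for e
      using that edges by blast
  qed simp
  also have "\<dots> \<le> 3" by (simp add: card_insert_if)
  finally have c: "int (card (V r \<inter> nbs v)) \<le> 3" by simp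
  let ?B = "ins v (V r)"
  have B: "linked (int (card (V r)) - 3) (V r) ?B" "int (card (V r)) + 1 - 3 \<le> int (card ?B)"
    using linked_ins[OF indep_V vs c] by auto
  have "linked (int (card ?B) - (2 * int L - 1)) ?B (V (r + 1))"
    by (rule nucleate_row[of _ _ "r + 1"]) (use linked_end[OF B(1)] in \<open>auto simp: ins_def v_def\<close>)
  then have "linked (int (card (V r)) - barrier_height - 1) ?B (V (r + 1))"
    using B(2) False by (elim linked_mono) (simp add: barrier_height_def)
  moreover have "linked (int (card (V r)) - barrier_height - 1) (V r) ?B"
    using B(1) False L1 by (elim linked_mono) (simp add: barrier_height_def)
  ultimately show ?thesis by (rule linked_trans)
next
  case True
  define R where "R = (\<lambda>j. pt r (r + 2 * int j)) ` {..<K}"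
  have "col_full R r" by (rule col_fullI[of r r]) (auto simp: R_def)
  have R: "R \<subseteq> V r" by (auto simp: R_def pt_in_V)
  have "card R \<le> K" unfolding R_def using card_image_le[of "{..<K}"] by simp
  define B where "B = V r - R"
  have B: "linked (int (card (V r)) - int K) (V r) B"
    unfolding B_def using indep_V R \<open>card R \<le> K\<close> by (intro linked_diff) auto
  have indB: "indep B" using linked_end[OF B] by simp
  have Bc: "int (card (V r)) - int K \<le> int (card B)" using linked_end[OF B] by simp
  define u where "u j = pt (r + 1) (r + 1 + 2 * int j)" for j
  have uV: "u j \<in> V (r + 1)" for j by (simp add: u_def pt_in_V)
  have "\<exists>C. linked (int (card B) - 1) B C \<and> int (card B) - (\<Sum>i<K. 1 - 1) \<le> int (card C) \<and>
    B \<inter> V (r + 1) \<subseteq> C \<and> (\<forall>i<K. u i \<in> C) \<and> C \<subseteq> B \<union> u ` {..<K}"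
  proof (rule fill[OF indB uV])
    fix j C assume C: "indep C" and sub: "C \<subseteq> B \<union> u ` {..<j}"
    define x where "x = r + 1"
    define y where "y = r + 1 + 2 * int j"
    have xy: "even (x - y)" by (simp add: x_def y_def)
    have CV: "C \<subseteq> (V r - R) \<union> V x" using sub uV by (auto simp: B_def x_def)
    have "\<not> [r + 2 = r] (mod 3)" "\<not> [r + 2 = r + 1] (mod 3)" "\<not> [r - 1 = r] (mod 3)" "\<not> [r - 1 = r + 1] (mod 3)" "\<not> [r = r + 1] (mod 3)"
      unfolding cong_def by presburger+
    note types = this
    have "pt r (y + 1) \<in> R" "pt r (y - 1) \<in> R"
      using \<open>col_full R r\<close> unfolding col_full_def by (auto simp: y_def)
    moreover have "pt r (y + 1) \<notin> V x" "pt r (y - 1) \<notin> V x"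
      using types by (auto simp: x_def pt_in_V)
    ultimately have "pt (x - 1) (y + 1) \<notin> C" "pt (x - 1) (y - 1) \<notin> C"
      using CV by (auto simp: x_def)
    moreover have "pt (x - 2) y \<notin> V r \<union> V x" "pt (x + 1) (y + 1) \<notin> V r \<union> V x" "pt (x + 1) (y - 1) \<notin> V r \<union> V x"
      using types by (simp_all add: x_def pt_in_V add.commute)
    then have "pt (x - 2) y \<notin> C" "pt (x + 1) (y + 1) \<notin> C" "pt (x + 1) (y - 1) \<notin> C"
      using CV by auto
    moreover have "u j = pt x y" by (simp add: u_def x_def y_def)
    ultimately have "C \<inter> nbs (u j) \<subseteq> {pt (x + 2) y}"
      using nbs_pt[OF xy] by (auto simp: nb_def)
    then have "card (C \<inter> nbs (u j)) \<le> card {pt (x + 2) y}" by (intro card_mono) auto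
    then show "int (card (C \<inter> nbs (u j))) \<le> 1 \<and> (1 = (0::int) \<longrightarrow> u j \<notin> C)" by simp
  qed auto
  then obtain C where C: "linked (int (card B) - 1) B C" "card B \<le> card C" "\<forall>i<K. u i \<in> C" "C \<subseteq> B \<union> u ` {..<K}" by auto
  have "col_full C (r + 1)" by (rule col_fullI[of "r + 1" "r + 1"]) (use C(3) in \<open>auto simp: u_def\<close>)
  moreover have "\<not> col_full C x'" if x': "[x' = r + 1 + 1] (mod 3)" for x'
  proof -
    have "pt x' x' \<notin> V r" "pt x' x' \<notin> V (r + 1)" using x' unfolding pt_in_V cong_def by presburger+
    then have "pt x' x' \<notin> C" using C(4) uV by (auto simp: B_def)
    then show ?thesis by (auto simp: col_full_def)
  qed
  ultimately have "linked (int (card C) - 1) C (V (r + 1))"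
    using linked_end[OF C(1)] by (intro spread_columns) auto
  then have "linked (int (card (V r)) - barrier_height - 1) C (V (r + 1))"
    using C(2) Bc True by (elim linked_mono) (simp add: barrier_height_def)
  moreover have "linked (int (card (V r)) - barrier_height - 1) B C"
    using C(1) Bc True by (elim linked_mono) (simp add: barrier_height_def)
  moreover have "linked (int (card (V r)) - barrier_height - 1) (V r) B"
    using B True by (elim linked_mono) (simp add: barrier_height_def)
  ultimately show ?thesis using linked_trans by blast
qed

end

section \<open>Full rows and the bottleneck\<close>

lemma sum_shift_periodic:
  fixes g :: "int \<Rightarrow> int"
  assumes "\<And>x. g (x + int n) = g x"
  shows "(\<Sum>x<n. g (int x + int c)) = (\<Sum>x<n. g (int x))"
proof (induction c)
  case (Suc c)
  let ?h = "\<lambda>x. g (int x + int c)"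
  have "(\<Sum>x<n. g (int x + int (Suc c))) = (\<Sum>x<n. ?h (Suc x))" by (simp add: add_ac)
  also have "\<dots> = (\<Sum>x<Suc n. ?h x) - ?h 0" by (subst sum.lessThan_Suc_shift) simp
  also have "\<dots> = (\<Sum>x<n. ?h x)" using assms[of "int c"] by (simp add: add.commute)
  finally show ?case using Suc by simp
qed simp

lemma sum_all_eq:
  fixes g :: "nat \<Rightarrow> int"
  assumes "\<And>x. x < n \<Longrightarrow> g x \<le> k" and "int n * k \<le> (\<Sum>x<n. g x)" and "x < n"
  shows "g x = k"
proof (rule ccontr)
  assume "g x \<noteq> k"
  then have "g x < k" using assms(1)[OF assms(3)] by simp
  then have "(\<Sum>x<n. g x) < (\<Sum>x<n. k)" using assms(1,3) by (intro sum_strict_mono_ex1) auto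
  then show False using assms(2) by simp
qed

lemma exists_large_term:
  fixes g :: "nat \<Rightarrow> int"
  assumes "\<And>i. i < n \<Longrightarrow> g i \<le> k" and "int n * (k - 1) < (\<Sum>i<n. g i)"
  shows "\<exists>i<n. g i = k"
proof (rule ccontr)
  assume "\<not> ?thesis"
  then have "g i \<le> k - 1" if "i < n" for i using assms(1)[OF that] that by fastforce
  then have "(\<Sum>i<n. g i) \<le> (\<Sum>i<n. k - 1)" by (intro sum_mono) auto
  then show False using assms(2) by simp
qed

lemma int_periodic:
  fixes g :: "int \<Rightarrow> 'a"
  assumes "\<And>x. g (x + p) = g x"
  shows "g (x + p * q) = g x"
proof (induction q rule: int_induct[where k = 0])
  case (step1 i)
  then show ?case using assms[of "x + p * i"] by (simp add: algebra_simps)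
next
  case (step2 i)
  then show ?case using assms[of "x + p * (i - 1)"] by (simp add: algebra_simps)
qed simp

lemma cong3_two_apart:
  fixes x r :: int
  assumes "\<not> [x = r] (mod 3)"
  shows "[x + 2 = r] (mod 3) \<or> [x - 2 = r] (mod 3)"
  using assms unfolding cong_iff_dvd_diff by presburger

lemma cong3_adjacent:
  fixes x r :: int
  assumes "\<not> [x = r] (mod 3)"
  shows "[x - 1 = r] (mod 3) \<or> [x + 1 = r] (mod 3)"
  using assms unfolding cong_iff_dvd_diff by presburger

context grid
begin

definition occ :: "site set \<Rightarrow> int \<Rightarrow> int \<Rightarrow> int" where
  "occ A x y = (if pt x y \<in> A then 1 else 0)"

lemma occ_bounds: "0 \<le> occ A x y" "occ A x y \<le> 1"
  by (auto simp: occ_def)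

lemma occ_parity: "A \<subseteq> sites K L \<Longrightarrow> odd (x - y) \<Longrightarrow> occ A x y = 0"
  using pt_in_sites[of x y] by (auto simp: occ_def)

lemma occ_shift_x: "occ A (x + int (6 * L)) y = occ A x y"
  using pt_shift_x[of x 1 y] by (simp add: occ_def)

lemma occ_shift_y: "occ A x (y + int (2 * K)) = occ A x y"
  using pt_shift_y[of x y 1] by (simp add: occ_def)

lemma card_occ:
  assumes "A \<subseteq> sites K L"
  shows "int (card A) = (\<Sum>x<6 * L. \<Sum>y<2 * K. occ A (int x) (int y))"
proof -
  let ?g = "\<lambda>(x, y). (int x, int y)" and ?R = "{..<6 * L} \<times> {..<2 * K}"
  have inj: "inj_on ?g X" for X by (auto simp: inj_on_def)
  have pt: "pt (int x) (int y) = (int x, int y)" if "x < 6 * L" "y < 2 * K" for x y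
    using that by (simp add: pt_def)
  define P where "P = {z \<in> ?R. ?g z \<in> A}"
  have A_eq: "A = ?g ` P"
  proof
    show "A \<subseteq> ?g ` P"
    proof
      fix v assume v: "v \<in> A"
      obtain x y where xy: "v = (x, y)" by (cases v)
      then have b: "0 \<le> x" "x < 6 * int L" "0 \<le> y" "y < 2 * int K"
        using v assms by (auto simp: sites_def)
      then show "v \<in> ?g ` P"
        using v xy by (intro image_eqI[of _ _ "(nat x, nat y)"]) (auto simp: P_def)
    qed
  qed (auto simp: P_def)
  have "card A = card P" by (subst A_eq) (rule card_image[OF inj])
  then have "int (card A) = (\<Sum>z\<in>P. 1)" by simp
  also have "\<dots> = (\<Sum>z\<in>?R. if ?g z \<in> A then 1 else 0)"
    unfolding P_def by (rule sum.inter_filter) simp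
  also have "\<dots> = (\<Sum>x<6 * L. \<Sum>y<2 * K. occ A (int x) (int y))"
    by (subst sum.cartesian_product, intro sum.cong) (auto simp: occ_def pt)
  finally show ?thesis .
qed

lemma triangle_up:
  assumes "indep A" "even (x - y)"
  shows "occ A x y + occ A (x + 1) (y + 1) + occ A (x + 2) y \<le> 1"
proof -
  have "pt (x + 1) (y + 1) \<notin> A" "pt (x + 2) y \<notin> A" if "pt x y \<in> A"
    using indep_pt[OF assms(1) that] by (auto simp: nb_def)
  moreover have "pt (x + 2) y \<notin> A" if "pt (x + 1) (y + 1) \<in> A"
    by (rule indep_pt[OF assms(1) that]) (simp add: nb_def add.commute)
  ultimately show ?thesis by (auto simp: occ_def)
qed

lemma triangle_down:
  assumes "indep A" "even (x - y)"
  shows "occ A x y + occ A (x + 1) (y - 1) + occ A (x + 2) y \<le> 1"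
proof -
  have "pt (x + 1) (y - 1) \<notin> A" "pt (x + 2) y \<notin> A" if "pt x y \<in> A"
    using indep_pt[OF assms(1) that] by (auto simp: nb_def)
  moreover have "pt (x + 2) y \<notin> A" if "pt (x + 1) (y - 1) \<in> A"
    by (rule indep_pt[OF assms(1) that]) (simp add: nb_def add.commute)
  ultimately show ?thesis by (auto simp: occ_def)
qed

text \<open>
  Of the two sites with the same \<open>x\<close> in two adjacent rows exactly one belongs to the lattice, so \<open>strip A y\<close>
  describes the configuration in the rows \<open>y\<close> and \<open>y + 1\<close> as a word indexed by \<open>x\<close>.
\<close>

definition strip :: "site set \<Rightarrow> int \<Rightarrow> int \<Rightarrow> int" where
  "strip A y x = occ A x y + occ A x (y + 1)"

text \<open>
  The number of particles in row \<open>y\<close> of the three columns centred at \<open>x\<close>.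
\<close>

definition band :: "site set \<Rightarrow> int \<Rightarrow> int \<Rightarrow> int" where
  "band A x y = occ A (x - 1) y + occ A x y + occ A (x + 1) y"

text \<open>
  Three consecutive sites of a strip form a triangle.
\<close>

lemma strip_triangle:
  assumes A: "indep A"
  shows "strip A y x + strip A y (x + 1) + strip A y (x + 2) \<le> 1"
proof -
  have AS: "A \<subseteq> sites K L" using A by (simp add: indep_def)
  show ?thesis
  proof (cases "even (x - y)")
    case True
    then have "occ A x (y + 1) = 0" "occ A (x + 1) y = 0" "occ A (x + 2) (y + 1) = 0"
      by (auto intro!: occ_parity[OF AS])
    then show ?thesis using triangle_up[OF A True] by (simp add: strip_def)
  next
    case False
    then have "occ A x y = 0" "occ A (x + 1) (y + 1) = 0" "occ A (x + 2) y = 0"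
      by (auto intro!: occ_parity[OF AS])
    moreover have "even (x - (y + 1))" using False by simp
    from triangle_down[OF A this] have "occ A x (y + 1) + occ A (x + 1) y + occ A (x + 2) (y + 1) \<le> 1" by simp
    ultimately show ?thesis by (simp add: strip_def)
  qed
qed

text \<open>
  In two adjacent rows a band of three columns has a triangle of sites.
\<close>

lemma band_rungs:
  assumes A: "indep A"
  shows "band A x y + band A x (y + 1) \<le> 1"
proof -
  have AS: "A \<subseteq> sites K L" using A by (simp add: indep_def)
  show ?thesis
  proof (cases "even (x - y)")
    case True
    then have "occ A (x - 1) y = 0" "occ A (x + 1) y = 0" "occ A x (y + 1) = 0"
      by (auto intro!: occ_parity[OF AS])
    moreover have "even (x - 1 - (y + 1))" using True by simp
    from triangle_down[OF A this] have "occ A (x - 1) (y + 1) + occ A x y + occ A (x + 1) (y + 1) \<le> 1"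
      by (simp add: add.commute)
    ultimately show ?thesis by (simp add: band_def)
  next
    case False
    then have "occ A x y = 0" "occ A (x - 1) (y + 1) = 0" "occ A (x + 1) (y + 1) = 0"
      by (auto intro!: occ_parity[OF AS])
    moreover have "even (x - 1 - y)" using False by simp
    from triangle_up[OF A this] have "occ A (x - 1) y + occ A x (y + 1) + occ A (x + 1) y \<le> 1"
      by (simp add: add.commute)
    ultimately show ?thesis by (simp add: band_def)
  qed
qed

lemma strip_shift: "strip A y (x + int (6 * L)) = strip A y x"
  unfolding strip_def occ_shift_x ..

lemma band_shift: "band A x (y + int (2 * K)) = band A x y"
  unfolding band_def occ_shift_y ..

lemma strip_sum_triple:
  "(\<Sum>x<6 * L. strip A y (int x) + strip A y (int x + 1) + strip A y (int x + 2)) = 3 * (\<Sum>x<6 * L. strip A y (int x))"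
  using sum_shift_periodic[of "strip A y" "6 * L" 1] sum_shift_periodic[of "strip A y" "6 * L" 2] strip_shift
  by (simp add: sum.distrib)

lemma band_sum_double:
  "(\<Sum>y<2 * K. band A x (int y) + band A x (int y + 1)) = 2 * (\<Sum>y<2 * K. band A x (int y))"
  using sum_shift_periodic[of "band A x" "2 * K" 1] band_shift by (simp add: sum.distrib)

lemma strip_sum_le:
  assumes "indep A"
  shows "(\<Sum>x<6 * L. strip A y (int x)) \<le> 2 * int L"
proof -
  have "(\<Sum>x<6 * L. strip A y (int x) + strip A y (int x + 1) + strip A y (int x + 2)) \<le> (\<Sum>x<6 * L. 1)"
    by (intro sum_mono strip_triangle assms)
  then show ?thesis unfolding strip_sum_triple by simp
qed

lemma band_sum_le:
  assumes "indep A"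
  shows "(\<Sum>y<2 * K. band A x (int y)) \<le> int K"
proof -
  have "(\<Sum>y<2 * K. band A x (int y) + band A x (int y + 1)) \<le> (\<Sum>y<2 * K. 1)"
    by (intro sum_mono band_rungs assms)
  then show ?thesis unfolding band_sum_double by simp
qed

lemma card_strips:
  assumes "A \<subseteq> sites K L"
  shows "int (card A) = (\<Sum>i<K. \<Sum>x<6 * L. strip A (2 * int i) (int x))"
proof -
  have "(\<Sum>y<2 * K. g y) = (\<Sum>i<K. g (2 * i) + g (2 * i + 1))" for g :: "nat \<Rightarrow> int"
    by (induction K) (auto simp: numeral_2_eq_2)
  then have "int (card A) = (\<Sum>x<6 * L. \<Sum>i<K. strip A (2 * int i) (int x))"
    unfolding card_occ[OF assms] strip_def by (simp add: add.commute)
  then show ?thesis by (subst sum.swap)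
qed

lemma card_bands:
  assumes "A \<subseteq> sites K L"
  shows "int (card A) = (\<Sum>j<2 * L. \<Sum>y<2 * K. band A (3 * int j + int c + 1) (int y))"
proof -
  define g where "g x = (\<Sum>y<2 * K. occ A x (int y))" for x
  have per: "g (x + int (6 * L)) = g x" for x unfolding g_def occ_shift_x ..
  have group: "(\<Sum>x<3 * n. h x) = (\<Sum>j<n. h (3 * j) + h (3 * j + 1) + h (3 * j + 2))" for h :: "nat \<Rightarrow> int" and n
    by (induction n) (auto simp: numeral_3_eq_3)
  have "int (card A) = (\<Sum>x<6 * L. g (int x + int c))"
    unfolding card_occ[OF assms] using sum_shift_periodic[of g "6 * L" c, OF per] by (simp add: g_def)
  also have "\<dots> = (\<Sum>x<3 * (2 * L). g (int x + int c))" by (simp add: mult.assoc)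
  also have "\<dots> = (\<Sum>j<2 * L. g (int (3 * j) + int c) + g (int (3 * j + 1) + int c) + g (int (3 * j + 2) + int c))"
    by (rule group)
  also have "\<dots> = (\<Sum>j<2 * L. \<Sum>y<2 * K. band A (3 * int j + int c + 1) (int y))"
    by (simp add: g_def band_def sum.distrib add_ac)
  finally show ?thesis .
qed

lemma card_le_max:
  assumes A: "indep A"
  shows "int (card A) \<le> 2 * int K * int L"
proof -
  have "int (card A) = (\<Sum>i<K. \<Sum>x<6 * L. strip A (2 * int i) (int x))"
    using A by (intro card_strips) (simp add: indep_def)
  also have "\<dots> \<le> (\<Sum>i<K. 2 * int L)" by (intro sum_mono strip_sum_le A)
  finally show ?thesis by simp
qed

lemma card_V: "int (card (V r)) = 2 * int K * int L"
proof -
  have s: "strip (V r) y x = (if [x = r] (mod 3) then 1 else 0)" for x y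
    by (cases "even (x - y)") (auto simp: strip_def occ_def pt_in_V)
  have "strip (V r) y x + strip (V r) y (x + 1) + strip (V r) y (x + 2) = 1" for x y
  proof -
    have one: "3 dvd z \<and> \<not> 3 dvd z + 1 \<and> \<not> 3 dvd z + 2 \<or> \<not> 3 dvd z \<and> 3 dvd z + 1 \<and> \<not> 3 dvd z + 2 \<or>
        \<not> 3 dvd z \<and> \<not> 3 dvd z + 1 \<and> 3 dvd z + 2" for z :: int by presburger
    have "[x + k = r] (mod 3) \<longleftrightarrow> 3 dvd (x - r) + k" for k
      by (simp add: cong_iff_dvd_diff algebra_simps)
    from this[of 0] this[of 1] this[of 2] one[of "x - r"] show ?thesis unfolding s by (elim disjE) simp_all
  qed
  then have "3 * (\<Sum>x<6 * L. strip (V r) y (int x)) = 6 * int L" for y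
    unfolding strip_sum_triple[symmetric] by simp
  then have "(\<Sum>x<6 * L. strip (V r) y (int x)) = 2 * int L" for y by (simp add: algebra_simps)
  then show ?thesis unfolding card_strips[OF V_sites] by simp
qed

text \<open>
  The \<open>K\<close> disjoint strips hold at most \<open>2 L\<close> particles each; if fewer than \<open>K\<close> are missing, one strip
  attains the bound. Then all its triangles are occupied, so the word describing it has period \<open>3\<close>.
\<close>

lemma full_strip:
  assumes A: "indep A" and large: "2 * int K * int L - int K < int (card A)"
  obtains r y where "r \<in> {0, 1, 2}" "row_full A r y" "row_full A r (y + 1)"
proof -
  have AS: "A \<subseteq> sites K L" using A by (simp add: indep_def)
  have "\<exists>i<K. (\<Sum>x<6 * L. strip A (2 * int i) (int x)) = 2 * int L"
    using large unfolding card_strips[OF AS]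
    by (intro exists_large_term strip_sum_le[OF A]) (simp add: algebra_simps)
  then obtain i where i: "(\<Sum>x<6 * L. strip A (2 * int i) (int x)) = 2 * int L" by blast
  define y where "y = 2 * int i"
  define t where "t x = strip A y x + strip A y (x + 1) + strip A y (x + 2)" for x
  have t1: "t (int x) = 1" if "x < 6 * L" for x
  proof (rule sum_all_eq[OF _ _ that])
    show "t (int x) \<le> 1" for x unfolding t_def by (rule strip_triangle[OF A])
    show "int (6 * L) * 1 \<le> (\<Sum>x<6 * L. t (int x))"
      unfolding t_def strip_sum_triple using i by (simp add: y_def)
  qed
  have t_per: "t (x + int (6 * L) * q) = t x" for x q
  proof (rule int_periodic)
    show "t (x + int (6 * L)) = t x" for x
      using strip_shift[of A y x] strip_shift[of A y "x + 1"] strip_shift[of A y "x + 2"]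
      by (simp add: t_def add_ac)
  qed
  have t: "t x = 1" for x
  proof -
    define k where "k = nat (x mod int (6 * L))"
    have k: "k < 6 * L" "int k = x mod int (6 * L)"
      using L1 pos_mod_bound[of "int (6 * L)" x] by (auto simp: k_def nat_less_iff)
    have "x = int k + int (6 * L) * (x div int (6 * L))" unfolding k(2) by simp
    then show ?thesis using t1[OF k(1)] t_per by metis
  qed
  have per3: "strip A y (x + 3) = strip A y x" for x
    using t[of x] t[of "x + 1"] by (simp add: t_def add_ac)
  have per: "strip A y (x + 3 * q) = strip A y x" for x q by (rule int_periodic[where g = "strip A y"]) (rule per3)
  have nn: "0 \<le> strip A y x" for x using occ_bounds by (simp add: strip_def)
  have "\<exists>r\<in>{0, 1, 2}. strip A y r \<noteq> 0"
    using t[of 0] by (auto simp: t_def)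
  then obtain r where r: "r \<in> {0, 1, 2}" "strip A y r \<noteq> 0" by (rule bexE)
  have occupied: "pt x y' \<in> A" if "even (x - y')" "[x = r] (mod 3)" "y' = y \<or> y' = y + 1" for x y'
  proof -
    have "3 dvd x - r" using that(2) by (simp add: cong_iff_dvd_diff)
    then obtain q where "x - r = 3 * q" by (rule dvdE)
    then have "x = r + 3 * q" by simp
    then have "strip A y x \<noteq> 0" using per r(2) by simp
    moreover have "occ A x (if y' = y then y + 1 else y) = 0"
      using that(1,3) by (intro occ_parity[OF AS]) auto
    ultimately show ?thesis using that(3) by (auto simp: strip_def occ_def split: if_splits)
  qed
  show ?thesis
    by (rule that[OF r(1), of y]) (auto simp: row_full_def intro: occupied)
qed

text \<open>
  A full row of type \<open>s\<close> meets a band whose middle column has type \<open>s\<close> in this column or not at all, and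
  any other band in one of the two outer columns or not at all. Which of the two happens is decided
  by the parity of the row.
\<close>

lemma band_row_full:
  assumes A: "indep A" and row: "row_full A s y"
  shows "[x = s] (mod 3) \<Longrightarrow> band A x y = (if even (x - y) then 1 else 0)"
    and "\<not> [x = s] (mod 3) \<Longrightarrow> band A x y = (if even (x - y) then 0 else 1)"
proof -
  have AS: "A \<subseteq> sites K L" using A by (simp add: indep_def)
  have le1: "band A x y \<le> 1"
    using band_rungs[OF A, of x y] occ_bounds by (simp add: band_def) (smt (verit))
  have occupied: "occ A z y = 1" if "even (z - y)" "[z = s] (mod 3)" for z
    using row that by (simp add: row_full_def occ_def)
  have empty: "occ A z y = 0" if "even (z - y)" "\<not> [z = s] (mod 3)" for z
  proof -
    have "[z + 2 = s] (mod 3) \<or> [z - 2 = s] (mod 3)" using that(2) by (rule cong3_two_apart)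
    then have "pt z y \<notin> A"
    proof
      assume "[z + 2 = s] (mod 3)"
      moreover have "even (z + 2 - y)" using that(1) by simp
      ultimately have "pt (z + 2) y \<in> A" using row unfolding row_full_def by blast
      then show ?thesis by (rule indep_pt[OF A]) (simp add: nb_def)
    next
      assume "[z - 2 = s] (mod 3)"
      moreover have "even (z - 2 - y)" using that(1) by simp
      ultimately have "pt (z - 2) y \<in> A" using row unfolding row_full_def by blast
      then show ?thesis by (rule indep_pt[OF A]) (simp add: nb_def)
    qed
    then show ?thesis by (simp add: occ_def)
  qed
  have odd0: "occ A z y = 0" if "odd (z - y)" for z using occ_parity[OF AS that] .
  {
    assume x: "[x = s] (mod 3)"
    show "band A x y = (if even (x - y) then 1 else 0)"
    proof (cases "even (x - y)")
      case True
      then show ?thesis using occupied[OF True x] odd0[of "x - 1"] odd0[of "x + 1"] by (simp add: band_def)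
    next
      case False
      have "\<not> [x - 1 = s] (mod 3)" "\<not> [x + 1 = s] (mod 3)" using cong3_shift[OF x] by auto
      then show ?thesis using False odd0[of x] empty[of "x - 1"] empty[of "x + 1"] by (simp add: band_def)
    qed
  next
    assume x: "\<not> [x = s] (mod 3)"
    show "band A x y = (if even (x - y) then 0 else 1)"
    proof (cases "even (x - y)")
      case True
      then show ?thesis using empty[OF True x] odd0[of "x - 1"] odd0[of "x + 1"] by (simp add: band_def)
    next
      case False
      have "[x - 1 = s] (mod 3) \<or> [x + 1 = s] (mod 3)" using x by (rule cong3_adjacent)
      moreover have "even (x - 1 - y)" "even (x + 1 - y)" using False by auto
      ultimately have "occ A (x - 1) y = 1 \<or> occ A (x + 1) y = 1" using occupied by blast
      then have "1 \<le> band A x y"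
        using occ_bounds(1)[of A "x - 1" y] occ_bounds(1)[of A x y] occ_bounds(1)[of A "x + 1" y]
        unfolding band_def by linarith
      then show ?thesis using False le1 by simp
    qed
  }
qed

text \<open>
  The \<open>2 L\<close> disjoint bands hold at most \<open>K\<close> particles each, so one of them attains the bound if fewer than
  \<open>2 L\<close> are missing. The bands are placed such that their middle columns have type \<open>s\<close>. In a band
  attaining the bound, rows with and without a particle alternate, so occupied rows have a common
  parity; by \<open>band_row_full\<close> full rows of types \<open>s\<close> and \<open>s'\<close> would require different parities.
\<close>

lemma full_rows_same_type:
  assumes A: "indep A" and large: "2 * int K * int L - 2 * int L < int (card A)"
    and rows: "row_full A s y" "row_full A s' y'"
  shows "[s = s'] (mod 3)"
proof (rule ccontr)
  assume ne: "\<not> [s = s'] (mod 3)"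
  have AS: "A \<subseteq> sites K L" using A by (simp add: indep_def)
  (* the offset for which the middle columns 3 j + c + 1 of the bands have type s *)
  define c where "c = nat ((s - 1) mod 3)"
  have c: "int c = (s - 1) mod 3" by (simp add: c_def)
  have "\<exists>j<2 * L. (\<Sum>y<2 * K. band A (3 * int j + int c + 1) (int y)) = int K"
    using large unfolding card_bands[OF AS, of c]
    by (intro exists_large_term band_sum_le[OF A]) (simp add: algebra_simps)
  then obtain j where j: "(\<Sum>y<2 * K. band A (3 * int j + int c + 1) (int y)) = int K" by blast
  define x where "x = 3 * int j + int c + 1"
  have x: "[x = s] (mod 3)" unfolding x_def c cong_iff_dvd_diff by presburger
  have x': "\<not> [x = s'] (mod 3)" using x ne cong_sym cong_trans by blast
  define t where "t y = band A x y + band A x (y + 1)" for y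
  have t1: "t (int y) = 1" if "y < 2 * K" for y
  proof (rule sum_all_eq[OF _ _ that])
    show "t (int y) \<le> 1" for y unfolding t_def by (rule band_rungs[OF A])
    show "int (2 * K) * 1 \<le> (\<Sum>y<2 * K. t (int y))"
      unfolding t_def band_sum_double using j by (simp add: x_def)
  qed
  have t_per: "t (y + int (2 * K) * q) = t y" for y q
  proof (rule int_periodic)
    show "t (y + int (2 * K)) = t y" for y
      using band_shift[of A x y] band_shift[of A x "y + 1"] by (simp add: t_def add_ac)
  qed
  have t: "t y = 1" for y
  proof -
    define k where "k = nat (y mod int (2 * K))"
    have k: "k < 2 * K" "int k = y mod int (2 * K)"
      using K2 pos_mod_bound[of "int (2 * K)" y] by (auto simp: k_def nat_less_iff)
    have "y = int k + int (2 * K) * (y div int (2 * K))" unfolding k(2) by simp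
    then show ?thesis using t1[OF k(1)] t_per by metis
  qed
  have per2: "band A x (y + 2) = band A x y" for y
    using t[of y] t[of "y + 1"] by (simp add: t_def add_ac)
  have per: "band A x (y + 2 * q) = band A x y" for y q by (rule int_periodic[where g = "band A x"]) (rule per2)
  have b: "band A x y = (if even (x - y) then 1 else 0)" "band A x y' = (if even (x - y') then 0 else 1)"
    using band_row_full[OF A rows(1)] band_row_full[OF A rows(2)] x x' by auto
  show False
  proof (cases "even (y' - y)")
    case True
    then obtain q where "y' - y = 2 * q" by (rule evenE)
    then have "y' = y + 2 * q" by simp
    then have "band A x y' = band A x y" using per by simp
    moreover have "even (x - y) \<longleftrightarrow> even (x - y')" using True by presburger
    ultimately show False using b by (auto split: if_splits)
  next
    case False
    then have "even (y' - (y + 1))" by simp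
    then obtain q where "y' - (y + 1) = 2 * q" by (rule evenE)
    then have "y' = (y + 1) + 2 * q" by simp
    then have "band A x y' = band A x (y + 1)" using per by simp
    moreover have "even (x - y) \<longleftrightarrow> odd (x - y')" using False by presburger
    ultimately show False using b t[of y] by (auto simp: t_def split: if_splits)
  qed
qed

text \<open>
  The invariant of paths that stay below the barrier.
\<close>

definition row_types :: "site set \<Rightarrow> int set" where
  "row_types A = {s \<in> {0, 1, 2}. \<exists>y. row_full A s y}"

text \<open>
  There are two adjacent full rows of the only type present, and \<open>v\<close> lies in at most one of them.
\<close>

lemma row_types_remove:
  assumes A: "indep A" and v: "v \<in> A" and large: "2 * int K * int L - int (min K (2 * L)) < int (card A)"
  shows "row_types (A - {v}) = row_types A"
proof
  show "row_types (A - {v}) \<subseteq> row_types A" by (auto simp: row_types_def row_full_def)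
  show "row_types A \<subseteq> row_types (A - {v})"
  proof
    fix s assume "s \<in> row_types A"
    then obtain y' where s: "s \<in> {0, 1, 2}" "row_full A s y'" by (auto simp: row_types_def)
    have "2 * int K * int L - int K < int (card A)" "2 * int K * int L - 2 * int L < int (card A)"
      using large by linarith+
    then obtain r y where r: "r \<in> {0, 1, 2}" "row_full A r y" "row_full A r (y + 1)"
      using full_strip[OF A] by blast
    have "[r = s] (mod 3)" by (rule full_rows_same_type[OF A _ r(2) s(2)]) fact
    then have rs: "r = s" using r(1) s(1) by (auto simp: cong_def)
    have "row_full (A - {v}) s y \<or> row_full (A - {v}) s (y + 1)"
    proof (rule ccontr)
      assume "\<not> ?thesis"
      then obtain x x' where "v = pt x y" "v = pt x' (y + 1)" using r rs by (auto simp: row_full_def)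
      then have "pt x y = pt x' (y + 1)" by simp
      then have "[y = y + 1] (mod 2 * int K)" by (simp only: pt_eq_iff)
      then have "2 * int K dvd 1" by (simp add: cong_iff_dvd_diff)
      then show False using K2 by (auto dest: zdvd_imp_le)
    qed
    then show "s \<in> row_types (A - {v})" using s(1) by (auto simp: row_types_def)
  qed
qed

lemma row_types_V:
  assumes "r \<in> {0, 1, 2}"
  shows "row_types (V r) = {r}"
proof -
  have full: "row_full (V r) r y" for y by (simp add: row_full_def pt_in_V)
  have "s = r" if s: "s \<in> row_types (V r)" for s
  proof -
    obtain y where y: "s \<in> {0, 1, 2}" "row_full (V r) s y" using s by (auto simp: row_types_def)
    have "[s = r] (mod 3)"
      using full_rows_same_type[OF indep_V _ y(2) full[of 0]] L1 by (simp add: card_V)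
    then show ?thesis using y(1) assms by (auto simp: cong_def)
  qed
  moreover have "r \<in> row_types (V r)" using full assms by (auto simp: row_types_def)
  ultimately show ?thesis by blast
qed

end

section \<open>The energy landscape of the hard-core model\<close>

lemma (in stochastic_matrix) surv_symmetry:
  assumes bij: "bij_betw \<Phi> S S" and p: "\<And>x y. x \<in> S \<Longrightarrow> y \<in> S \<Longrightarrow> p (\<Phi> x) (\<Phi> y) = p x y"
    and A: "\<And>x. x \<in> S \<Longrightarrow> \<Phi> x \<in> A \<longleftrightarrow> x \<in> A" and x: "x \<in> S"
  shows "surv S p A t (\<Phi> x) = surv S p A t x"
  using x
proof (induction t arbitrary: x)
  case 0
  then show ?case using A by (simp add: surv_def)
next
  case (Suc t)
  show ?case
  proof (cases "x \<in> A")
    case True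
    then show ?thesis using A Suc.prems by (simp add: surv_in)
  next
    case False
    then have "\<Phi> x \<notin> A" using A Suc.prems by simp
    have "(\<Sum>y\<in>S. p (\<Phi> x) y * surv S p A t y) = (\<Sum>y\<in>S. p (\<Phi> x) (\<Phi> y) * surv S p A t (\<Phi> y))"
      by (rule sum.reindex_bij_betw[OF bij, symmetric])
    also have "\<dots> = (\<Sum>y\<in>S. p x y * surv S p A t y)"
      using Suc p by (intro sum.cong) auto
    finally show ?thesis using False \<open>\<Phi> x \<notin> A\<close> by (simp add: surv_Suc)
  qed
qed

context grid
begin

abbreviation cf :: "site set \<Rightarrow> conf" where
  "cf \<equiv> indicator_conf K L"

lemma cf_apply: "v \<in> sites K L \<Longrightarrow> cf A v = (if v \<in> A then 1 else 0)"
  by (simp add: indicator_conf_def indicator_def)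

lemma cf_inj: "A \<subseteq> sites K L \<Longrightarrow> B \<subseteq> sites K L \<Longrightarrow> cf A = cf B \<Longrightarrow> A = B"
  by (metis cf_apply subsetD subsetI subset_antisym zero_neq_one)

lemma cf_hc: "indep A \<Longrightarrow> cf A \<in> hc_confs K L"
proof -
  assume A: "indep A"
  have "cf A \<in> sites K L \<rightarrow>\<^sub>E {0, 1}" by (auto simp: indicator_conf_def indicator_def)
  moreover have "cf A v * cf A w = 0" if vw: "neighbors K L v w" for v w
  proof -
    have "v \<in> sites K L" "w \<in> sites K L" using neighbors_sites[OF vw] by auto
    moreover have "v \<notin> A \<or> w \<notin> A" using vw A unfolding indep_def by blast
    ultimately show ?thesis by (auto simp: cf_apply)
  qed
  ultimately show ?thesis unfolding hc_confs_def by blast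
qed

lemma hc_cases:
  assumes "\<sigma> \<in> hc_confs K L"
  obtains A where "indep A" "\<sigma> = cf A"
proof
  have \<sigma>: "\<sigma> \<in> sites K L \<rightarrow>\<^sub>E {0, 1}" using assms unfolding hc_confs_def by blast
  have excl: "\<sigma> v * \<sigma> w = 0" if "neighbors K L v w" for v w
    using assms that unfolding hc_confs_def by blast
  let ?A = "{v \<in> sites K L. \<sigma> v = 1}"
  show "indep ?A" unfolding indep_def using excl by fastforce
  show "\<sigma> = cf ?A"
  proof
    fix v
    show "\<sigma> v = cf ?A v"
    proof (cases "v \<in> sites K L")
      case True
      then have "\<sigma> v = 0 \<or> \<sigma> v = 1" using \<sigma> by blast
      then show ?thesis using True by (elim disjE) (simp_all add: cf_apply)
    next
      case False
      then show ?thesis using PiE_arb[OF \<sigma>] by (simp add: indicator_conf_def)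
    qed
  qed
qed

lemma Hamiltonian_cf:
  assumes "A \<subseteq> sites K L"
  shows "Hamiltonian K L (cf A) = - real (card A)"
proof -
  have "(\<Sum>v\<in>sites K L. real (cf A v)) = (\<Sum>v\<in>sites K L. if v \<in> A then 1 else 0)"
    by (intro sum.cong) (auto simp: cf_apply)
  also have "\<dots> = real (card (sites K L \<inter> A))" using finite_sites by (simp add: sum.If_cases Int_def)
  finally show ?thesis using assms by (simp add: Hamiltonian_def Int_absorb1)
qed

lemma connectivity_pos_iff:
  assumes "A \<subseteq> sites K L" "B \<subseteq> sites K L"
  shows "0 < connectivity K L (cf A) (cf B) \<longleftrightarrow> (\<exists>v. v \<notin> A \<and> B = insert v A \<or> v \<notin> B \<and> A = insert v B)"
proof -
  have "{v \<in> sites K L. cf A v \<noteq> cf B v} = (A - B) \<union> (B - A)"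
    using assms by (auto simp: cf_apply split: if_splits)
  moreover have "pt 0 0 \<in> sites K L" by (simp add: pt_in_sites)
  then have "0 < card (sites K L)" using finite_sites card_gt_0_iff by blast
  ultimately have "0 < connectivity K L (cf A) (cf B) \<longleftrightarrow> card ((A - B) \<union> (B - A)) = 1"
    by (simp add: connectivity_def)
  also have "\<dots> \<longleftrightarrow> (\<exists>v. (A - B) \<union> (B - A) = {v})" by (simp add: card_1_singleton_iff)
  also have "\<dots> \<longleftrightarrow> (\<exists>v. v \<notin> A \<and> B = insert v A \<or> v \<notin> B \<and> A = insert v B)"
  proof (intro iffI; elim exE)
    fix v assume v: "(A - B) \<union> (B - A) = {v}"
    then have w: "w \<in> A \<and> w \<notin> B \<or> w \<in> B \<and> w \<notin> A \<longleftrightarrow> w = v" for w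
      by (metis DiffE DiffI UnE UnI1 UnI2 singletonD singletonI)
    show "\<exists>v. v \<notin> A \<and> B = insert v A \<or> v \<notin> B \<and> A = insert v B"
    proof (intro exI[of _ v], cases "v \<in> A")
      case True
      then have "v \<notin> B" using w[of v] by simp
      moreover have "A = insert v B"
      proof (rule set_eqI)
        show "u \<in> A \<longleftrightarrow> u \<in> insert v B" for u using w[of u] True by blast
      qed
      ultimately show "v \<notin> A \<and> B = insert v A \<or> v \<notin> B \<and> A = insert v B" by simp
    next
      case False
      have "B = insert v A"
      proof (rule set_eqI)
        show "u \<in> B \<longleftrightarrow> u \<in> insert v A" for u using w[of u] w[of v] False by blast
      qed
      with False show "v \<notin> A \<and> B = insert v A \<or> v \<notin> B \<and> A = insert v B" by simp
    qed
  next
    fix v assume "v \<notin> A \<and> B = insert v A \<or> v \<notin> B \<and> A = insert v B"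
    then have "(A - B) \<union> (B - A) = {v}" by auto
    then show "\<exists>v. (A - B) \<union> (B - A) = {v}" by (rule exI)
  qed
  finally show ?thesis .
qed

lemma finite_hc: "finite (hc_confs K L)"
  by (rule finite_subset[of _ "sites K L \<rightarrow>\<^sub>E {0, 1}"]) (auto simp: hc_confs_def finite_sites intro!: finite_PiE)

text \<open>
  A configuration has at most one neighbour per site.
\<close>

lemma connectivity_sum:
  assumes x: "\<sigma> \<in> hc_confs K L"
  shows "(\<Sum>\<eta>\<in>hc_confs K L - {\<sigma>}. connectivity K L \<sigma> \<eta>) \<le> 1"
proof -
  let ?N = "{\<eta> \<in> hc_confs K L - {\<sigma>}. card {v \<in> sites K L. \<sigma> v \<noteq> \<eta> v} = 1}"
  have "?N \<subseteq> (\<lambda>v. \<sigma>(v := 1 - \<sigma> v)) ` sites K L"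
  proof
    fix \<eta> assume "\<eta> \<in> ?N"
    then obtain v where \<eta>: "\<eta> \<in> hc_confs K L" "{v \<in> sites K L. \<sigma> v \<noteq> \<eta> v} = {v}"
      by (auto simp: card_1_singleton_iff)
    have v: "v \<in> sites K L" "\<sigma> v \<noteq> \<eta> v" using \<eta>(2) by auto
    have "\<eta> = \<sigma>(v := 1 - \<sigma> v)"
    proof
      fix w
      show "\<eta> w = (\<sigma>(v := 1 - \<sigma> v)) w"
      proof (cases "w \<in> sites K L")
        case True
        show ?thesis
        proof (cases "w = v")
          case True
          have "\<sigma> v = 0 \<or> \<sigma> v = 1" "\<eta> v = 0 \<or> \<eta> v = 1"
            using x \<eta>(1) v(1) unfolding hc_confs_def by blast+
          then show ?thesis using v(2) True by (elim disjE) simp_all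
        next
          case False
          then have "w \<notin> {v \<in> sites K L. \<sigma> v \<noteq> \<eta> v}" unfolding \<eta>(2) by simp
          then show ?thesis using True False by simp
        qed
      next
        case False
        have "\<sigma> \<in> sites K L \<rightarrow>\<^sub>E {0, 1}" "\<eta> \<in> sites K L \<rightarrow>\<^sub>E {0, 1}"
          using x \<eta>(1) unfolding hc_confs_def by blast+
        then have "\<sigma> w = undefined" "\<eta> w = undefined" using PiE_arb False by metis+
        moreover have "w \<noteq> v" using False v(1) by blast
        ultimately show ?thesis by simp
      qed
    qed
    then show "\<eta> \<in> (\<lambda>v. \<sigma>(v := 1 - \<sigma> v)) ` sites K L" using v(1) by blast
  qed
  then have N: "card ?N \<le> card (sites K L)" by (rule surj_card_le[OF finite_sites])
  have "(\<Sum>\<eta>\<in>hc_confs K L - {\<sigma>}. connectivity K L \<sigma> \<eta>) = (\<Sum>\<eta>\<in>?N. 1 / real (card (sites K L)))"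
    unfolding connectivity_def using finite_hc by (intro sum.inter_filter[symmetric]) simp
  also have "\<dots> = real (card ?N) / real (card (sites K L))" by simp
  also have "\<dots> \<le> 1" using N by (auto simp: divide_le_eq_1)
  finally show ?thesis .
qed

sublocale hardcore: metropolis "hc_confs K L" "Hamiltonian K L" "connectivity K L"
proof
  fix x y assume "x \<in> hc_confs K L" "y \<in> hc_confs K L"
  have "{v \<in> sites K L. x v \<noteq> y v} = {v \<in> sites K L. y v \<noteq> x v}" by auto
  then show "connectivity K L x y = connectivity K L y x" by (simp only: connectivity_def)
  show "0 \<le> connectivity K L x y" by (simp add: connectivity_def)
next
  fix x assume "x \<in> hc_confs K L"
  then show "(\<Sum>y\<in>hc_confs K L - {x}. connectivity K L x y) \<le> 1" by (rule connectivity_sum)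
  show "Hamiltonian K L x \<le> 0" by (simp add: Hamiltonian_def sum_nonneg)
qed (rule finite_hc)

lemma transition_eq: "hardcore.transition = metropolis_prob K L"
  by (intro ext) (simp add: hardcore.transition_def metropolis_prob_def metropolis_rate_def)

lemma linked_imp_link:
  "linked m A B \<Longrightarrow> (hardcore.link (- real_of_int m))\<^sup>*\<^sup>* (cf A) (cf B)"
proof (induction rule: linked.induct)
  case (add A B v)
  have B: "indep B" "m \<le> int (card B)" using linked_end[OF add.hyps(1)] by auto
  have "int (card B) \<le> int (card (insert v B))" using indep_finite[OF B(1)] by (simp add: card_insert_if)
  moreover have sub: "B \<subseteq> sites K L" "insert v B \<subseteq> sites K L" using add.hyps(3) by (auto simp: indep_def)
  moreover have "0 < connectivity K L (cf B) (cf (insert v B))"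
    using connectivity_pos_iff[OF sub] add.hyps(2) by blast
  ultimately have "hardcore.link (- real_of_int m) (cf B) (cf (insert v B))"
    using B cf_hc[OF B(1)] cf_hc[OF add.hyps(3)] unfolding hardcore.link_def by (simp add: Hamiltonian_cf)
  then show ?case using add.IH by (rule rtranclp.rtrancl_into_rtrancl[rotated])
next
  case (remove A v B)
  have B: "indep (insert v B)" "m \<le> int (card (insert v B))" using linked_end[OF remove.hyps(1)] by auto
  then have indB: "indep B" using indep_subset by blast
  have sub: "insert v B \<subseteq> sites K L" "B \<subseteq> sites K L" using B(1) by (auto simp: indep_def)
  moreover have "0 < connectivity K L (cf (insert v B)) (cf B)"
    using connectivity_pos_iff[OF sub] remove.hyps(2) by blast
  ultimately have "hardcore.link (- real_of_int m) (cf (insert v B)) (cf B)"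
    using B remove.hyps cf_hc[OF B(1)] cf_hc[OF indB] unfolding hardcore.link_def by (simp add: Hamiltonian_cf)
  then show ?case using remove.IH by (rule rtranclp.rtrancl_into_rtrancl[rotated])
qed simp

lemma V_mod: "[r = s] (mod 3) \<Longrightarrow> V r = V s"
  by (auto simp: sites_mod_def intro: cong_trans cong_sym)

lemma V_cases: "V r \<in> {V 0, V 1, V 2}"
proof -
  have "[r = 0] (mod 3) \<or> [r = 1] (mod 3) \<or> [r = 2] (mod 3)" unfolding cong_def by presburger
  then show ?thesis using V_mod by blast
qed

lemma conf_cf: "conf_a K L = cf (V 0)" "conf_b K L = cf (V 1)" "conf_c K L = cf (V 2)"
  by (simp_all add: conf_a_def conf_b_def conf_c_def)

lemma barrier_eq: "barrier K L = real_of_int barrier_height + 1"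
  by (simp add: barrier_def barrier_height_def)

lemma path_to_grounds:
  assumes "\<sigma> \<in> hc_confs K L"
  shows "\<exists>\<eta>\<in>{conf_a K L, conf_b K L, conf_c K L}.
    (hardcore.link (Hamiltonian K L \<sigma> + real_of_int barrier_height))\<^sup>*\<^sup>* \<sigma> \<eta>"
proof -
  obtain A where A: "indep A" "\<sigma> = cf A" using assms by (rule hc_cases)
  obtain r where r: "linked (int (card A) - barrier_height) A (V r)" using relax_to_ground[OF A(1)] by blast
  have "Hamiltonian K L \<sigma> = - real (card A)" using A Hamiltonian_cf by (simp add: indep_def)
  then have "(hardcore.link (Hamiltonian K L \<sigma> + real_of_int barrier_height))\<^sup>*\<^sup>* \<sigma> (cf (V r))"
    using linked_imp_link[OF r] A(2) by (simp add: algebra_simps)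
  moreover have "cf (V r) \<in> {cf (V 0), cf (V 1), cf (V 2)}" using V_cases[of r] by auto
  ultimately show ?thesis unfolding conf_cf by (rule bexI)
qed

lemma path_to_b:
  assumes "\<sigma> \<in> hc_confs K L"
  shows "(hardcore.link (Hamiltonian K L \<sigma> + barrier K L))\<^sup>*\<^sup>* \<sigma> (conf_b K L)"
proof -
  obtain A where A: "indep A" "\<sigma> = cf A" using assms by (rule hc_cases)
  define m where "m = int (card A) - barrier_height - 1"
  obtain r where "linked (int (card A) - barrier_height) A (V r)" using relax_to_ground[OF A(1)] by blast
  then have r: "linked m A (V r)" by (rule linked_mono) (simp add: m_def)
  have cross: "linked m (V s) (V (s + 1))" for s
    by (rule linked_mono[OF cross_between_grounds]) (use card_le_max[OF A(1)] in \<open>simp add: m_def card_V\<close>)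
  have "V 3 = V 0" by (rule V_mod) (simp add: cong_def)
  then have c01: "linked m (V 0) (V 1)" and c20: "linked m (V 2) (V 0)" using cross[of 0] cross[of 2] by simp_all
  (* from V 2 the path leads through V 3 = V 0 *)
  have "linked m A (V 1)"
    using V_cases[of r] r linked_trans[OF c01] linked_trans[OF c20] by auto
  moreover have "Hamiltonian K L \<sigma> = - real (card A)" using A Hamiltonian_cf by (simp add: indep_def)
  ultimately show ?thesis
    using linked_imp_link A(2) unfolding conf_cf barrier_eq by (fastforce simp: m_def algebra_simps)
qed

definition basin_a :: "conf set" where
  "basin_a = cf ` {A. indep A \<and> 2 * int K * int L - barrier_height \<le> int (card A) \<and> row_types A = {0}}"

text \<open>
  If both configurations had at most \<open>min K (2 L)\<close> missing particles, the larger one would have fewer, so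
  \<open>row_types_remove\<close> would apply to this step.
\<close>

lemma basin_a_exit:
  assumes \<sigma>: "\<sigma> \<in> basin_a" and \<eta>: "\<eta> \<in> hc_confs K L - basin_a" and q: "0 < connectivity K L \<sigma> \<eta>"
  shows "Hamiltonian K L (conf_a K L) + barrier K L \<le> max (Hamiltonian K L \<sigma>) (Hamiltonian K L \<eta>)"
proof (rule ccontr)
  assume low: "\<not> ?thesis"
  obtain A where A: "\<sigma> = cf A" "indep A" "2 * int K * int L - barrier_height \<le> int (card A)" "row_types A = {0}"
    using \<sigma> by (auto simp: basin_a_def)
  obtain B where B: "indep B" "\<eta> = cf B" using \<eta> by (auto elim: hc_cases)
  have sub: "A \<subseteq> sites K L" "B \<subseteq> sites K L" using A(2) B(1) by (auto simp: indep_def)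
  have "real (card (V 0)) = 2 * real K * real L"
    using arg_cong[OF card_V[of 0], of real_of_int] by simp
  then have "2 * real K * real L - real_of_int barrier_height - 1 < real (card B)"
    using low by (simp add: conf_cf barrier_eq A(1) B(2) Hamiltonian_cf sub V_sites max_def split: if_splits)
  then have "real_of_int (2 * int K * int L - barrier_height - 1) < real_of_int (int (card B))" by simp
  then have Bc: "2 * int K * int L - barrier_height \<le> int (card B)" by (simp only: of_int_less_iff)
  obtain v where "v \<notin> A \<and> B = insert v A \<or> v \<notin> B \<and> A = insert v B"
    using q connectivity_pos_iff[OF sub] A(1) B(2) by auto
  then have "row_types B = row_types A"
  proof (elim disjE conjE)
    assume v: "v \<notin> A" "B = insert v A"
    then have "A = B - {v}" "v \<in> B" by auto
    moreover have "card B = Suc (card A)" using v indep_finite[OF A(2)] by simp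
    ultimately show ?thesis using row_types_remove[OF B(1), of v] A(3) by (simp add: barrier_height_def)
  next
    assume v: "v \<notin> B" "A = insert v B"
    then have "B = A - {v}" "v \<in> A" by auto
    moreover have "card A = Suc (card B)" using v indep_finite[OF B(1)] by simp
    ultimately show ?thesis using row_types_remove[OF A(2), of v] Bc by (simp add: barrier_height_def)
  qed
  then have "\<eta> \<in> basin_a" using A(4) B Bc by (auto simp: basin_a_def)
  then show False using \<eta> by simp
qed

lemma basin_a_props: "basin_a \<subseteq> hc_confs K L" "conf_a K L \<in> basin_a" "conf_b K L \<notin> basin_a" "conf_c K L \<notin> basin_a"
proof -
  show "basin_a \<subseteq> hc_confs K L" using cf_hc by (auto simp: basin_a_def)
  show "conf_a K L \<in> basin_a"
    unfolding basin_a_def conf_cf using row_types_V[of 0] indep_V by (intro imageI) (auto simp: card_V barrier_height_def)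
  have "cf (V r) \<notin> basin_a" if "r \<in> {1, 2}" for r
  proof
    assume "cf (V r) \<in> basin_a"
    then obtain A where A: "cf (V r) = cf A" "indep A" "row_types A = {0}" by (auto simp: basin_a_def)
    then have "A = V r" using cf_inj[of "V r" A] V_sites by (auto simp: indep_def)
    then show False using A(3) row_types_V[of r] that by auto
  qed
  then show "conf_b K L \<notin> basin_a" "conf_c K L \<notin> basin_a" unfolding conf_cf by auto
qed

section \<open>Reflection symmetry and conclusion\<close>

text \<open>
  The reflection \<open>x \<mapsto> 2 - x\<close> exchanges the residues \<open>0\<close> and \<open>2\<close> modulo \<open>3\<close> and fixes \<open>1\<close>.
\<close>

definition mirror :: "site \<Rightarrow> site" where
  "mirror v = ((2 - fst v) mod (6 * int L), snd v)"

definition reflect :: "conf \<Rightarrow> conf" where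
  "reflect \<sigma> = (\<lambda>v\<in>sites K L. \<sigma> (mirror v))"

lemma mirror_pt: "mirror (pt x y) = pt (2 - x) y"
  by (simp add: mirror_def pt_def mod_simps)

lemma mirror_sites: "v \<in> sites K L \<Longrightarrow> mirror v \<in> sites K L"
  by (elim site_cases) (simp add: mirror_pt pt_in_sites)

lemma mirror_mirror: "v \<in> sites K L \<Longrightarrow> mirror (mirror v) = v"
  by (elim site_cases) (simp add: mirror_pt)

lemma mirror_bij: "bij_betw mirror (sites K L) (sites K L)"
  by (rule bij_betw_byWitness[of _ mirror]) (auto simp: mirror_mirror mirror_sites)

lemma mirror_neighbors:
  assumes "neighbors K L v w"
  shows "neighbors K L (mirror v) (mirror w)"
proof -
  have "v \<in> sites K L" using neighbors_sites[OF assms] by simp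
  then obtain x y where v: "v = pt x y" "even (x - y)" by (rule site_cases)
  then have "w \<in> nb x y" using assms by (simp add: neighbors_pt)
  moreover have "2 - (x + 2) = 2 - x - 2" "2 - (x - 2) = 2 - x + 2"
    "2 - (x + 1) = 2 - x - 1" "2 - (x - 1) = 2 - x + 1" by simp_all
  ultimately have "mirror w \<in> nb (2 - x) y" unfolding nb_def by (elim insertE) (simp_all add: mirror_pt)
  moreover have "even (2 - x - y)" using v(2) by simp
  ultimately show ?thesis unfolding v(1) mirror_pt by (simp add: neighbors_pt)
qed

lemma reflect_hc:
  assumes "\<sigma> \<in> hc_confs K L"
  shows "reflect \<sigma> \<in> hc_confs K L"
proof -
  have \<sigma>: "\<sigma> \<in> sites K L \<rightarrow>\<^sub>E {0, 1}" using assms unfolding hc_confs_def by blast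
  have "reflect \<sigma> \<in> sites K L \<rightarrow>\<^sub>E {0, 1}"
    unfolding reflect_def by (rule restrict_PiE_iff[THEN iffD2]) (use \<sigma> mirror_sites in blast)
  moreover have "reflect \<sigma> v * reflect \<sigma> w = 0" if vw: "neighbors K L v w" for v w
  proof -
    have "\<sigma> (mirror v) * \<sigma> (mirror w) = 0"
      using assms mirror_neighbors[OF vw] unfolding hc_confs_def by blast
    then show ?thesis using neighbors_sites[OF vw] by (simp add: reflect_def)
  qed
  ultimately show ?thesis unfolding hc_confs_def by blast
qed

lemma reflect_reflect:
  assumes "\<sigma> \<in> hc_confs K L"
  shows "reflect (reflect \<sigma>) = \<sigma>"
proof
  fix v
  have "\<sigma> \<in> sites K L \<rightarrow>\<^sub>E {0, 1}" using assms unfolding hc_confs_def by blast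
  then show "reflect (reflect \<sigma>) v = \<sigma> v"
    using PiE_arb[of \<sigma>] by (cases "v \<in> sites K L") (auto simp: reflect_def mirror_sites mirror_mirror)
qed

lemma reflect_bij: "bij_betw reflect (hc_confs K L) (hc_confs K L)"
  by (rule bij_betw_byWitness[of _ reflect]) (auto simp: reflect_reflect reflect_hc)

lemma reflect_Hamiltonian: "Hamiltonian K L (reflect \<sigma>) = Hamiltonian K L \<sigma>"
proof -
  have "(\<Sum>v\<in>sites K L. real (reflect \<sigma> v)) = (\<Sum>v\<in>sites K L. real (\<sigma> (mirror v)))"
    by (intro sum.cong) (auto simp: reflect_def)
  also have "\<dots> = (\<Sum>v\<in>sites K L. real (\<sigma> v))"
    by (rule sum.reindex_bij_betw[OF mirror_bij])
  finally show ?thesis by (simp add: Hamiltonian_def)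
qed

lemma reflect_connectivity: "connectivity K L (reflect \<sigma>) (reflect \<eta>) = connectivity K L \<sigma> \<eta>"
proof -
  have "bij_betw mirror {v \<in> sites K L. reflect \<sigma> v \<noteq> reflect \<eta> v} {v \<in> sites K L. \<sigma> v \<noteq> \<eta> v}"
    by (rule bij_betw_byWitness[of _ mirror]) (auto simp: reflect_def mirror_sites mirror_mirror)
  then show ?thesis unfolding connectivity_def by (simp add: bij_betw_same_card)
qed

lemma reflect_transition:
  assumes "\<sigma> \<in> hc_confs K L" "\<eta> \<in> hc_confs K L"
  shows "hardcore.transition \<beta> (reflect \<sigma>) (reflect \<eta>) = hardcore.transition \<beta> \<sigma> \<eta>"
proof (cases "\<sigma> = \<eta>")
  case False
  then have "reflect \<sigma> \<noteq> reflect \<eta>" using assms reflect_reflect by metis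
  then show ?thesis using False by (simp add: hardcore.transition_def reflect_connectivity reflect_Hamiltonian)
next
  case True
  have "bij_betw reflect (hc_confs K L - {\<sigma>}) (hc_confs K L - {reflect \<sigma>})"
  proof (rule bij_betw_byWitness[of _ reflect])
    have "reflect \<zeta> \<noteq> reflect \<sigma>" if "\<zeta> \<in> hc_confs K L" "\<zeta> \<noteq> \<sigma>" for \<zeta>
      using that reflect_reflect assms(1) by metis
    then show "reflect ` (hc_confs K L - {\<sigma>}) \<subseteq> hc_confs K L - {reflect \<sigma>}"
      by (auto simp: reflect_hc)
    have "reflect \<zeta> \<noteq> \<sigma>" if "\<zeta> \<in> hc_confs K L" "\<zeta> \<noteq> reflect \<sigma>" for \<zeta>
      using that reflect_reflect by metis
    then show "reflect ` (hc_confs K L - {reflect \<sigma>}) \<subseteq> hc_confs K L - {\<sigma>}"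
      by (auto simp: reflect_hc)
  qed (auto simp: reflect_reflect)
  then show ?thesis
    using True sum.reindex_bij_betw[of reflect "hc_confs K L - {\<sigma>}" "hc_confs K L - {reflect \<sigma>}"
      "\<lambda>\<zeta>. connectivity K L (reflect \<sigma>) \<zeta> * exp (- \<beta> * max 0 (Hamiltonian K L \<zeta> - Hamiltonian K L (reflect \<sigma>)))"]
    by (simp add: hardcore.transition_def reflect_connectivity reflect_Hamiltonian)
qed

lemma reflect_ground: "reflect (cf (V r)) = cf (V (2 - r))"
proof
  fix v
  show "reflect (cf (V r)) v = cf (V (2 - r)) v"
  proof (cases "v \<in> sites K L")
    case True
    then obtain x y where v: "v = pt x y" "even (x - y)" by (rule site_cases)
    have "even (2 - x - y)" using v(2) by simp
    moreover have "[2 - x = r] (mod 3) \<longleftrightarrow> [x = 2 - r] (mod 3)"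
      unfolding cong_iff_dvd_diff by presburger
    ultimately have "mirror v \<in> V r \<longleftrightarrow> v \<in> V (2 - r)" using v by (simp add: mirror_pt pt_in_V)
    then show ?thesis using True by (simp add: reflect_def cf_apply mirror_sites)
  next
    case False
    then show ?thesis by (simp add: reflect_def indicator_conf_def)
  qed
qed

text \<open>
  This is why the hitting time of \<open>b\<close> is asymptotically exponential although the chain may stay for a
  long time in \<open>c\<close> on its way: it does not matter in which of \<open>a\<close> and \<open>c\<close> the chain is.
\<close>

lemma survival_b_symmetric:
  assumes "0 < \<beta>"
  shows "hardcore.survival \<beta> {conf_b K L} t (conf_c K L) = hardcore.survival \<beta> {conf_b K L} t (conf_a K L)"
proof -
  interpret reversible_chain "hc_confs K L" "hardcore.transition \<beta>" "\<lambda>\<sigma>. exp (- \<beta> * Hamiltonian K L \<sigma>)"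
    using assms by (rule hardcore.reversible)
  have b: "reflect (conf_b K L) = conf_b K L" "reflect (conf_a K L) = conf_c K L"
    using reflect_ground[of 1] reflect_ground[of 0] by (simp_all add: conf_cf)
  have a: "conf_a K L \<in> hc_confs K L" using basin_a_props by blast
  have "hardcore.survival \<beta> {conf_b K L} t (reflect (conf_a K L)) = hardcore.survival \<beta> {conf_b K L} t (conf_a K L)"
  proof (rule surv_symmetry[OF reflect_bij reflect_transition _ a])
    show "reflect \<sigma> \<in> {conf_b K L} \<longleftrightarrow> \<sigma> \<in> {conf_b K L}" if "\<sigma> \<in> hc_confs K L" for \<sigma>
      using b(1) reflect_reflect[OF that] by (metis singleton_iff)
  qed
  then show ?thesis using b by simp
qed

lemma metastable_a:
  assumes T: "conf_a K L \<in> T" "T \<subseteq> {conf_a K L, conf_c K L}" and AT: "A \<union> T = {conf_a K L, conf_b K L, conf_c K L}"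
    and A: "conf_b K L \<in> A" "A \<subseteq> {conf_b K L, conf_c K L}"
    and law: "\<And>\<beta> t \<eta>. 0 < \<beta> \<Longrightarrow> \<eta> \<in> T \<Longrightarrow> hardcore.survival \<beta> A t \<eta> = hardcore.survival \<beta> A t (conf_a K L)"
  shows "metastable (hc_confs K L) (Hamiltonian K L) (connectivity K L) (conf_a K L) T A basin_a
    (barrier K L) (real_of_int barrier_height)"
proof
  show "conf_a K L \<in> T" by (rule T(1))
  show "T \<subseteq> hc_confs K L" using T(2) cf_hc indep_V by (auto simp: conf_cf)
  show "0 \<le> real_of_int barrier_height" by (simp add: barrier_height_def)
  show "real_of_int barrier_height < barrier K L" by (simp add: barrier_eq)
  show "\<exists>\<eta>\<in>A. (hardcore.link (Hamiltonian K L \<sigma> + barrier K L))\<^sup>*\<^sup>* \<sigma> \<eta>" if "\<sigma> \<in> hc_confs K L" for \<sigma>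
    using path_to_b[OF that] A(1) by blast
  show "\<exists>\<eta>\<in>A \<union> T. (hardcore.link (Hamiltonian K L \<sigma> + real_of_int barrier_height))\<^sup>*\<^sup>* \<sigma> \<eta>" if "\<sigma> \<in> hc_confs K L" for \<sigma>
    unfolding AT using that by (rule path_to_grounds)
  show "basin_a \<subseteq> hc_confs K L" "conf_a K L \<in> basin_a" by (rule basin_a_props)+
  show "A \<inter> basin_a = {}" using A(2) basin_a_props by blast
qed (use basin_a_exit law in blast)+

end

text \<open>
  The general results apply with target \<open>{b, c}\<close> and \<open>T = {a}\<close>, and with target \<open>{b}\<close> and \<open>T = {a, c}\<close>. In
  both cases \<open>A \<union> T\<close> consists of the three ground states.
\<close>

theorem theorem2p1:
  fixes K L :: nat
    and M :: "real \<Rightarrow> 'w measure"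
    and X :: "real \<Rightarrow> nat \<Rightarrow> 'w \<Rightarrow> conf"
  assumes "K \<ge> 2" and "L \<ge> 1"
    and "\<And>\<beta>. \<beta> > 0 \<Longrightarrow> metropolis_chain K L \<beta> (conf_a K L) (M \<beta>) (X \<beta>)"
  shows "let \<tau>\<^sub>b = (\<lambda>\<beta>. hitting_time (X \<beta>) {conf_b K L});
             \<tau>\<^sub>b\<^sub>c = (\<lambda>\<beta>. hitting_time (X \<beta>) {conf_b K L, conf_c K L})
         in
           (\<forall>\<epsilon>>0. ((\<lambda>\<beta>. \<P>(\<omega> in M \<beta>.
               ennreal (exp (\<beta> * (barrier K L - \<epsilon>))) \<le> ennreal_of_enat (\<tau>\<^sub>b\<^sub>c \<beta> \<omega>) \<and>
               \<tau>\<^sub>b\<^sub>c \<beta> \<omega> \<le> \<tau>\<^sub>b \<beta> \<omega> \<and>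
               ennreal_of_enat (\<tau>\<^sub>b \<beta> \<omega>) \<le> ennreal (exp (\<beta> * (barrier K L + \<epsilon>))))) \<longlongrightarrow> 1) at_top) \<and>
           ((\<lambda>\<beta>. log_expected_rate \<beta> (M \<beta>) (\<tau>\<^sub>b \<beta>)) \<longlongrightarrow> barrier K L) at_top \<and>
           ((\<lambda>\<beta>. log_expected_rate \<beta> (M \<beta>) (\<tau>\<^sub>b\<^sub>c \<beta>)) \<longlongrightarrow> barrier K L) at_top \<and>
           conv_in_distr_at_top M (\<lambda>\<beta>. normalized_time (M \<beta>) (\<tau>\<^sub>b\<^sub>c \<beta>)) Exp1 \<and>
           conv_in_distr_at_top M (\<lambda>\<beta>. normalized_time (M \<beta>) (\<tau>\<^sub>b \<beta>)) Exp1"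
proof -
  interpret grid K L using assms(1,2) by unfold_locales
  have mc: "markov_chain (hc_confs K L) (hardcore.transition \<beta>) (conf_a K L) (M \<beta>) (X \<beta>)" if "0 < \<beta>" for \<beta>
    using assms(3)[OF that] by (simp add: metropolis_chain_def transition_eq)
  let ?S = "hc_confs K L" and ?H = "Hamiltonian K L" and ?q = "connectivity K L"
  let ?a = "conf_a K L" and ?b = "conf_b K L" and ?c = "conf_c K L"
  interpret bc: metastable_chain ?S ?H ?q ?a "{?a}" "{?b, ?c}" basin_a "barrier K L" "real_of_int barrier_height" M X
    unfolding metastable_chain_def metastable_chain_axioms_def
    using metastable_a[of "{?a}" "{?b, ?c}"] mc by auto
  interpret b: metastable_chain ?S ?H ?q ?a "{?a, ?c}" "{?b}" basin_a "barrier K L" "real_of_int barrier_height" M X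
    unfolding metastable_chain_def metastable_chain_axioms_def
    using metastable_a[of "{?a, ?c}" "{?b}"] survival_b_symmetric mc by auto
  have window: "((\<lambda>\<beta>. \<P>(\<omega> in M \<beta>.
      ennreal (exp (\<beta> * (barrier K L - \<epsilon>))) \<le> ennreal_of_enat (bc.\<tau> \<beta> \<omega>) \<and> bc.\<tau> \<beta> \<omega> \<le> b.\<tau> \<beta> \<omega> \<and>
      ennreal_of_enat (b.\<tau> \<beta> \<omega>) \<le> ennreal (exp (\<beta> * (barrier K L + \<epsilon>))))) \<longlongrightarrow> 1) at_top"
    if "0 < \<epsilon>" for \<epsilon>
  proof -
    let ?E = "\<lambda>\<beta> \<omega>. ennreal (exp (\<beta> * (barrier K L - \<epsilon>))) \<le> ennreal_of_enat (bc.\<tau> \<beta> \<omega>)"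
    let ?F = "\<lambda>\<beta> \<omega>. ennreal_of_enat (b.\<tau> \<beta> \<omega>) \<le> ennreal (exp (\<beta> * (barrier K L + \<epsilon>)))"
    have le: "bc.\<tau> \<beta> \<omega> \<le> b.\<tau> \<beta> \<omega>" for \<beta> \<omega> by (rule hitting_time_antimono) auto
    show ?thesis
    proof (rule tendsto_sandwich[OF _ _ _ tendsto_const])
      show "((\<lambda>\<beta>. \<P>(\<omega> in M \<beta>. ?E \<beta> \<omega>) + \<P>(\<omega> in M \<beta>. ?F \<beta> \<omega>) - 1) \<longlongrightarrow> 1) at_top"
        using tendsto_diff[OF tendsto_add[OF bc.\<tau>_lower[OF that] b.\<tau>_upper[OF that]] tendsto_const, of 1] by simp
      show "\<forall>\<^sub>F \<beta> in at_top. \<P>(\<omega> in M \<beta>. ?E \<beta> \<omega>) + \<P>(\<omega> in M \<beta>. ?F \<beta> \<omega>) - 1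
          \<le> \<P>(\<omega> in M \<beta>. ?E \<beta> \<omega> \<and> bc.\<tau> \<beta> \<omega> \<le> b.\<tau> \<beta> \<omega> \<and> ?F \<beta> \<omega>)"
        using eventually_gt_at_top[of 0]
      proof eventually_elim
        case (elim \<beta>)
        interpret prob_space "M \<beta>" using elim by (rule bc.prob_M)
        note bc.\<tau>_measurable[OF elim, measurable] b.\<tau>_measurable[OF elim, measurable]
        have sets: "{\<omega> \<in> space (M \<beta>). ?E \<beta> \<omega>} \<in> events" "{\<omega> \<in> space (M \<beta>). ?F \<beta> \<omega>} \<in> events"
          by measurable
        have "prob {\<omega> \<in> space (M \<beta>). ?E \<beta> \<omega>} + prob {\<omega> \<in> space (M \<beta>). ?F \<beta> \<omega>}
            = prob ({\<omega> \<in> space (M \<beta>). ?E \<beta> \<omega>} \<union> {\<omega> \<in> space (M \<beta>). ?F \<beta> \<omega>})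
            + prob ({\<omega> \<in> space (M \<beta>). ?E \<beta> \<omega>} \<inter> {\<omega> \<in> space (M \<beta>). ?F \<beta> \<omega>})"
          using sets by (subst measure_Un3) (auto simp: fmeasurable_eq_sets)
        moreover have "{\<omega> \<in> space (M \<beta>). ?E \<beta> \<omega>} \<inter> {\<omega> \<in> space (M \<beta>). ?F \<beta> \<omega>}
            = {\<omega> \<in> space (M \<beta>). ?E \<beta> \<omega> \<and> bc.\<tau> \<beta> \<omega> \<le> b.\<tau> \<beta> \<omega> \<and> ?F \<beta> \<omega>}"
          using le by auto
        moreover have "prob ({\<omega> \<in> space (M \<beta>). ?E \<beta> \<omega>} \<union> {\<omega> \<in> space (M \<beta>). ?F \<beta> \<omega>}) \<le> 1"
          by (rule prob_le_1)
        ultimately show ?case by simp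
      qed
      show "\<forall>\<^sub>F \<beta> in at_top. \<P>(\<omega> in M \<beta>. ?E \<beta> \<omega> \<and> bc.\<tau> \<beta> \<omega> \<le> b.\<tau> \<beta> \<omega> \<and> ?F \<beta> \<omega>) \<le> 1"
        using eventually_gt_at_top[of 0] by eventually_elim (intro prob_space.prob_le_1 bc.prob_M)
    qed
  qed
  show ?thesis
    unfolding Let_def
    using window b.log_expected_rate_tendsto bc.log_expected_rate_tendsto
      bc.normalized_time_conv b.normalized_time_conv by blast
qed

end
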